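(* Let $k$ be a field, let $n,s$ be positive integers, and let $m$ be the $\mathrm{char}(k)$-free part of $n$. (a) We have $$s_n(k[[x_1,\dots,x_s]])=s_n(k((x_1,\dots,x_s)))=s_n(k((x_1))\dots((x_s)))=s_m(k).$$ (b) If $s_n(k)<\infty$, then $$w_n(k[[x_1,\dots,x_s]])=\begin{cases}\max\{w_m(k),\,s_m(k)+1\} & \text{if } m>1,\\ 1 & \text{if } m=1,\end{cases}$$ $$w_n(k((x_1,\dots,x_s)))=w_n(k((x_1))\dots((x_s)))=\begin{cases}s_m(k)+1 & \text{if } m>1,\\ 1 & \text{if } m=1,\end{cases}$$ $$w_n(k((x_1))\dots((x_s))[[x_{s+1}]])=\begin{cases}s_m(k)+1 & \text{if } m>1,\\ 1 & \text{if } m=1.\end{cases}$$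
   Context: For a commutative ring $A$ and a positive integer $n$: the $n$th level $s_n(A)$ is the smallest positive integer $g$ such that $-1$ is a sum of $g$ $n$th powers of elements of $A$ ($\infty$ if none); the $n$th Waring number $w_n(A)$ is the smallest positive integer $g$ such that every element of $A$ that is a sum of (finitely many) $n$th powers is a sum of at most $g$ $n$th powers ($\infty$ if none). For a prime $p$ and $n=p^{j}m$ with $p\nmid m$, $j\ge 0$, the $p$-free part of $n$ is $m$; the $0$-free part of $n$ is $n$ itself. $k[[x_1,\dots,x_s]]$ is the ring of formal power series, $k((x_1,\dots,x_s))$ is its field of fractions, and $k((x_1))\dots((x_s))$ is the field of iterated formal Laurent series. *)

theory Defs
  imports
    "HOL-Algebra.Algebra"
    "HOL-Library.Multiset"
    "HOL-Library.Extended_Nat"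
    "HOL-Computational_Algebra.Primes"
begin

section \<open>Sums of powers, levels and Waring numbers\<close>

definition is_sum_of_powers :: "('a, 'b) ring_scheme \<Rightarrow> nat \<Rightarrow> nat \<Rightarrow> 'a \<Rightarrow> bool" where
  "is_sum_of_powers R n g x \<longleftrightarrow>
     (\<exists>a :: nat \<Rightarrow> 'a. (\<forall>i<g. a i \<in> carrier R) \<and> x = (\<Oplus>\<^bsub>R\<^esub>i\<in>{..<g}. a i [^]\<^bsub>R\<^esub> n))"

text \<open>The infimum of the empty set is \<open>\<infinity>\<close> in \<^typ>\<open>enat\<close>, and the infimum of a
  nonempty set is attained.\<close>

definition level :: "nat \<Rightarrow> ('a, 'b) ring_scheme \<Rightarrow> enat" where
  "level n R = Inf {enat g |g. g > 0 \<and> is_sum_of_powers R n g (\<ominus>\<^bsub>R\<^esub> \<one>\<^bsub>R\<^esub>)}"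

definition waring_number :: "nat \<Rightarrow> ('a, 'b) ring_scheme \<Rightarrow> enat" where
  "waring_number n R =
     Inf {enat g |g. g > 0 \<and>
            (\<forall>x h. is_sum_of_powers R n h x \<longrightarrow> (\<exists>h'\<le>g. is_sum_of_powers R n h' x))}"


section \<open>Characteristic and free part\<close>

text \<open>The analogue, for rings with a carrier, of \<open>CHAR('a)\<close>.\<close>

definition ring_char :: "('a, 'b) ring_scheme \<Rightarrow> nat" where
  "ring_char R = Gcd {n :: nat. [n] \<cdot>\<^bsub>R\<^esub> \<one>\<^bsub>R\<^esub> = \<zero>\<^bsub>R\<^esub>}"

definition free_part :: "nat \<Rightarrow> nat \<Rightarrow> nat" where
  "free_part p n = (if p = 0 then n else n div p ^ multiplicity p n)"

lemma free_partI:
  assumes "Factorial_Ring.prime p" and "n = p ^ j * m" and "\<not> p dvd m"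
  shows "free_part p n = m"
proof -
  have "multiplicity p n = j"
    using assms by (auto intro!: multiplicity_eqI simp: dvd_mult_cancel_left)
  with assms show ?thesis
    by (auto simp: free_part_def prime_gt_0_nat)
qed


section \<open>Power series\<close>

text \<open>Formal power series over \<open>R\<close> in the variables \<open>x\<^sub>v\<close>, for \<open>v\<close> in a finite set \<open>I\<close>.
  As in \<^theory>\<open>HOL-Algebra.Indexed_Polynomials\<close>, a monomial is a multiset of variables
  and a series maps each monomial to its coefficient.\<close>

definition power_series_ring ::
    "('a, 'b) ring_scheme \<Rightarrow> 'v set \<Rightarrow> ('v multiset \<Rightarrow> 'a) ring" where
  "power_series_ring R I =
     \<lparr> carrier = {f. range f \<subseteq> carrier R \<and> (\<forall>e. \<not> set_mset e \<subseteq> I \<longrightarrow> f e = \<zero>\<^bsub>R\<^esub>)},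
       monoid.mult = (\<lambda>f g e. \<Oplus>\<^bsub>R\<^esub>d\<in>{d. d \<subseteq># e}. f d \<otimes>\<^bsub>R\<^esub> g (e - d)),
       one = (\<lambda>e. if e = {#} then \<one>\<^bsub>R\<^esub> else \<zero>\<^bsub>R\<^esub>),
       ring.zero = (\<lambda>e. \<zero>\<^bsub>R\<^esub>),
       add = (\<lambda>f g e. f e \<oplus>\<^bsub>R\<^esub> g e) \<rparr>"


section \<open>Fraction field of an integral domain\<close>

definition frac_rel :: "('a, 'b) ring_scheme \<Rightarrow> (('a \<times> 'a) \<times> ('a \<times> 'a)) set" where
  "frac_rel R = {((a, b), (c, d)) |a b c d.
     a \<in> carrier R \<and> b \<in> carrier R - {\<zero>\<^bsub>R\<^esub>} \<and> c \<in> carrier R \<and> d \<in> carrier R - {\<zero>\<^bsub>R\<^esub>} \<and>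
     a \<otimes>\<^bsub>R\<^esub> d = c \<otimes>\<^bsub>R\<^esub> b}"

definition frac_class :: "('a, 'b) ring_scheme \<Rightarrow> 'a \<Rightarrow> 'a \<Rightarrow> ('a \<times> 'a) set" where
  "frac_class R a b = frac_rel R `` {(a, b)}"

definition fraction_field :: "('a, 'b) ring_scheme \<Rightarrow> ('a \<times> 'a) set ring" where
  "fraction_field R =
     \<lparr> carrier = (carrier R \<times> (carrier R - {\<zero>\<^bsub>R\<^esub>})) // frac_rel R,
       monoid.mult = (\<lambda>P Q. \<Union>(a, b)\<in>P. \<Union>(c, d)\<in>Q. frac_class R (a \<otimes>\<^bsub>R\<^esub> c) (b \<otimes>\<^bsub>R\<^esub> d)),
       one = frac_class R \<one>\<^bsub>R\<^esub> \<one>\<^bsub>R\<^esub>,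
       ring.zero = frac_class R \<zero>\<^bsub>R\<^esub> \<one>\<^bsub>R\<^esub>,
       add = (\<lambda>P Q. \<Union>(a, b)\<in>P. \<Union>(c, d)\<in>Q.
                frac_class R (a \<otimes>\<^bsub>R\<^esub> d \<oplus>\<^bsub>R\<^esub> c \<otimes>\<^bsub>R\<^esub> b) (b \<otimes>\<^bsub>R\<^esub> d)) \<rparr>"


section \<open>Iterated Laurent series\<close>

text \<open>In the product, the terms with a zero factor are left out so that the sum is finite.\<close>

definition laurent_ring :: "('a, 'b) ring_scheme \<Rightarrow> (int \<Rightarrow> 'a) ring" where
  "laurent_ring R =
     \<lparr> carrier = {f. range f \<subseteq> carrier R \<and> (\<exists>N. \<forall>i<N. f i = \<zero>\<^bsub>R\<^esub>)},
       monoid.mult = (\<lambda>f g i. \<Oplus>\<^bsub>R\<^esub>j\<in>{j. f j \<noteq> \<zero>\<^bsub>R\<^esub> \<and> g (i - j) \<noteq> \<zero>\<^bsub>R\<^esub>}. f j \<otimes>\<^bsub>R\<^esub> g (i - j)),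
       one = (\<lambda>i. if i = 0 then \<one>\<^bsub>R\<^esub> else \<zero>\<^bsub>R\<^esub>),
       ring.zero = (\<lambda>i. \<zero>\<^bsub>R\<^esub>),
       add = (\<lambda>f g i. f i \<oplus>\<^bsub>R\<^esub> g i) \<rparr>"

text \<open>Each application of \<^const>\<open>laurent_ring\<close> changes the type of the elements. To iterate it,
  every step is transported by \<^const>\<open>image_ring\<close> along an injection into functions on
  exponent lists: an element \<open>f\<close> of the \<open>s\<close>-fold iteration has at
  \<open>x\<^sub>1\<^bsup>i\<^sub>1\<^esup> \<dots> x\<^sub>s\<^bsup>i\<^sub>s\<^esup>\<close> the coefficient \<open>f [i\<^sub>s, \<dots>, i\<^sub>1]\<close>, and is zero on lists of
  any length other than \<open>s\<close>.\<close>

definition const_list :: "('a, 'b) ring_scheme \<Rightarrow> 'a \<Rightarrow> (int list \<Rightarrow> 'a)" where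
  "const_list k c = (\<lambda>l. case l of [] \<Rightarrow> c | _ # _ \<Rightarrow> \<zero>\<^bsub>k\<^esub>)"

definition uncurry_list ::
    "('a, 'b) ring_scheme \<Rightarrow> (int \<Rightarrow> int list \<Rightarrow> 'a) \<Rightarrow> (int list \<Rightarrow> 'a)" where
  "uncurry_list k F = (\<lambda>l. case l of [] \<Rightarrow> \<zero>\<^bsub>k\<^esub> | i # l' \<Rightarrow> F i l')"

primrec iterated_laurent ::
    "('a, 'b) ring_scheme \<Rightarrow> nat \<Rightarrow> (int list \<Rightarrow> 'a) ring" where
  "iterated_laurent k 0 = image_ring (const_list k) k"
| "iterated_laurent k (Suc s) = image_ring (uncurry_list k) (laurent_ring (iterated_laurent k s))"

lemma inj_const_list: "inj (const_list k)"
  by (rule injI) (metis const_list_def list.simps(4))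

lemma inj_uncurry_list: "inj (uncurry_list k)"
proof (rule injI)
  fix F G assume "uncurry_list k F = uncurry_list k G"
  then have "uncurry_list k F (i # l) = uncurry_list k G (i # l)" for i l
    by simp
  then show "F = G"
    by (auto simp: uncurry_list_def)
qed

lemma iterated_laurent_0_iso: "const_list k \<in> ring_iso k (iterated_laurent k 0)"
  by (simp add: inj_imp_image_ring_iso inj_on_subset[OF inj_const_list])

lemma iterated_laurent_Suc_iso:
  "uncurry_list k \<in> ring_iso (laurent_ring (iterated_laurent k s)) (iterated_laurent k (Suc s))"
  by (simp add: inj_imp_image_ring_iso inj_on_subset[OF inj_uncurry_list])

end

theory Submission
  imports Defs
begin

text \<open>In characteristic \<open>p\<close> the Frobenius map turns sums of \<open>m\<close>-th powers into sums of
  \<open>p\<^sup>jm\<close>-th powers, so in a domain only the exponent \<open>m\<close> prime to the characteristic matters.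
  For such \<open>m\<close>, a power series \<open>h\<close> without constant term satisfies \<open>1 + h = u\<^sup>m\<close> for some
  \<open>u\<close>, so \<open>h = u\<^sup>m + (-1)\<close> is a sum of \<open>s\<^sub>m(k) + 1\<close> powers; multiplying by \<open>m\<close>-th powers, this
  carries over to all elements of the fraction field and of the Laurent series field.
  Conversely, if fewer than \<open>s\<^sub>m(K) + 1\<close> \<open>m\<close>-th powers are added in \<open>K((x))\<close>, their leading
  coefficients cannot cancel, so the sum has valuation divisible by \<open>m\<close> and is not \<open>x\<close> if
  \<open>m > 1\<close>.
  The power series ring and its fraction field inherit this lower bound by embedding into
  iterated Laurent series.\<close>

text \<open>The obstacle is the fraction field for \<open>s > 1\<close>: its elements have no
  leading coefficient, so valuations cannot be used on it directly. Everything there is read off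
  from an injective homomorphism of the power series ring into Laurent series in \<open>x_s\<close>
  over the \<open>(s-1)\<close>-fold iterated field. The last step is kept as a
  \<open>laurent_ring\<close> because the lower bound needs a variable whose image is a uniformizer.
  The same injection supplies the ring axioms of the fraction field and the absence of zero
  divisors. The upper bound divides by \<open>m\<close> when \<open>u^m = 1 + h\<close> is solved
  coefficient by coefficient, which is why the exponent must first lose its \<open>p\<close>-part.
  The term \<open>w_m(k)\<close> in the maximum occurs only for power series: a nonzero constant
  term cannot be scaled away there, whereas in the fields multiplication by a suitable
  \<open>m\<close>-th power makes the constant term zero. For \<open>m > 1\<close> the field
  \<open>k((x_1))...((x_s))\<close> already has Waring number \<open>s_m(k) + 1\<close>, so over it
  the maximum collapses.\<close>

section \<open>Finite sums, the binomial theorem and the Frobenius map\<close>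

lemma (in abelian_monoid) finsum_Sigma:
  assumes "finite A" and "\<And>x. x \<in> A \<Longrightarrow> finite (B x)"
    and "\<And>x y. x \<in> A \<Longrightarrow> y \<in> B x \<Longrightarrow> f x y \<in> carrier G"
  shows "(\<Oplus>x\<in>A. \<Oplus>y\<in>B x. f x y) = (\<Oplus>z\<in>Sigma A B. f (fst z) (snd z))"
  using assms
proof (induction A rule: finite_induct)
  case (insert a A)
  have "(\<Oplus>z\<in>Sigma (insert a A) B. f (fst z) (snd z)) =
    (\<Oplus>z\<in>Pair a ` B a \<union> Sigma A B. f (fst z) (snd z))"
    by (rule arg_cong[where f = "finsum G _"]) auto
  also have "\<dots> = (\<Oplus>z\<in>Pair a ` B a. f (fst z) (snd z)) \<oplus> (\<Oplus>z\<in>Sigma A B. f (fst z) (snd z))"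
    using insert by (intro finsum_Un_disjoint) (auto simp: image_iff)
  also have "(\<Oplus>z\<in>Pair a ` B a. f (fst z) (snd z)) = (\<Oplus>y\<in>B a. f a y)"
    using insert.prems by (subst finsum_reindex) (auto simp: inj_on_def)
  finally show ?case
    using insert by (subst finsum_insert) (auto intro!: finsum_closed)
qed simp

context cring
begin

lemma binomial_theorem:
  assumes "a \<in> carrier R" "b \<in> carrier R"
  shows "(a \<oplus> b) [^] (n::nat) = (\<Oplus>i\<in>{..n}. add_pow R (n choose i) (a [^] i \<otimes> b [^] (n - i)))"
proof (induction n)
  case 0
  then show ?case using assms by simp
next
  case (Suc n)
  let ?t = "\<lambda>n i. add_pow R (n choose i) (a [^] i \<otimes> b [^] (n - i))"
  let ?u = "\<lambda>i. add_pow R (n choose i) (a [^] i \<otimes> b [^] (Suc n - i))"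
  let ?v = "\<lambda>i. add_pow R (n choose i) (a [^] Suc i \<otimes> b [^] (n - i))"
  have b: "(\<Oplus>i\<in>{..n}. ?t n i) \<otimes> b = (\<Oplus>i\<in>{..Suc n}. ?u i)"
  proof -
    have "(\<Oplus>i\<in>{..n}. ?t n i) \<otimes> b = (\<Oplus>i\<in>{..n}. ?u i)"
      using assms by (subst finsum_ldistr)
        (auto intro!: finsum_cong' simp: add_pow_ldistr Suc_diff_le m_assoc)
    \<comment> \<open>The added term has coefficient \<open>n choose Suc n\<close>, which is zero;
      with the longer range the index 0 can be split off and the rest shifted.\<close>
    also have "\<dots> = (\<Oplus>i\<in>{..Suc n}. ?u i)"
      using assms by (intro add.finprod_mono_neutral_cong_left) (auto simp: le_Suc_eq binomial_eq_0)
    finally show ?thesis .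
  qed
  have a: "(\<Oplus>i\<in>{..n}. ?t n i) \<otimes> a = (\<Oplus>i\<in>{..n}. ?v i)"
    using assms by (subst finsum_ldistr)
      (auto intro!: finsum_cong' simp: add_pow_ldistr add_pow_rdistr m_ac)
  have "(a \<oplus> b) [^] Suc n = (\<Oplus>i\<in>{..n}. ?v i) \<oplus> (\<Oplus>i\<in>{..Suc n}. ?u i)"
    using assms by (simp add: Suc r_distr a b finsum_closed)
  also have "(\<Oplus>i\<in>{..Suc n}. ?u i) = (\<Oplus>i\<in>{..n}. ?u (Suc i)) \<oplus> ?u 0"
    using assms by (intro finsum_Suc2) auto
  also have "(\<Oplus>i\<in>{..n}. ?v i) \<oplus> ((\<Oplus>i\<in>{..n}. ?u (Suc i)) \<oplus> ?u 0) =
      (\<Oplus>i\<in>{..n}. ?v i \<oplus> ?u (Suc i)) \<oplus> ?u 0"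
    using assms by (subst finsum_addf) (auto simp: a_assoc intro!: finsum_closed)
  also have "(\<Oplus>i\<in>{..n}. ?v i \<oplus> ?u (Suc i)) = (\<Oplus>i\<in>{..n}. ?t (Suc n) (Suc i))"
    using assms by (auto intro!: finsum_cong' simp: add.nat_pow_mult)
  also have "\<dots> \<oplus> ?u 0 = (\<Oplus>i\<in>{..Suc n}. ?t (Suc n) i)"
    using assms by (subst finsum_Suc2) auto
  finally show ?case .
qed

lemma freshman_prime:
  assumes p: "Factorial_Ring.prime (p::nat)" and char: "add_pow R p \<one> = \<zero>"
    and ab: "a \<in> carrier R" "b \<in> carrier R"
  shows "(a \<oplus> b) [^] p = a [^] p \<oplus> b [^] p"
proof -
  have p0: "p > 0" using p by (simp add: prime_gt_0_nat)
  \<comment> \<open>Only \<open>one\<close> is assumed to be killed by \<open>p\<close>; multiplying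
    by \<open>x\<close> spreads this to the whole ring, so every binomial coefficient divisible by
    \<open>p\<close> kills its term.\<close>
  have mult: "add_pow R (p * c) x = \<zero>" if "x \<in> carrier R" for c :: nat and x
  proof -
    have "add_pow R p x = (add_pow R p \<one>) \<otimes> x"
      using that by (subst add_pow_ldistr) auto
    then show ?thesis
      using that char by (simp flip: add.nat_pow_pow)
  qed
  let ?t = "\<lambda>i. add_pow R (p choose i) (a [^] i \<otimes> b [^] (p - i))"
  have "?t i = \<zero>" if "i \<in> {..p} - {0, p}" for i
  proof -
    have "p dvd p choose i" using that p by (intro dvd_choose_prime) auto
    then show ?thesis using ab mult by (auto elim!: dvdE)
  qed
  then have "(\<Oplus>i\<in>{..p}. ?t i) = (\<Oplus>i\<in>{0, p}. ?t i)"
    using ab by (intro add.finprod_mono_neutral_cong_right) auto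
  also have "\<dots> = a [^] p \<oplus> b [^] p"
    using ab p0 by (simp add: a_comm)
  finally show ?thesis using binomial_theorem[OF ab] by simp
qed

lemma freshman:
  assumes p: "Factorial_Ring.prime (p::nat)" and char: "add_pow R p \<one> = \<zero>"
    and ab: "a \<in> carrier R" "b \<in> carrier R"
  shows "(a \<oplus> b) [^] (p ^ j) = a [^] (p ^ j) \<oplus> b [^] (p ^ j)"
proof (induction j)
  case (Suc j)
  have "(a \<oplus> b) [^] (p ^ Suc j) = ((a \<oplus> b) [^] (p ^ j)) [^] p"
    using ab by (simp add: nat_pow_pow mult.commute)
  also have "\<dots> = (a [^] (p ^ j)) [^] p \<oplus> (b [^] (p ^ j)) [^] p"
    using ab freshman_prime[OF p char] by (simp add: Suc)
  finally show ?case
    using ab by (simp add: nat_pow_pow mult.commute)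
qed (use ab in simp)

end

section \<open>Sums of powers\<close>

context cring
begin

lemma is_sum_of_powers_closed: "is_sum_of_powers R n g x \<Longrightarrow> x \<in> carrier R"
  by (auto simp: is_sum_of_powers_def intro!: finsum_closed)

lemma is_sum_of_powers_0_iff: "is_sum_of_powers R n 0 x \<longleftrightarrow> x = \<zero>"
  by (simp add: is_sum_of_powers_def)

text \<open>Summands may be indexed by any finite set, which is needed once an index has been
  removed from an initial segment.\<close>

lemma is_sum_of_powers_finsum:
  assumes "finite A" "a \<in> A \<rightarrow> carrier R"
  shows "is_sum_of_powers R n (card A) (\<Oplus>i\<in>A. a i [^] n)"
proof -
  from \<open>finite A\<close> obtain h where h: "bij_betw h {..<card A} A"
    using ex_bij_betw_nat_finite[of A] by (auto simp: atLeast0LessThan)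
  have "(\<Oplus>i\<in>h ` {..<card A}. a i [^] n) = (\<Oplus>i\<in>{..<card A}. a (h i) [^] n)"
    using h assms by (intro finsum_reindex) (auto simp: bij_betw_def)
  moreover have "\<forall>i<card A. a (h i) \<in> carrier R"
    using h assms by (auto simp: bij_betw_def)
  ultimately show ?thesis
    using h unfolding is_sum_of_powers_def bij_betw_def by (intro exI[of _ "a \<circ> h"]) auto
qed

text \<open>Splitting off one summand replaces explicit families by an induction on the number of
  powers.\<close>

lemma is_sum_of_powers_Suc_iff:
  "is_sum_of_powers R n (Suc g) x \<longleftrightarrow>
    (\<exists>a\<in>carrier R. \<exists>y. is_sum_of_powers R n g y \<and> x = a [^] n \<oplus> y)"
  (is "?L \<longleftrightarrow> ?R")
proof
  assume ?L
  then obtain a where a: "\<forall>i<Suc g. a i \<in> carrier R" "x = (\<Oplus>i\<in>{..<Suc g}. a i [^] n)"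
    by (auto simp: is_sum_of_powers_def)
  then have "x = a g [^] n \<oplus> (\<Oplus>i\<in>{..<g}. a i [^] n)"
    by (auto simp: lessThan_Suc intro!: finsum_insert)
  moreover have "is_sum_of_powers R n g (\<Oplus>i\<in>{..<g}. a i [^] n)"
    using a unfolding is_sum_of_powers_def by (intro exI[of _ a]) auto
  ultimately show ?R using a by blast
next
  assume ?R
  then obtain b a where a: "b \<in> carrier R" "\<forall>i<g. a i \<in> carrier R"
    "x = b [^] n \<oplus> (\<Oplus>i\<in>{..<g}. a i [^] n)"
    by (auto simp: is_sum_of_powers_def)
  have "(\<Oplus>i\<in>{..<g}. a i [^] n) = (\<Oplus>i\<in>{..<g}. (a(g := b)) i [^] n)"
    using a by (intro finsum_cong') auto
  also have "b [^] n \<oplus> \<dots> = (\<Oplus>i\<in>{..<Suc g}. (a(g := b)) i [^] n)"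
    using a unfolding lessThan_Suc by (subst finsum_insert) auto
  finally show ?L
    using a unfolding is_sum_of_powers_def by (intro exI[of _ "a(g := b)"]) auto
qed

lemma is_sum_of_powers_add:
  "is_sum_of_powers R n g x \<Longrightarrow> is_sum_of_powers R n h y \<Longrightarrow> is_sum_of_powers R n (g + h) (x \<oplus> y)"
proof (induction g arbitrary: x)
  case (Suc g)
  then obtain a z where az: "a \<in> carrier R" "is_sum_of_powers R n g z" "x = a [^] n \<oplus> z"
    by (auto simp: is_sum_of_powers_Suc_iff)
  then have "x \<oplus> y = a [^] n \<oplus> (z \<oplus> y)"
    using Suc.prems(2) by (auto dest!: is_sum_of_powers_closed simp: a_assoc)
  with Suc az show ?case by (auto simp: is_sum_of_powers_Suc_iff)
qed (simp add: is_sum_of_powers_0_iff is_sum_of_powers_closed[of n h y])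

lemma is_sum_of_powers_1: "a \<in> carrier R \<Longrightarrow> is_sum_of_powers R n 1 (a [^] n)"
  by (auto simp: is_sum_of_powers_Suc_iff is_sum_of_powers_0_iff)

lemma is_sum_of_powers_zero: "n > 0 \<Longrightarrow> is_sum_of_powers R n g \<zero>"
  by (induction g) (auto simp: is_sum_of_powers_0_iff is_sum_of_powers_Suc_iff nat_pow_zero
      intro!: bexI[of _ \<zero>] exI[of _ \<zero>])

text \<open>For a positive exponent zero is a power, so missing summands are filled with zeros and
  "at most \<open>g\<close>" becomes "exactly \<open>g\<close>".\<close>

lemma is_sum_of_powers_mono:
  assumes "is_sum_of_powers R n g x" "g \<le> h" "n > 0"
  shows "is_sum_of_powers R n h x"
  using is_sum_of_powers_add[OF assms(1) is_sum_of_powers_zero[OF assms(3), of "h - g"]] assms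
  by (auto dest: is_sum_of_powers_closed)

text \<open>Each summand absorbs the factor, \<open>c^n a^n = (c a)^n\<close>. This allows shifting
  valuations and clearing denominators without changing the number of summands.\<close>

lemma is_sum_of_powers_mult_power:
  assumes c: "c \<in> carrier R" and "is_sum_of_powers R n g x"
  shows "is_sum_of_powers R n g (c [^] n \<otimes> x)"
  using assms(2)
proof (induction g arbitrary: x)
  case (Suc g)
  then obtain a z where az: "a \<in> carrier R" "is_sum_of_powers R n g z" "x = a [^] n \<oplus> z"
    by (auto simp: is_sum_of_powers_Suc_iff)
  then have "c [^] n \<otimes> x = (c \<otimes> a) [^] n \<oplus> c [^] n \<otimes> z"
    using c by (auto dest!: is_sum_of_powers_closed simp: r_distr nat_pow_distrib)
  with Suc az c show ?case by (auto simp: is_sum_of_powers_Suc_iff)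
qed (use c in \<open>auto simp: is_sum_of_powers_0_iff\<close>)

end

lemma (in ring_hom_cring) is_sum_of_powers_hom:
  assumes "is_sum_of_powers R n g x"
  shows "is_sum_of_powers S n g (h x)"
  using assms
proof (induction g arbitrary: x)
  case (Suc g)
  then obtain a z where az: "a \<in> carrier R" "is_sum_of_powers R n g z" "x = a [^] n \<oplus> z"
    by (auto simp: R.is_sum_of_powers_Suc_iff)
  then have "h x = h a [^]\<^bsub>S\<^esub> n \<oplus>\<^bsub>S\<^esub> h z"
    using ring.hom_nat_pow by (auto dest!: R.is_sum_of_powers_closed)
  with Suc az show ?case by (auto simp: S.is_sum_of_powers_Suc_iff)
qed (auto simp: R.is_sum_of_powers_0_iff S.is_sum_of_powers_0_iff)

section \<open>Level and Waring number as bounds in the extended naturals\<close>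

text \<open>Testing against finite bounds treats infinite values without a case distinction.\<close>

lemma enat_eqI: "(\<And>g. a \<le> enat g \<longleftrightarrow> b \<le> enat g) \<Longrightarrow> a = b" for a b :: enat
  by (metis dual_order.antisym enat_ord_code(3) nle_le not_infinity_eq)

text \<open>The infimum of a nonempty set of extended naturals belongs to the set, and upward
  closure passes from the attained value to \<open>h\<close>.\<close>

lemma Inf_enat_le_iff:
  assumes "\<And>g h. P g \<Longrightarrow> g \<le> h \<Longrightarrow> P h"
  shows "Inf {enat g |g. P g} \<le> enat h \<longleftrightarrow> P h"
proof
  assume le: "Inf {enat g |g. P g} \<le> enat h"
  then have "{enat g |g. P g} \<noteq> {}"
    by (metis Inf_enat_def enat_ord_code(5))
  then have "Inf {enat g |g. P g} \<in> {enat g |g. P g}"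
    by (metis (no_types, lifting) Inf_enat_def LeastI_ex equals0I)
  with le show "P h" using assms by auto
qed (auto intro: Inf_lower)

context cring
begin

lemma level_le_iff:
  assumes "n > 0"
  shows "level n R \<le> enat g \<longleftrightarrow> g > 0 \<and> is_sum_of_powers R n g (\<ominus> \<one>)"
  unfolding level_def using assms by (intro Inf_enat_le_iff) (auto intro: is_sum_of_powers_mono)

text \<open>Padding with zeros turns the bound \<open>h' \<le> g\<close> of the definition into
  exactly \<open>g\<close> summands.\<close>

lemma waring_number_le_iff:
  assumes "n > 0"
  shows "waring_number n R \<le> enat g \<longleftrightarrow>
    g > 0 \<and> (\<forall>x h. is_sum_of_powers R n h x \<longrightarrow> is_sum_of_powers R n g x)"
proof -
  have "waring_number n R \<le> enat g \<longleftrightarrow>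
    g > 0 \<and> (\<forall>x h. is_sum_of_powers R n h x \<longrightarrow> (\<exists>h'\<le>g. is_sum_of_powers R n h' x))"
    unfolding waring_number_def by (intro Inf_enat_le_iff) (meson dual_order.trans order_less_le_trans)
  then show ?thesis using is_sum_of_powers_mono assms by blast
qed

lemma waring_number_1: "waring_number 1 R = 1"
proof (rule enat_eqI)
  fix g
  have "is_sum_of_powers R 1 g x" if "g > 0" "is_sum_of_powers R 1 h x" for h x
  proof -
    have "is_sum_of_powers R 1 1 x"
      using is_sum_of_powers_1[of x 1] is_sum_of_powers_closed[OF that(2)] by simp
    then show ?thesis using is_sum_of_powers_mono that(1) by simp
  qed
  then show "waring_number 1 R \<le> enat g \<longleftrightarrow> 1 \<le> enat g"
    unfolding waring_number_le_iff[OF zero_less_one] by (auto simp: one_enat_def)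
qed

end

text \<open>Homomorphisms carry a representation of \<open>-1\<close> forward, so the level can only
  drop; maps into and out of a ring therefore squeeze its level.\<close>

lemma (in ring_hom_cring) level_hom_le:
  assumes "n > 0"
  shows "level n S \<le> level n R"
proof (cases "level n R")
  case (enat g)
  then have "g > 0" "is_sum_of_powers R n g (\<ominus> \<one>)"
    using R.level_le_iff[OF assms, of g] by auto
  with is_sum_of_powers_hom show ?thesis
    unfolding enat S.level_le_iff[OF assms] by fastforce
qed simp

section \<open>Powers of the Frobenius map in domains\<close>

context domain
begin

lemma nat_pow_eq_zero: "a \<in> carrier R \<Longrightarrow> a [^] (n::nat) = \<zero> \<Longrightarrow> a = \<zero>"
  by (induction n) (auto simp: integral_iff)

text \<open>Additivity of the \<open>p^j\<close>-th power map gives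
  \<open>(a - b)^(p^j) = 0\<close>, and a domain has no nonzero nilpotents.\<close>

lemma frobenius_inj:
  assumes p: "Factorial_Ring.prime (p::nat)" and char: "add_pow R p \<one> = \<zero>"
    and ab: "a \<in> carrier R" "b \<in> carrier R" and eq: "a [^] (p ^ j) = b [^] (p ^ j)"
  shows "a = b"
proof -
  have "a = (a \<ominus> b) \<oplus> b" using ab by (simp add: minus_eq a_assoc l_neg)
  then have "b [^] (p ^ j) = (a \<ominus> b) [^] (p ^ j) \<oplus> b [^] (p ^ j)"
    using freshman[OF p char, of "a \<ominus> b" b j] ab eq by simp
  then have "(a \<ominus> b) [^] (p ^ j) = \<zero>"
    using ab by (metis add.l_cancel_one' minus_closed nat_pow_closed a_comm)
  then have "a \<ominus> b = \<zero>"
    using ab nat_pow_eq_zero by blast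
  then show ?thesis using ab by (simp add: r_right_minus_eq)
qed

text \<open>The \<open>p^j\<close>-th power map is additive, so it sends a sum of
  \<open>m\<close>-th powers to the sum of the \<open>p^j m\<close>-th powers of the same
  elements.\<close>

lemma is_sum_of_powers_frobenius_iff:
  assumes p: "Factorial_Ring.prime (p::nat)" and char: "add_pow R p \<one> = \<zero>"
  shows "is_sum_of_powers R (p ^ j * m) g x \<longleftrightarrow> (\<exists>y. is_sum_of_powers R m g y \<and> x = y [^] (p ^ j))"
proof (induction g arbitrary: x)
  case 0
  have "p > 0" using p by (simp add: prime_gt_0_nat)
  then show ?case by (simp add: is_sum_of_powers_0_iff nat_pow_zero)
next
  case (Suc g)
  have "(a [^] m \<oplus> y) [^] (p ^ j) = a [^] (p ^ j * m) \<oplus> y [^] (p ^ j)"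
    if "a \<in> carrier R" "is_sum_of_powers R m g y" for a y
    using that freshman[OF p char]
    by (simp add: is_sum_of_powers_closed nat_pow_pow mult.commute)
  then show ?case
    unfolding is_sum_of_powers_Suc_iff Suc by (safe; metis)
qed

lemma level_waring_frobenius:
  assumes p: "Factorial_Ring.prime (p::nat)" and char: "add_pow R p \<one> = \<zero>" and m: "m > 0"
  shows "level (p ^ j * m) R = level m R" (is ?A)
    and "waring_number (p ^ j * m) R = waring_number m R" (is ?B)
proof -
  have n: "p ^ j * m > 0" using p m by (simp add: prime_gt_0_nat)
  have q: "p ^ j \<noteq> 0" using p by (simp add: prime_gt_0_nat)
  note iff = is_sum_of_powers_frobenius_iff[OF p char]
  have inj: "a = b" if "is_sum_of_powers R m g a" "is_sum_of_powers R m h b"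
    "a [^] (p ^ j) = b [^] (p ^ j)" for a b g h
    using frobenius_inj[OF p char] that by (blast dest: is_sum_of_powers_closed)
  \<comment> \<open>Expanding \<open>0 = (1 - 1)^(p^j)\<close> also covers \<open>p = 2\<close>,
    where the exponent can be even.\<close>
  have "\<zero> = \<one> \<oplus> (\<ominus> \<one>) [^] (p ^ j)"
    using freshman[OF p char, of \<one> "\<ominus> \<one>" j] q by (simp add: r_neg nat_pow_zero)
  then have minus_one: "(\<ominus> \<one>) [^] (p ^ j) = \<ominus> \<one>"
    by (metis a_inv_closed minus_equality nat_pow_closed one_closed a_comm)
  have "is_sum_of_powers R (p ^ j * m) g (\<ominus> \<one>) \<longleftrightarrow> is_sum_of_powers R m g (\<ominus> \<one>)" for g
    unfolding iff
    by (metis a_inv_closed frobenius_inj[OF p char] is_sum_of_powers_closed minus_one one_closed)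
  then show ?A
    by (intro enat_eqI) (simp only: level_le_iff[OF n] level_le_iff[OF m])
  \<comment> \<open>Roots under the injective \<open>p^j\<close>-th power map are unique, so a
    representation of \<open>y^(p^j)\<close> with exponent \<open>p^j m\<close> comes from one of
    \<open>y\<close> itself.\<close>
  have "(\<forall>x h. is_sum_of_powers R (p ^ j * m) h x \<longrightarrow> is_sum_of_powers R (p ^ j * m) g x) \<longleftrightarrow>
      (\<forall>x h. is_sum_of_powers R m h x \<longrightarrow> is_sum_of_powers R m g x)" for g
    unfolding iff using inj by (smt (verit))
  then show ?B
    by (intro enat_eqI) (simp only: waring_number_le_iff[OF n] waring_number_le_iff[OF m])
qed

end

section \<open>Convolution rings\<close>

text \<open>Power series have multisets as exponents and Laurent series have integers; treating both as
  functions on a cancellative monoid gives the ring axioms for both at once.\<close>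

definition convolution_support ::
    "('a, 'b) ring_scheme \<Rightarrow> ('m::cancel_comm_monoid_add \<Rightarrow> 'a) \<Rightarrow> ('m \<Rightarrow> 'a) \<Rightarrow> 'm \<Rightarrow> ('m \<times> 'm) set" where
  "convolution_support R f g e = {(a, b). a + b = e \<and> f a \<noteq> \<zero>\<^bsub>R\<^esub> \<and> g b \<noteq> \<zero>\<^bsub>R\<^esub>}"

definition convolution ::
    "('a, 'b) ring_scheme \<Rightarrow> ('m::cancel_comm_monoid_add \<Rightarrow> 'a) \<Rightarrow> ('m \<Rightarrow> 'a) \<Rightarrow> 'm \<Rightarrow> 'a" where
  "convolution R f g e = (\<Oplus>\<^bsub>R\<^esub>z\<in>convolution_support R f g e. f (fst z) \<otimes>\<^bsub>R\<^esub> g (snd z))"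

text \<open>Any finite set of decompositions of \<open>e\<close> that covers the support gives the
  same sum, since the extra terms have a zero factor. Several products can thus be summed over one
  index set.\<close>

lemma (in cring) convolution_eq_finsum:
  assumes "\<And>e. f e \<in> carrier R" "\<And>e. g e \<in> carrier R"
    and "finite B" "convolution_support R f g e \<subseteq> B" "\<And>z. z \<in> B \<Longrightarrow> fst z + snd z = e"
  shows "convolution R f g e = (\<Oplus>z\<in>B. f (fst z) \<otimes> g (snd z))"
  unfolding convolution_def
proof (rule add.finprod_mono_neutral_cong_left)
  fix z assume "z \<in> B - convolution_support R f g e"
  then have "f (fst z) = \<zero> \<or> g (snd z) = \<zero>"
    using assms(5)[of z] by (auto simp: convolution_support_def split: prod.splits)
  then show "f (fst z) \<otimes> g (snd z) = \<zero>" using assms(1,2) by auto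
qed (use assms in auto)

text \<open>Finiteness is demanded for triples because associativity is a statement about threefold
  sums; the case of pairs follows from it.\<close>

locale convolution_ring = R?: cring R
  for R :: "('a, 'b) ring_scheme" (structure)
    and A :: "('m::cancel_comm_monoid_add \<Rightarrow> 'a, 'c) ring_scheme" +
  assumes coeff_closed: "f \<in> carrier A \<Longrightarrow> f e \<in> carrier R"
    and finite_triples: "f \<in> carrier A \<Longrightarrow> g \<in> carrier A \<Longrightarrow> h \<in> carrier A \<Longrightarrow>
      finite {(a, b, c). a + b + c = e \<and> f a \<noteq> \<zero> \<and> g b \<noteq> \<zero> \<and> h c \<noteq> \<zero>}"
    and mult_convolution:
      "f \<in> carrier A \<Longrightarrow> g \<in> carrier A \<Longrightarrow> f \<otimes>\<^bsub>A\<^esub> g = convolution R f g"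
    and mult_in_carrier: "f \<in> carrier A \<Longrightarrow> g \<in> carrier A \<Longrightarrow> f \<otimes>\<^bsub>A\<^esub> g \<in> carrier A"
    and one_coeff: "\<one>\<^bsub>A\<^esub> = (\<lambda>e. if e = 0 then \<one> else \<zero>)"
    and one_in_carrier: "\<one>\<^bsub>A\<^esub> \<in> carrier A"
    and add_coeff: "f \<oplus>\<^bsub>A\<^esub> g = (\<lambda>e. f e \<oplus> g e)"
    and add_in_carrier: "f \<in> carrier A \<Longrightarrow> g \<in> carrier A \<Longrightarrow> f \<oplus>\<^bsub>A\<^esub> g \<in> carrier A"
    and zero_coeff: "\<zero>\<^bsub>A\<^esub> = (\<lambda>e. \<zero>)"
    and zero_in_carrier: "\<zero>\<^bsub>A\<^esub> \<in> carrier A"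
    and minus_in_carrier: "f \<in> carrier A \<Longrightarrow> (\<lambda>e. \<ominus> f e) \<in> carrier A"
begin

text \<open>Pairs are triples whose third factor is the unit series, which is nonzero only at
  exponent 0. In the zero ring all supports are empty.\<close>

lemma finite_convolution_support:
  assumes "f \<in> carrier A" "g \<in> carrier A"
  shows "finite (convolution_support R f g e)"
proof (cases "\<one> = \<zero>")
  case True
  then show ?thesis
    using assms coeff_closed one_zeroD by (fastforce simp: convolution_support_def)
next
  case False
  have eq: "(\<lambda>(a, b, c). (a, b)) ` {(a, b, c). a + b + c = e \<and> f a \<noteq> \<zero> \<and> g b \<noteq> \<zero> \<and> \<one>\<^bsub>A\<^esub> c \<noteq> \<zero>}
      = convolution_support R f g e"
    using False by (force simp: convolution_support_def one_coeff image_iff split: if_splits)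
  show ?thesis
    unfolding eq[symmetric] by (rule finite_imageI[OF finite_triples[OF assms one_in_carrier]])
qed

lemmas convolution_superset = convolution_eq_finsum[OF coeff_closed coeff_closed]

lemma convolution_nonzero:
  assumes "convolution R f g e \<noteq> \<zero>"
  obtains a b where "a + b = e" "f a \<noteq> \<zero>" "g b \<noteq> \<zero>"
proof -
  have "convolution_support R f g e \<noteq> {}" using assms by (auto simp: convolution_def)
  then show ?thesis using that by (auto simp: convolution_support_def)
qed

lemma convolution_commute:
  assumes "f \<in> carrier A" "g \<in> carrier A"
  shows "convolution R f g e = convolution R g f e"
proof -
  have "convolution_support R f g e = prod.swap ` convolution_support R g f e"
    by (auto simp: convolution_support_def image_iff add.commute)
  then have "convolution R f g e =
      (\<Oplus>z\<in>prod.swap ` convolution_support R g f e. f (fst z) \<otimes> g (snd z))"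
    by (simp add: convolution_def)
  also have "\<dots> = (\<Oplus>z\<in>convolution_support R g f e. f (snd z) \<otimes> g (fst z))"
    using assms coeff_closed by (subst finsum_reindex) auto
  also have "\<dots> = convolution R g f e"
    unfolding convolution_def using assms coeff_closed by (intro finsum_cong') (auto simp: m_comm)
  finally show ?thesis .
qed

text \<open>The sum over triples is a symmetric form of the double product, which reduces
  associativity to commutativity and a rotation of the triples.\<close>

lemma convolution_convolution:
  assumes f: "f \<in> carrier A" and g: "g \<in> carrier A" and h: "h \<in> carrier A"
  shows "convolution R (convolution R f g) h e =
    (\<Oplus>t\<in>{(a, b, c). a + b + c = e \<and> f a \<noteq> \<zero> \<and> g b \<noteq> \<zero> \<and> h c \<noteq> \<zero>}.
      f (fst t) \<otimes> g (fst (snd t)) \<otimes> h (snd (snd t)))" (is "_ = finsum R ?t ?T")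
proof -
  have fg: "convolution R f g \<in> carrier A"
    using mult_in_carrier[OF f g] mult_convolution[OF f g] by simp
  note [simp] = coeff_closed[OF f] coeff_closed[OF g] coeff_closed[OF h]
  have T: "finite ?T" by (rule finite_triples[OF f g h])
  \<comment> \<open>\<open>B\<close> may exceed the outer support:
    \<open>convolution R f g (a + b)\<close> can vanish by cancellation although \<open>f a\<close>
    and \<open>g b\<close> do not.\<close>
  define B where "B = (\<lambda>(a, b, c). (a + b, c)) ` ?T"
  have finite_B: "finite B" unfolding B_def by (rule finite_imageI[OF T])
  have B: "fst z + snd z = e" "h (snd z) \<noteq> \<zero>" if "z \<in> B" for z using that by (auto simp: B_def)
  \<comment> \<open>\<open>p\<close> regroups a triple as an outer pair together with the inner pair
    that refines its first entry.\<close>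
  define p where "p = (\<lambda>(a, b, c). ((a + b, c :: 'm), (a, b :: 'm)))"
  have "convolution R (convolution R f g) h e = (\<Oplus>z\<in>B. convolution R f g (fst z) \<otimes> h (snd z))"
  proof (rule convolution_superset[OF fg h finite_B _ B(1)])
    show "convolution_support R (convolution R f g) h e \<subseteq> B"
    proof
      fix z assume "z \<in> convolution_support R (convolution R f g) h e"
      then obtain d c where z: "z = (d, c)" "d + c = e" "convolution R f g d \<noteq> \<zero>" "h c \<noteq> \<zero>"
        by (auto simp: convolution_support_def)
      then obtain a b where "a + b = d" "f a \<noteq> \<zero>" "g b \<noteq> \<zero>"
        using convolution_nonzero by blast
      with z have "(a, b, c) \<in> ?T" "z = (\<lambda>(a, b, c). (a + b, c)) (a, b, c)" by auto
      then show "z \<in> B" unfolding B_def by (rule rev_image_eqI)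
    qed
  qed
  also have "\<dots> = (\<Oplus>z\<in>B. \<Oplus>w\<in>convolution_support R f g (fst z). f (fst w) \<otimes> g (snd w) \<otimes> h (snd z))"
    by (intro finsum_cong')
      (auto simp: convolution_def finsum_ldistr finite_convolution_support[OF f g] intro!: finsum_closed)
  also have "\<dots> = (\<Oplus>u\<in>Sigma B (\<lambda>z. convolution_support R f g (fst z)).
      f (fst (snd u)) \<otimes> g (snd (snd u)) \<otimes> h (snd (fst u)))"
    by (subst finsum_Sigma) (use finite_B finite_convolution_support[OF f g] in auto)
  also have "Sigma B (\<lambda>z. convolution_support R f g (fst z)) = p ` ?T"
    by (force simp: B_def p_def convolution_support_def image_iff)
  also have "(\<Oplus>u\<in>p ` ?T. f (fst (snd u)) \<otimes> g (snd (snd u)) \<otimes> h (snd (fst u))) = finsum R ?t ?T"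
    by (subst finsum_reindex) (auto simp: inj_on_def p_def intro!: finsum_cong')
  finally show ?thesis .
qed

lemma convolution_assoc:
  assumes f: "f \<in> carrier A" and g: "g \<in> carrier A" and h: "h \<in> carrier A"
  shows "convolution R (convolution R f g) h e = convolution R f (convolution R g h) e"
proof -
  have gh: "convolution R g h \<in> carrier A"
    using mult_in_carrier[OF g h] mult_convolution[OF g h] by simp
  note [simp] = coeff_closed[OF f] coeff_closed[OF g] coeff_closed[OF h]
  let ?T = "{(a, b, c). a + b + c = e \<and> f a \<noteq> \<zero> \<and> g b \<noteq> \<zero> \<and> h c \<noteq> \<zero>}"
  \<comment> \<open>The rotation puts \<open>f\<close> last, so the same lemma computes the product
    bracketed the other way.\<close>
  have "{(b, c, a). b + c + a = e \<and> g b \<noteq> \<zero> \<and> h c \<noteq> \<zero> \<and> f a \<noteq> \<zero>} = (\<lambda>(a, b, c). (b, c, a)) ` ?T"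
    by (force simp: image_iff add_ac)
  then have "convolution R (convolution R g h) f e =
      (\<Oplus>t\<in>(\<lambda>(a, b, c). (b, c, a)) ` ?T. g (fst t) \<otimes> h (fst (snd t)) \<otimes> f (snd (snd t)))"
    by (simp only: convolution_convolution[OF g h f])
  also have "\<dots> = (\<Oplus>t\<in>?T. f (fst t) \<otimes> g (fst (snd t)) \<otimes> h (snd (snd t)))"
    by (subst finsum_reindex) (auto simp: inj_on_def m_ac intro!: finsum_cong')
  finally show ?thesis
    by (simp only: convolution_convolution[OF f g h] convolution_commute[OF f gh])
qed

lemma convolution_one:
  assumes f: "f \<in> carrier A"
  shows "convolution R \<one>\<^bsub>A\<^esub> f e = f e"
proof -
  have "convolution R \<one>\<^bsub>A\<^esub> f e = (\<Oplus>z\<in>{(0, e)}. \<one>\<^bsub>A\<^esub> (fst z) \<otimes> f (snd z))"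
    using f one_in_carrier
    by (intro convolution_superset) (auto simp: convolution_support_def one_coeff split: if_splits)
  then show ?thesis using coeff_closed[OF f] by (simp add: one_coeff)
qed

lemma convolution_add:
  assumes f: "f \<in> carrier A" and g: "g \<in> carrier A" and h: "h \<in> carrier A"
  shows "convolution R (f \<oplus>\<^bsub>A\<^esub> g) h e = convolution R f h e \<oplus> convolution R g h e"
proof -
  have fg: "f \<oplus>\<^bsub>A\<^esub> g \<in> carrier A" by (rule add_in_carrier[OF f g])
  note [simp] = coeff_closed[OF f] coeff_closed[OF g] coeff_closed[OF h]
  \<comment> \<open>The support for \<open>f + g\<close> lies in this union, so all three products
    become sums over one index set.\<close>
  let ?B = "convolution_support R f h e \<union> convolution_support R g h e"
  have B: "finite ?B" using assms finite_convolution_support by auto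
  have e: "fst z + snd z = e" if "z \<in> ?B" for z using that by (auto simp: convolution_support_def)
  have "convolution R (f \<oplus>\<^bsub>A\<^esub> g) h e = (\<Oplus>z\<in>?B. (f \<oplus>\<^bsub>A\<^esub> g) (fst z) \<otimes> h (snd z))"
    by (rule convolution_superset[OF fg h B _ e]) (auto simp: convolution_support_def add_coeff)
  also have "\<dots> = (\<Oplus>z\<in>?B. f (fst z) \<otimes> h (snd z) \<oplus> g (fst z) \<otimes> h (snd z))"
    by (intro finsum_cong') (auto simp: add_coeff l_distr)
  also have "\<dots> = (\<Oplus>z\<in>?B. f (fst z) \<otimes> h (snd z)) \<oplus> (\<Oplus>z\<in>?B. g (fst z) \<otimes> h (snd z))"
    by (subst finsum_addf) auto
  finally show ?thesis
    by (simp only: convolution_superset[OF f h B _ e] convolution_superset[OF g h B _ e] Un_upper1 Un_upper2)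
qed

lemma is_cring: "cring A"
proof (rule cringI)
  show "abelian_group A"
  proof (rule abelian_groupI)
    fix f assume f: "f \<in> carrier A"
    show "\<exists>g\<in>carrier A. g \<oplus>\<^bsub>A\<^esub> f = \<zero>\<^bsub>A\<^esub>"
      using f coeff_closed[OF f]
      by (intro bexI[OF _ minus_in_carrier[OF f]]) (auto simp: add_coeff zero_coeff l_neg)
  qed (auto simp: add_in_carrier zero_in_carrier,
      auto simp: add_coeff zero_coeff coeff_closed a_ac)
  show "comm_monoid A"
  proof (rule comm_monoidI)
    fix f g h assume fgh: "f \<in> carrier A" "g \<in> carrier A" "h \<in> carrier A"
    have "convolution R f g \<in> carrier A" "convolution R g h \<in> carrier A"
      using mult_in_carrier mult_convolution fgh by (metis, metis)
    then show "f \<otimes>\<^bsub>A\<^esub> g \<otimes>\<^bsub>A\<^esub> h = f \<otimes>\<^bsub>A\<^esub> (g \<otimes>\<^bsub>A\<^esub> h)"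
      using fgh by (auto simp: mult_convolution convolution_assoc)
  qed (auto simp: mult_in_carrier one_in_carrier,
      auto simp: mult_convolution one_in_carrier convolution_one intro: convolution_commute)
  show "(f \<oplus>\<^bsub>A\<^esub> g) \<otimes>\<^bsub>A\<^esub> h = f \<otimes>\<^bsub>A\<^esub> h \<oplus>\<^bsub>A\<^esub> g \<otimes>\<^bsub>A\<^esub> h"
    if "f \<in> carrier A" "g \<in> carrier A" "h \<in> carrier A" for f g h
    using that unfolding add_coeff[of "f \<otimes>\<^bsub>A\<^esub> h"]
    by (auto simp: mult_convolution add_in_carrier convolution_add)
qed

sublocale A: cring A by (rule is_cring)

lemma mult_coeff: "f \<in> carrier A \<Longrightarrow> g \<in> carrier A \<Longrightarrow> (f \<otimes>\<^bsub>A\<^esub> g) e = convolution R f g e"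
  by (simp add: mult_convolution)

text \<open>The case in which a single decomposition contributes; it yields products with constants
  and monomials, constant terms, and leading coefficients.\<close>

lemma mult_coeff_single:
  assumes "f \<in> carrier A" "g \<in> carrier A"
    and "\<And>a b. a + b = u + v \<Longrightarrow> f a \<noteq> \<zero> \<Longrightarrow> g b \<noteq> \<zero> \<Longrightarrow> a = u \<and> b = v"
  shows "(f \<otimes>\<^bsub>A\<^esub> g) (u + v) = f u \<otimes> g v"
proof -
  have "(f \<otimes>\<^bsub>A\<^esub> g) (u + v) = (\<Oplus>z\<in>{(u, v)}. f (fst z) \<otimes> g (snd z))"
    unfolding mult_coeff[OF assms(1,2)]
  proof (rule convolution_superset[OF assms(1,2)])
    show "convolution_support R f g (u + v) \<subseteq> {(u, v)}"
    proof
      fix z assume "z \<in> convolution_support R f g (u + v)"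
      then obtain a b where z: "z = (a, b)" "a + b = u + v" "f a \<noteq> \<zero>" "g b \<noteq> \<zero>"
        by (auto simp: convolution_support_def)
      from assms(3)[OF z(2-4)] z(1) show "z \<in> {(u, v)}" by simp
    qed
  qed simp_all
  then show ?thesis using coeff_closed[OF assms(1)] coeff_closed[OF assms(2)] by simp
qed

lemma minus_coeff: "f \<in> carrier A \<Longrightarrow> (\<ominus>\<^bsub>A\<^esub> f) e = \<ominus> f e"
  using A.minus_equality[of "\<lambda>e. \<ominus> f e" f] minus_in_carrier coeff_closed
  by (simp add: add_coeff zero_coeff l_neg)

lemma finsum_coeff:
  assumes "finite I" "f \<in> I \<rightarrow> carrier A"
  shows "(\<Oplus>\<^bsub>A\<^esub>i\<in>I. f i) e = (\<Oplus>i\<in>I. f i e)"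
  using assms
proof (induction I rule: finite_induct)
  case (insert i I)
  from insert.prems have f: "f i \<in> carrier A" "f \<in> I \<rightarrow> carrier A"
    by (simp_all add: Pi_iff)
  then have "(\<lambda>i. f i e) \<in> I \<rightarrow> carrier R" "f i e \<in> carrier R"
    using coeff_closed by (simp_all add: Pi_iff)
  with insert.IH[OF f(2)] insert.hyps f show ?case by (simp add: add_coeff)
qed (simp add: zero_coeff)

end

context convolution_ring
begin

definition const :: "'a \<Rightarrow> 'm \<Rightarrow> 'a" where
  "const c = (\<lambda>e. if e = 0 then c else \<zero>)"

lemma const_mult_coeff:
  assumes c: "c \<in> carrier R" and "const c \<in> carrier A" and f: "f \<in> carrier A"
  shows "(const c \<otimes>\<^bsub>A\<^esub> f) e = c \<otimes> f e"
proof -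
  have "(const c \<otimes>\<^bsub>A\<^esub> f) (0 + e) = const c 0 \<otimes> f e"
    using assms by (intro mult_coeff_single) (auto simp: const_def split: if_splits)
  then show ?thesis by (simp add: const_def)
qed

lemma const_hom:
  assumes "\<And>c. c \<in> carrier R \<Longrightarrow> const c \<in> carrier A"
  shows "ring_hom_cring R A const"
proof (intro ring_hom_cringI[OF R.is_cring A.is_cring] ring_hom_memI)
  fix c d assume cd: "c \<in> carrier R" "d \<in> carrier R"
  show "const (c \<otimes> d) = const c \<otimes>\<^bsub>A\<^esub> const d"
    using cd assms by (intro ext) (simp add: const_mult_coeff, simp add: const_def)
  show "const (c \<oplus> d) = const c \<oplus>\<^bsub>A\<^esub> const d"
    using cd by (intro ext) (simp add: add_coeff const_def)
qed (use assms in \<open>auto simp: const_def one_coeff\<close>)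

end

section \<open>Power series\<close>

lemma finite_submultisets: "finite {d. d \<subseteq># e}"
proof (induction e)
  case (add x e)
  have "{d. d \<subseteq># add_mset x e} \<subseteq> {d. d \<subseteq># e} \<union> add_mset x ` {d. d \<subseteq># e}"
  proof
    fix d assume "d \<in> {d. d \<subseteq># add_mset x e}"
    then have d: "d \<subseteq># add_mset x e" by simp
    show "d \<in> {d. d \<subseteq># e} \<union> add_mset x ` {d. d \<subseteq># e}"
    proof (cases "x \<in># d")
      case True
      then obtain d' where "d = add_mset x d'" by (metis insert_DiffM)
      then show ?thesis using d by auto
    next
      case False
      have "d \<subseteq># e"
      proof (rule mset_subset_eqI)
        fix y show "count d y \<le> count e y"
          using mset_subset_eq_count[OF d, of y] False by (cases "y = x") (auto simp: not_in_iff)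
      qed
      then show ?thesis by simp
    qed
  qed
  with add show ?case by (meson finite_UnI finite_imageI finite_subset)
qed simp

lemma power_series_ring_simps:
  "f \<in> carrier (power_series_ring R I) \<longleftrightarrow>
    (\<forall>e. f e \<in> carrier R) \<and> (\<forall>e. \<not> set_mset e \<subseteq> I \<longrightarrow> f e = \<zero>\<^bsub>R\<^esub>)"
  "\<one>\<^bsub>power_series_ring R I\<^esub> = (\<lambda>e. if e = {#} then \<one>\<^bsub>R\<^esub> else \<zero>\<^bsub>R\<^esub>)"
  "\<zero>\<^bsub>power_series_ring R I\<^esub> = (\<lambda>e. \<zero>\<^bsub>R\<^esub>)"
  "f \<oplus>\<^bsub>power_series_ring R I\<^esub> g = (\<lambda>e. f e \<oplus>\<^bsub>R\<^esub> g e)"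
  by (auto simp: power_series_ring_def)

lemma (in cring) power_series_mult_convolution:
  fixes f g :: "'v multiset \<Rightarrow> 'a"
  assumes f: "\<And>e. f e \<in> carrier R" and g: "\<And>e. g e \<in> carrier R"
  shows "f \<otimes>\<^bsub>power_series_ring R I\<^esub> g = convolution R f g"
proof
  fix e :: "'v multiset"
  have fin: "finite ((\<lambda>d. (d, e - d)) ` {d. d \<subseteq># e})"
    by (rule finite_imageI[OF finite_submultisets])
  have sub: "convolution_support R f g e \<subseteq> (\<lambda>d. (d, e - d)) ` {d. d \<subseteq># e}"
    by (auto simp: convolution_support_def image_iff)
  have "convolution R f g e = (\<Oplus>z\<in>(\<lambda>d. (d, e - d)) ` {d. d \<subseteq># e}. f (fst z) \<otimes> g (snd z))"
    by (rule convolution_eq_finsum[OF f g fin sub]) auto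
  also have "\<dots> = (\<Oplus>d\<in>{d. d \<subseteq># e}. f d \<otimes> g (e - d))"
    by (subst finsum_reindex) (auto simp: inj_on_def f g)
  finally show "(f \<otimes>\<^bsub>power_series_ring R I\<^esub> g) e = convolution R f g e"
    by (simp add: power_series_ring_def)
qed

lemma (in cring) convolution_in_carrier:
  "(\<And>e. f e \<in> carrier R) \<Longrightarrow> (\<And>e. g e \<in> carrier R) \<Longrightarrow> convolution R f g e \<in> carrier R"
  by (auto simp: convolution_def intro!: finsum_closed)

lemma (in cring) power_series_convolution_ring: "convolution_ring R (power_series_ring R I)"
proof (intro convolution_ring.intro[OF is_cring] convolution_ring_axioms.intro)
  fix f g h e
  assume f: "f \<in> carrier (power_series_ring R I)" and g: "g \<in> carrier (power_series_ring R I)"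
    and h: "h \<in> carrier (power_series_ring R I)"
  have "{(a, b, c). a + b + c = e \<and> f a \<noteq> \<zero> \<and> g b \<noteq> \<zero> \<and> h c \<noteq> \<zero>}
      \<subseteq> {d. d \<subseteq># e} \<times> {d. d \<subseteq># e} \<times> {d. d \<subseteq># e}"
    by (auto simp: ac_simps)
  then show "finite {(a, b, c). a + b + c = e \<and> f a \<noteq> \<zero> \<and> g b \<noteq> \<zero> \<and> h c \<noteq> \<zero>}"
    by (rule finite_subset) (intro finite_cartesian_product finite_submultisets)
next
  fix f g
  assume f: "f \<in> carrier (power_series_ring R I)" and g: "g \<in> carrier (power_series_ring R I)"
  then have fg: "\<And>e. f e \<in> carrier R" "\<And>e. g e \<in> carrier R" by (auto simp: power_series_ring_simps)
  then show mult: "f \<otimes>\<^bsub>power_series_ring R I\<^esub> g = convolution R f g"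
    by (intro power_series_mult_convolution)
  have "convolution R f g e = \<zero>" if "\<not> set_mset e \<subseteq> I" for e
  proof -
    have "convolution_support R f g e = {}"
      using that f g by (fastforce simp: convolution_support_def power_series_ring_simps)
    then show ?thesis by (simp add: convolution_def)
  qed
  then show "f \<otimes>\<^bsub>power_series_ring R I\<^esub> g \<in> carrier (power_series_ring R I)"
    using convolution_in_carrier[of f g, OF fg] unfolding mult power_series_ring_simps by auto
qed (auto simp: power_series_ring_simps)

section \<open>Laurent series\<close>

lemma laurent_ring_simps:
  "f \<in> carrier (laurent_ring R) \<longleftrightarrow> (\<forall>i. f i \<in> carrier R) \<and> (\<exists>N. \<forall>i<N. f i = \<zero>\<^bsub>R\<^esub>)"
  "\<one>\<^bsub>laurent_ring R\<^esub> = (\<lambda>i. if i = 0 then \<one>\<^bsub>R\<^esub> else \<zero>\<^bsub>R\<^esub>)"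
  "\<zero>\<^bsub>laurent_ring R\<^esub> = (\<lambda>i. \<zero>\<^bsub>R\<^esub>)"
  "f \<oplus>\<^bsub>laurent_ring R\<^esub> g = (\<lambda>i. f i \<oplus>\<^bsub>R\<^esub> g i)"
  by (auto simp: laurent_ring_def)

lemma (in cring) laurent_mult_convolution:
  assumes f: "\<And>e. f e \<in> carrier R" and g: "\<And>e. g e \<in> carrier R"
  shows "f \<otimes>\<^bsub>laurent_ring R\<^esub> g = convolution R f g"
proof
  fix i :: int
  let ?J = "{j. f j \<noteq> \<zero> \<and> g (i - j) \<noteq> \<zero>}"
  have eq: "convolution_support R f g i = (\<lambda>j. (j, i - j)) ` ?J"
    by (auto simp: convolution_support_def image_iff)
  have "convolution R f g i = (\<Oplus>j\<in>?J. f j \<otimes> g (i - j))"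
    unfolding convolution_def eq by (subst finsum_reindex) (auto simp: inj_on_def f g)
  then show "(f \<otimes>\<^bsub>laurent_ring R\<^esub> g) i = convolution R f g i"
    by (simp add: laurent_ring_def)
qed

lemma (in cring) laurent_convolution_ring: "convolution_ring R (laurent_ring R)"
proof (intro convolution_ring.intro[OF is_cring] convolution_ring_axioms.intro)
  fix f g h and e :: int
  assume f: "f \<in> carrier (laurent_ring R)" and g: "g \<in> carrier (laurent_ring R)"
    and h: "h \<in> carrier (laurent_ring R)"
  obtain N1 N2 N3 where N: "\<forall>i<N1. f i = \<zero>" "\<forall>i<N2. g i = \<zero>" "\<forall>i<N3. h i = \<zero>"
    using f g h by (auto simp: laurent_ring_simps)
  have "{(a, b, c). a + b + c = e \<and> f a \<noteq> \<zero> \<and> g b \<noteq> \<zero> \<and> h c \<noteq> \<zero>}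
      \<subseteq> {N1..e - N2 - N3} \<times> {N2..e - N1 - N3} \<times> {N3..e - N1 - N2}"
  proof
    fix t assume "t \<in> {(a, b, c). a + b + c = e \<and> f a \<noteq> \<zero> \<and> g b \<noteq> \<zero> \<and> h c \<noteq> \<zero>}"
    then obtain a b c where t: "t = (a, b, c)" "a + b + c = e" "f a \<noteq> \<zero>" "g b \<noteq> \<zero>" "h c \<noteq> \<zero>"
      by auto
    then have "a \<ge> N1" "b \<ge> N2" "c \<ge> N3" using N not_less by blast+
    with t show "t \<in> {N1..e - N2 - N3} \<times> {N2..e - N1 - N3} \<times> {N3..e - N1 - N2}" by auto
  qed
  then show "finite {(a, b, c). a + b + c = e \<and> f a \<noteq> \<zero> \<and> g b \<noteq> \<zero> \<and> h c \<noteq> \<zero>}"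
    by (rule finite_subset) (intro finite_cartesian_product finite_atLeastAtMost_int)
next
  fix f g
  assume f: "f \<in> carrier (laurent_ring R)" and g: "g \<in> carrier (laurent_ring R)"
  then have fg: "\<And>e. f e \<in> carrier R" "\<And>e. g e \<in> carrier R" by (auto simp: laurent_ring_simps)
  then show mult: "f \<otimes>\<^bsub>laurent_ring R\<^esub> g = convolution R f g"
    by (intro laurent_mult_convolution)
  obtain N1 N2 where N: "\<forall>i<N1. f i = \<zero>" "\<forall>i<N2. g i = \<zero>"
    using f g by (auto simp: laurent_ring_simps)
  have "convolution R f g e = \<zero>" if "e < N1 + N2" for e
  proof -
    have False if "a + b = e" "f a \<noteq> \<zero>" "g b \<noteq> \<zero>" for a b
    proof -
      have "a \<ge> N1" "b \<ge> N2" using N that not_less by blast+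
      then show False using \<open>e < N1 + N2\<close> that by simp
    qed
    then have "convolution_support R f g e = {}"
      by (auto simp: convolution_support_def)
    then show ?thesis by (simp add: convolution_def)
  qed
  then show "f \<otimes>\<^bsub>laurent_ring R\<^esub> g \<in> carrier (laurent_ring R)"
    using convolution_in_carrier[of f g, OF fg] unfolding mult laurent_ring_simps by blast
next
  fix f g
  assume f: "f \<in> carrier (laurent_ring R)" and g: "g \<in> carrier (laurent_ring R)"
  obtain N1 N2 where N: "\<forall>i<N1. f i = \<zero>" "\<forall>i<N2. g i = \<zero>"
    using f g by (auto simp: laurent_ring_simps)
  then have "\<forall>i<min N1 N2. f i \<oplus> g i = \<zero>" by simp
  then show "f \<oplus>\<^bsub>laurent_ring R\<^esub> g \<in> carrier (laurent_ring R)"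
    using f g unfolding laurent_ring_simps by blast
next
  fix f assume "f \<in> carrier (laurent_ring R)"
  then show "(\<lambda>e. \<ominus> f e) \<in> carrier (laurent_ring R)"
    unfolding laurent_ring_simps by (metis a_inv_closed minus_zero)
qed (auto simp: laurent_ring_simps)

section \<open>Expansion of a power series along one variable\<close>

text \<open>This is the coefficient of \<open>y^n\<close> when a series in \<open>insert y I\<close>
  is viewed as a series in \<open>y\<close> over the series in \<open>I\<close>. The value zero
  elsewhere keeps it in the smaller carrier.\<close>

definition slice ::
    "('a, 'b) ring_scheme \<Rightarrow> 'v \<Rightarrow> 'v set \<Rightarrow> ('v multiset \<Rightarrow> 'a) \<Rightarrow> nat \<Rightarrow> 'v multiset \<Rightarrow> 'a" where
  "slice R y I f n = (\<lambda>e. if set_mset e \<subseteq> I then f (e + replicate_mset n y) else \<zero>\<^bsub>R\<^esub>)"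

lemma mset_split_variable: "filter_mset (\<lambda>x. x \<noteq> y) a + replicate_mset (count a y) y = a"
  by (rule multiset_eqI) auto

text \<open>Slicing and then applying \<open>\<phi>\<close> to each slice extends a map on series in
  \<open>I\<close> to one on series in \<open>insert y I\<close>, with Laurent series over
  \<open>L\<close> as the new target. Embeddings are built this way one variable at a time.\<close>

locale power_series_expansion = R?: cring R + L: cring L
  for R :: "('a, 'b) ring_scheme" (structure) and L :: "('c, 'd) ring_scheme"
    and y :: 'v and I and \<phi> +
  assumes y_notin: "y \<notin> I" and hom: "\<phi> \<in> ring_hom (power_series_ring R I) L"
begin

abbreviation "P \<equiv> power_series_ring R I"
abbreviation "Q \<equiv> power_series_ring R (insert y I)"

sublocale P: convolution_ring R P by (rule power_series_convolution_ring)
sublocale Q: convolution_ring R Q by (rule power_series_convolution_ring)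
sublocale LL: convolution_ring L "laurent_ring L" by (rule L.laurent_convolution_ring)
sublocale phi: ring_hom_cring P L \<phi>
  by (intro ring_hom_cringI P.is_cring L.is_cring hom)

definition expansion :: "('v multiset \<Rightarrow> 'a) \<Rightarrow> int \<Rightarrow> 'c" where
  "expansion f = (\<lambda>i. if i < 0 then \<zero>\<^bsub>L\<^esub> else \<phi> (slice R y I f (nat i)))"

lemma slice_closed: "f \<in> carrier Q \<Longrightarrow> slice R y I f n \<in> carrier P"
  by (auto simp: power_series_ring_simps slice_def)

text \<open>This is the Cauchy product in \<open>y\<close>: a decomposition of
  \<open>e + n y\<close> amounts to a split \<open>j + (n - j)\<close> of the exponent of
  \<open>y\<close> together with a decomposition of the \<open>y\<close>-free part
  \<open>e\<close>.\<close>

lemma slice_mult: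
  assumes f: "f \<in> carrier Q" and g: "g \<in> carrier Q"
  shows "slice R y I (f \<otimes>\<^bsub>Q\<^esub> g) n = (\<Oplus>\<^bsub>P\<^esub>j\<in>{..n}. slice R y I f j \<otimes>\<^bsub>P\<^esub> slice R y I g (n - j))"
proof
  fix e
  let ?s = "slice R y I"
  let ?t = "\<lambda>j. ?s f j \<otimes>\<^bsub>P\<^esub> ?s g (n - j)"
  have t: "?t \<in> {..n} \<rightarrow> carrier P" using slice_closed f g by simp
  note [simp] = P.coeff_closed[OF slice_closed[OF f]] P.coeff_closed[OF slice_closed[OF g]]
    Q.coeff_closed[OF f] Q.coeff_closed[OF g]
  show "?s (f \<otimes>\<^bsub>Q\<^esub> g) n e = (\<Oplus>\<^bsub>P\<^esub>j\<in>{..n}. ?t j) e"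
  proof (cases "set_mset e \<subseteq> I")
    case False
    then show ?thesis
      using P.A.finsum_closed[OF t] by (auto simp: slice_def power_series_ring_simps)
  next
    case e: True
    let ?S = "\<lambda>j. convolution_support R (?s f j) (?s g (n - j)) e"
    \<comment> \<open>\<open>h\<close> puts back the powers of \<open>y\<close> that slicing
      removed.\<close>
    define h where "h = (\<lambda>(j, a, b). (a + replicate_mset j y, b + replicate_mset (n - j) y))"
    have fin: "finite (?S j)" for j
      by (rule P.finite_convolution_support[OF slice_closed[OF f] slice_closed[OF g]])
    have S: "set_mset a \<subseteq> I" "set_mset b \<subseteq> I" "a + b = e"
      "f (a + replicate_mset j y) \<noteq> \<zero>" "g (b + replicate_mset (n - j) y) \<noteq> \<zero>"
      if "(a, b) \<in> ?S j" for a b j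
      using that by (auto simp: convolution_support_def slice_def split: if_splits)
    have img: "convolution_support R f g (e + replicate_mset n y) = h ` Sigma {..n} ?S"
    proof (intro subset_antisym subsetI)
      fix z assume "z \<in> convolution_support R f g (e + replicate_mset n y)"
      then obtain a b where z: "z = (a, b)" "a + b = e + replicate_mset n y" "f a \<noteq> \<zero>" "g b \<noteq> \<zero>"
        by (auto simp: convolution_support_def)
      let ?F = "filter_mset (\<lambda>x. x \<noteq> y)"
      have ab: "set_mset a \<subseteq> insert y I" "set_mset b \<subseteq> insert y I"
        using f g z(3,4) unfolding power_series_ring_simps by blast+
      have "count e y = 0" using e y_notin by (auto simp: count_eq_zero_iff)
      then have n: "count a y + count b y = n"
        using arg_cong[OF z(2), of "\<lambda>m. count m y"] by simp
      have "?F e = e" using e y_notin by (auto simp: filter_mset_eq_conv)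
      moreover have "?F (replicate_mset n y) = {#}" by simp
      ultimately have e': "?F a + ?F b = e"
        using arg_cong[OF z(2), of ?F] by simp
      have nb: "n - count a y = count b y" using n by simp
      have "?s f (count a y) (?F a) \<noteq> \<zero>" "?s g (n - count a y) (?F b) \<noteq> \<zero>"
        using ab z unfolding slice_def nb mset_split_variable by auto
      then have "(count a y, ?F a, ?F b) \<in> Sigma {..n} ?S"
        using n e' by (auto simp: convolution_support_def)
      moreover have "z = h (count a y, ?F a, ?F b)"
        unfolding h_def by (simp add: nb mset_split_variable z(1))
      ultimately show "z \<in> h ` Sigma {..n} ?S" by (rule rev_image_eqI)
    next
      fix z assume "z \<in> h ` Sigma {..n} ?S"
      then obtain j a b where z: "z = h (j, a, b)" "j \<le> n" "(a, b) \<in> ?S j" by auto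
      have "replicate_mset j y + replicate_mset (n - j) y = replicate_mset n y"
        using z(2) by (intro multiset_eqI) simp
      then have "a + replicate_mset j y + (b + replicate_mset (n - j) y) = e + replicate_mset n y"
        using S(3)[OF z(3)] by (metis add.assoc add.commute)
      then show "z \<in> convolution_support R f g (e + replicate_mset n y)"
        using S(4,5)[OF z(3)] by (simp add: z(1) h_def convolution_support_def)
    qed
    \<comment> \<open>Monomials over \<open>I\<close> do not contain \<open>y\<close>, so counting
      \<open>y\<close> in the first component recovers \<open>j\<close>.\<close>
    have inj: "inj_on h (Sigma {..n} ?S)"
    proof (rule inj_onI)
      fix u v assume uv: "u \<in> Sigma {..n} ?S" "v \<in> Sigma {..n} ?S" "h u = h v"
      obtain j a b j' a' b' where u: "u = (j, a, b)" and v: "v = (j', a', b')"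
        by (metis prod_cases3)
      have ab: "(a, b) \<in> ?S j" "(a', b') \<in> ?S j'" using uv u v by auto
      have cnt: "count a y = 0" "count a' y = 0"
        using S(1)[OF ab(1)] S(1)[OF ab(2)] y_notin by (auto simp: count_eq_zero_iff)
      have a: "a + replicate_mset j y = a' + replicate_mset j' y"
        using uv(3) by (simp add: u v h_def)
      have "j = j'" using arg_cong[OF a, of "\<lambda>m. count m y"] cnt by simp
      with a uv(3) show "u = v" by (simp add: u v h_def)
    qed
    have "?s (f \<otimes>\<^bsub>Q\<^esub> g) n e = convolution R f g (e + replicate_mset n y)"
      using e by (simp add: slice_def Q.mult_convolution[OF f g])
    also have "\<dots> = (\<Oplus>u\<in>Sigma {..n} ?S. f (fst (h u)) \<otimes> g (snd (h u)))"
      unfolding convolution_def img by (rule finsum_reindex[OF _ inj]) simp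
    also have "\<dots> = (\<Oplus>u\<in>Sigma {..n} ?S. ?s f (fst u) (fst (snd u)) \<otimes> ?s g (n - fst u) (snd (snd u)))"
    proof (rule finsum_cong'[OF refl])
      fix u assume "u \<in> Sigma {..n} ?S"
      then obtain j a b where u: "u = (j, a, b)" "(a, b) \<in> ?S j" by auto
      show "f (fst (h u)) \<otimes> g (snd (h u)) = ?s f (fst u) (fst (snd u)) \<otimes> ?s g (n - fst u) (snd (snd u))"
        using S(1,2)[OF u(2)] by (simp add: u(1) h_def slice_def)
    qed simp
    also have "\<dots> = (\<Oplus>j\<in>{..n}. \<Oplus>w\<in>?S j. ?s f j (fst w) \<otimes> ?s g (n - j) (snd w))"
      by (subst finsum_Sigma) (use fin in auto)
    also have "\<dots> = (\<Oplus>j\<in>{..n}. ?t j e)"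
      by (intro finsum_cong')
        (simp_all add: P.mult_convolution slice_closed f g convolution_def finsum_closed)
    also have "\<dots> = (\<Oplus>\<^bsub>P\<^esub>j\<in>{..n}. ?t j) e"
      by (rule P.finsum_coeff[symmetric, OF _ t]) simp
    finally show ?thesis .
  qed
qed

lemma expansion_closed: "f \<in> carrier Q \<Longrightarrow> expansion f \<in> carrier (laurent_ring L)"
  using slice_closed phi.hom_closed unfolding laurent_ring_simps expansion_def
  by (auto intro!: exI[of _ 0])

lemma expansion_mult:
  assumes f: "f \<in> carrier Q" and g: "g \<in> carrier Q"
  shows "expansion (f \<otimes>\<^bsub>Q\<^esub> g) = expansion f \<otimes>\<^bsub>laurent_ring L\<^esub> expansion g"
proof
  fix i :: int
  note fg = expansion_closed[OF f] expansion_closed[OF g]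
  note [simp] = LL.coeff_closed[OF fg(1)] LL.coeff_closed[OF fg(2)]
  show "expansion (f \<otimes>\<^bsub>Q\<^esub> g) i = (expansion f \<otimes>\<^bsub>laurent_ring L\<^esub> expansion g) i"
  proof (cases "i < 0")
    case True
    have "convolution_support L (expansion f) (expansion g) i = {}"
      using True by (auto simp: convolution_support_def expansion_def split: if_splits)
    then show ?thesis
      unfolding LL.mult_convolution[OF fg] convolution_def using True by (simp add: expansion_def)
  next
    case False
    define n where "n = nat i"
    have i: "i = int n" using False by (simp add: n_def)
    let ?h = "\<lambda>j. (int j, int (n - j))"
    \<comment> \<open>Both expansions vanish at negative exponents, so only splits of
      \<open>n\<close> into natural numbers contribute.\<close>
    have sub: "convolution_support L (expansion f) (expansion g) i \<subseteq> ?h ` {..n}"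
    proof
      fix z assume "z \<in> convolution_support L (expansion f) (expansion g) i"
      then obtain a b where z: "z = (a, b)" "a + b = int n" "a \<ge> 0" "b \<ge> 0"
        by (auto simp: convolution_support_def expansion_def i split: if_splits)
      then have "z = ?h (nat a)" "nat a \<in> {..n}" by auto
      then show "z \<in> ?h ` {..n}" by (rule image_eqI)
    qed
    have "(expansion f \<otimes>\<^bsub>laurent_ring L\<^esub> expansion g) i =
        (\<Oplus>\<^bsub>L\<^esub>z\<in>?h ` {..n}. expansion f (fst z) \<otimes>\<^bsub>L\<^esub> expansion g (snd z))"
      unfolding LL.mult_convolution[OF fg]
      by (rule LL.convolution_superset[OF fg _ sub]) (auto simp: i)
    also have "\<dots> = (\<Oplus>\<^bsub>L\<^esub>j\<in>{..n}. expansion f (int j) \<otimes>\<^bsub>L\<^esub> expansion g (int (n - j)))"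
      by (subst L.finsum_reindex) (auto simp: inj_on_def)
    also have "\<dots> = (\<Oplus>\<^bsub>L\<^esub>j\<in>{..n}. \<phi> (slice R y I f j \<otimes>\<^bsub>P\<^esub> slice R y I g (n - j)))"
      using slice_closed[OF f] slice_closed[OF g]
      by (intro L.finsum_cong') (auto simp: expansion_def nat_diff_distrib)
    also have "\<dots> = \<phi> (\<Oplus>\<^bsub>P\<^esub>j\<in>{..n}. slice R y I f j \<otimes>\<^bsub>P\<^esub> slice R y I g (n - j))"
      using slice_closed[OF f] slice_closed[OF g]
      by (subst phi.hom_finsum) (auto simp: o_def)
    finally show ?thesis
      using False by (simp add: expansion_def slice_mult[OF f g] n_def)
  qed
qed

lemma slice_one: "slice R y I \<one>\<^bsub>Q\<^esub> n = (if n = 0 then \<one>\<^bsub>P\<^esub> else \<zero>\<^bsub>P\<^esub>)"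
  by (auto simp: slice_def power_series_ring_simps fun_eq_iff)

lemma slice_add: "slice R y I (f \<oplus>\<^bsub>Q\<^esub> g) n = slice R y I f n \<oplus>\<^bsub>P\<^esub> slice R y I g n"
  by (auto simp: slice_def power_series_ring_simps fun_eq_iff)

lemma slice_variable:
  "slice R y I (\<lambda>e. if e = {#y#} then \<one> else \<zero>) n = (if n = 1 then \<one>\<^bsub>P\<^esub> else \<zero>\<^bsub>P\<^esub>)"
proof
  fix e
  have "e + replicate_mset n y = {#y#} \<longleftrightarrow> n = 1 \<and> e = {#}" if "set_mset e \<subseteq> I"
  proof
    assume eq: "e + replicate_mset n y = {#y#}"
    have "count e y = 0" using that y_notin by (auto simp: count_eq_zero_iff)
    then have "n = 1" using arg_cong[OF eq, of "\<lambda>m. count m y"] by simp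
    with eq show "n = 1 \<and> e = {#}" by simp
  qed simp
  then show "slice R y I (\<lambda>e. if e = {#y#} then \<one> else \<zero>) n e = (if n = 1 then \<one>\<^bsub>P\<^esub> else \<zero>\<^bsub>P\<^esub>) e"
    by (auto simp: slice_def power_series_ring_simps)
qed

lemma expansion_hom: "expansion \<in> ring_hom Q (laurent_ring L)"
proof (rule ring_hom_memI)
  show "expansion (f \<oplus>\<^bsub>Q\<^esub> g) = expansion f \<oplus>\<^bsub>laurent_ring L\<^esub> expansion g"
    if "f \<in> carrier Q" "g \<in> carrier Q" for f g
    using that by (auto simp: expansion_def slice_add slice_closed laurent_ring_simps fun_eq_iff)
  show "expansion \<one>\<^bsub>Q\<^esub> = \<one>\<^bsub>laurent_ring L\<^esub>"
    by (auto simp: expansion_def slice_one laurent_ring_simps fun_eq_iff)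
qed (auto simp: expansion_closed expansion_mult)

text \<open>The new variable goes to the uniformizer, the element on which the lower bound is
  tested.\<close>

lemma expansion_variable:
  "expansion (\<lambda>e. if e = {#y#} then \<one> else \<zero>) = (\<lambda>i. if i = 1 then \<one>\<^bsub>L\<^esub> else \<zero>\<^bsub>L\<^esub>)"
  by (auto simp: expansion_def slice_variable fun_eq_iff)

text \<open>The coefficient at \<open>e\<close> is found again in the slice whose index is the
  multiplicity of \<open>y\<close> in \<open>e\<close>.\<close>

lemma inj_expansion:
  assumes inj: "inj_on \<phi> (carrier P)"
  shows "inj_on expansion (carrier Q)"
proof (rule inj_onI, rule ext)
  fix f g e assume f: "f \<in> carrier Q" and g: "g \<in> carrier Q" and eq: "expansion f = expansion g"
  show "f e = g e"
  proof (cases "set_mset e \<subseteq> insert y I")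
    case True
    let ?n = "count e y" and ?e = "filter_mset (\<lambda>x. x \<noteq> y) e"
    have "slice R y I f ?n = slice R y I g ?n"
      using fun_cong[OF eq, of "int ?n"] inj slice_closed[OF f] slice_closed[OF g]
      by (auto simp: expansion_def inj_on_def)
    then have "slice R y I f ?n ?e = slice R y I g ?n ?e" by simp
    then show ?thesis using True by (auto simp: slice_def mset_split_variable split: if_splits)
  qed (use f g in \<open>auto simp: power_series_ring_simps\<close>)
qed

end

section \<open>Roots and inverses of power series\<close>

lemma (in abelian_group) add_minus_cancel:
  "a \<in> carrier G \<Longrightarrow> b \<in> carrier G \<Longrightarrow> a \<oplus> (b \<ominus> a) = b"
  by (simp add: minus_eq a_comm[of b "\<ominus> a"] r_neg2)

lemma empty_subset_mset_iff: "{#} \<subset># e \<longleftrightarrow> e \<noteq> {#}"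
  by (auto simp: subset_mset_def)

lemma diff_subset_mset: "d \<subseteq># e \<Longrightarrow> d \<noteq> {#} \<Longrightarrow> e - d \<subset># e"
proof -
  assume d: "d \<subseteq># e" "d \<noteq> {#}"
  then have "size (e - d) < size e"
    using size_mset_mono[OF d(1)] by (simp add: size_Diff_submset nonempty_has_size)
  then show ?thesis by (auto simp: subset_mset_def)
qed

context cring
begin

context
  fixes I :: "'v set"
begin

interpretation P: convolution_ring R "power_series_ring R I"
  by (rule power_series_convolution_ring)

abbreviation (input) "PS \<equiv> power_series_ring R I"

lemma power_series_coeff_empty_hom:
  "ring_hom_cring PS R (\<lambda>f. f {#})"
proof (intro ring_hom_cringI[OF P.A.is_cring is_cring] ring_hom_memI)
  fix f g assume f: "f \<in> carrier PS" and g: "g \<in> carrier PS"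
  show "(f \<otimes>\<^bsub>PS\<^esub> g) {#} = f {#} \<otimes> g {#}"
    using P.mult_coeff_single[OF f g, of "{#}" "{#}"] by simp
qed (auto simp: power_series_ring_simps)

lemma power_series_const_hom: "ring_hom_cring R PS P.const"
  by (rule P.const_hom) (auto simp: power_series_ring_simps P.const_def)

lemma power_series_mult_coeff:
  "f \<in> carrier PS \<Longrightarrow> g \<in> carrier PS \<Longrightarrow>
    (f \<otimes>\<^bsub>PS\<^esub> g) e = (\<Oplus>d\<in>{d. d \<subseteq># e}. f d \<otimes> g (e - d))"
  by (simp add: power_series_ring_def)

text \<open>It isolates the two terms containing \<open>f e\<close> and \<open>g e\<close>; all
  others involve coefficients strictly below \<open>e\<close>, which a recursion has already
  fixed.\<close>

lemma power_series_mult_coeff_split: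
  assumes f: "f \<in> carrier PS" and g: "g \<in> carrier PS" and e: "e \<noteq> {#}"
  shows "(f \<otimes>\<^bsub>PS\<^esub> g) e =
    f e \<otimes> g {#} \<oplus> (f {#} \<otimes> g e \<oplus> (\<Oplus>d\<in>{d. d \<subset># e} - {{#}}. f d \<otimes> g (e - d)))"
proof -
  note [simp] = P.coeff_closed[OF f] P.coeff_closed[OF g]
  define D where "D = {d. d \<subset># e} - {{#}}"
  have split: "{d. d \<subseteq># e} = insert e (insert {#} D)"
    using e by (auto simp: D_def subset_mset.le_less empty_subset_mset_iff)
  have "finite D" unfolding D_def
    by (rule finite_subset[OF _ finite_submultisets[of e]]) (auto simp: subset_mset.le_less)
  moreover have "e \<notin> insert {#} D" "{#} \<notin> D" using e by (auto simp: D_def)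
  ultimately show ?thesis
    unfolding power_series_mult_coeff[OF f g] split D_def[symmetric] by (simp add: finsum_closed)
qed

text \<open>The coefficients of \<open>u\<close> are found by recursion on submultisets: once those below \<open>e\<close> are
  fixed, the equation at \<open>e\<close> is linear in \<open>u e\<close> with leading coefficient \<open>c\<close>.\<close>

lemma power_series_triangular_solution:
  assumes c: "c \<in> Units R" and \<Phi>: "\<Phi> \<in> carrier PS \<rightarrow> carrier PS" and t: "t \<in> carrier PS"
    and u\<^sub>0: "u\<^sub>0 \<in> carrier R"
    and base: "\<And>u. u \<in> carrier PS \<Longrightarrow> u {#} = u\<^sub>0 \<Longrightarrow> \<Phi> u {#} = t {#}"
    and step: "\<And>u v e. u \<in> carrier PS \<Longrightarrow> v \<in> carrier PS \<Longrightarrow> u {#} = u\<^sub>0 \<Longrightarrow> v {#} = u\<^sub>0 \<Longrightarrow>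
      e \<noteq> {#} \<Longrightarrow> (\<And>d. d \<subset># e \<Longrightarrow> u d = v d) \<Longrightarrow> \<Phi> u e = \<Phi> v e \<oplus> c \<otimes> (u e \<ominus> v e)"
  shows "\<exists>u\<in>carrier PS. u {#} = u\<^sub>0 \<and> \<Phi> u = t"
proof -
  \<comment> \<open>To apply \<open>\<Phi>\<close> before \<open>u\<close> is complete, the known
    coefficients below \<open>e\<close> and the candidate \<open>r\<close> at \<open>e\<close> are
    extended by zero.\<close>
  define trunc where "trunc f e r = (\<lambda>d. if d \<subset># e then f d else if d = e then r else \<zero>)"
    for f :: "'v multiset \<Rightarrow> 'a" and e r
  \<comment> \<open>These conditions make \<open>r\<close> an admissible value at \<open>e\<close>.
    Vanishing outside \<open>I\<close> and the prescribed constant term are built in, so that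
    truncations satisfy the hypotheses of \<open>step\<close>.\<close>
  define good where "good f e r \<longleftrightarrow> r \<in> carrier R \<and> (\<not> set_mset e \<subseteq> I \<longrightarrow> r = \<zero>) \<and>
    (e = {#} \<longrightarrow> r = u\<^sub>0) \<and> (e \<noteq> {#} \<longrightarrow> \<Phi> (trunc f e r) e = t e)" for f e r
  have trunc_closed: "trunc f e r \<in> carrier PS"
    if "\<And>d. d \<subset># e \<Longrightarrow> good f d (f d)" "r \<in> carrier R" "\<not> set_mset e \<subseteq> I \<Longrightarrow> r = \<zero>" for f e r
    using that unfolding power_series_ring_simps trunc_def good_def by auto
  have "\<exists>u. \<forall>e. good u e (u e)"
  proof (rule dependent_wf_choice[of "{(d, e). d \<subset># e}"])
    show "wf {(d, e :: 'v multiset). d \<subset># e}"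
      using wfp_subset_mset by (simp add: wfp_def)
    show "good f e r = good g e r" if "\<And>d. (d, e) \<in> {(d, e). d \<subset># e} \<Longrightarrow> f d = g d" for f g e r
    proof -
      have "trunc f e r = trunc g e r" using that by (auto simp: trunc_def)
      then show ?thesis by (simp add: good_def)
    qed
    show "\<exists>r. good f e r" if "\<And>d. (d, e) \<in> {(d, e). d \<subset># e} \<Longrightarrow> good f d (f d)" for f e
    proof (cases "e = {#}")
      case True
      then show ?thesis using u\<^sub>0 by (auto simp: good_def)
    next
      case e: False
      have good: "good f d (f d)" if "d \<subset># e" for d using that \<open>\<And>d. _ \<Longrightarrow> good f d (f d)\<close> by simp
      have zero: "trunc f e \<zero> \<in> carrier PS" using good by (rule trunc_closed) auto
      have u0: "trunc f e r {#} = u\<^sub>0" for r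
        using good[of "{#}"] e by (simp add: trunc_def good_def empty_subset_mset_iff)
      show ?thesis
      proof (cases "set_mset e \<subseteq> I")
        case False
        \<comment> \<open>A monomial outside \<open>I\<close> leaves no freedom, and both sides
          vanish there.\<close>
        then have "\<Phi> (trunc f e \<zero>) e = t e"
          using \<Phi> t zero by (auto simp: power_series_ring_simps Pi_iff)
        then show ?thesis using e by (auto simp: good_def)
      next
        case I: True
        have cl: "\<Phi> (trunc f e \<zero>) e \<in> carrier R" "t e \<in> carrier R"
          using \<Phi> t zero P.coeff_closed by (auto simp: Pi_iff)
        \<comment> \<open>By \<open>step\<close>, raising the coefficient from zero to
          \<open>r\<close> adds \<open>c r\<close>; this \<open>r\<close> makes up exactly the
          missing difference.\<close>
        define r where "r = inv c \<otimes> (t e \<ominus> \<Phi> (trunc f e \<zero>) e)"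
        have r: "r \<in> carrier R" using c cl by (simp add: r_def)
        have r': "trunc f e r \<in> carrier PS" using good r I by (intro trunc_closed) auto
        have e_coeff: "trunc f e x e = x" for x by (simp add: trunc_def)
        have "\<Phi> (trunc f e r) e = \<Phi> (trunc f e \<zero>) e \<oplus> c \<otimes> (trunc f e r e \<ominus> trunc f e \<zero> e)"
          by (rule step[OF r' zero u0 u0 e]) (auto simp: trunc_def)
        also have "c \<otimes> (trunc f e r e \<ominus> trunc f e \<zero> e) = c \<otimes> r"
          using r by (simp add: e_coeff minus_eq)
        also have "\<dots> = t e \<ominus> \<Phi> (trunc f e \<zero>) e"
          unfolding r_def using c cl by (subst m_assoc[symmetric]) auto
        also have "\<Phi> (trunc f e \<zero>) e \<oplus> (t e \<ominus> \<Phi> (trunc f e \<zero>) e) = t e"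
          using cl by (rule add_minus_cancel)
        finally show ?thesis using r e I by (auto simp: good_def)
      qed
    qed
  qed
  then obtain u where u: "\<And>e. good u e (u e)" by blast
  have uP: "u \<in> carrier PS" using u unfolding power_series_ring_simps good_def by blast
  have u0: "u {#} = u\<^sub>0" using u by (simp add: good_def)
  have "\<Phi> u e = t e" for e
  proof (cases "e = {#}")
    case True
    then show ?thesis using base[OF uP u0] by simp
  next
    case False
    have tr: "trunc u e (u e) \<in> carrier PS"
      using u by (intro trunc_closed) (auto simp: good_def)
    have tr0: "trunc u e (u e) {#} = u\<^sub>0"
      using u0 False by (simp add: trunc_def empty_subset_mset_iff)
    have ue: "u e \<in> carrier R" by (rule P.coeff_closed[OF uP])
    \<comment> \<open>\<open>u\<close> and its truncation agree below \<open>e\<close> and at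
      \<open>e\<close>, so the correction term will vanish.\<close>
    have "\<Phi> u e = \<Phi> (trunc u e (u e)) e \<oplus> c \<otimes> (u e \<ominus> trunc u e (u e) e)"
      by (rule step[OF uP tr u0 tr0 False]) (simp add: trunc_def)
    also have "trunc u e (u e) e = u e" by (simp add: trunc_def)
    also have "c \<otimes> (u e \<ominus> u e) = \<zero>" using ue c by (simp add: minus_eq r_neg Units_closed)
    also have "\<Phi> (trunc u e (u e)) e = t e" using u False by (simp add: good_def)
    finally show ?thesis using P.coeff_closed[OF t] by simp
  qed
  then show ?thesis using uP u0 by blast
qed

text \<open>In the equation for \<open>g f\<close> at \<open>e\<close> the unknown
  \<open>g e\<close> has coefficient \<open>f {#}\<close>, which is the unit that drives the
  recursion.\<close>

lemma power_series_inverse: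
  assumes f: "f \<in> carrier PS" and unit: "f {#} \<in> Units R"
  shows "\<exists>g\<in>carrier PS. g \<otimes>\<^bsub>PS\<^esub> f = \<one>\<^bsub>PS\<^esub>"
proof -
  have "\<exists>g\<in>carrier PS. g {#} = inv (f {#}) \<and> g \<otimes>\<^bsub>PS\<^esub> f = \<one>\<^bsub>PS\<^esub>"
  proof (rule power_series_triangular_solution[OF unit])
    show "(u \<otimes>\<^bsub>PS\<^esub> f) {#} = \<one>\<^bsub>PS\<^esub> {#}" if "u \<in> carrier PS" "u {#} = inv (f {#})" for u
      using P.mult_coeff_single[OF that(1) f, of "{#}" "{#}"] that unit
      by (simp add: power_series_ring_simps)
    fix u v e assume u: "u \<in> carrier PS" and v: "v \<in> carrier PS"
      and u0: "u {#} = inv (f {#})" and v0: "v {#} = inv (f {#})" and e: "e \<noteq> {#}"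
      and uv: "\<And>d. d \<subset># e \<Longrightarrow> u d = v d"
    let ?r = "\<lambda>u. u {#} \<otimes> f e \<oplus> (\<Oplus>d\<in>{d. d \<subset># e} - {{#}}. u d \<otimes> f (e - d))"
    note [simp] = P.coeff_closed[OF f] P.coeff_closed[OF u] P.coeff_closed[OF v]
    have r: "?r u = ?r v"
      using uv by (auto simp: u0 v0 intro!: arg_cong2[where f = "(\<oplus>)"] finsum_cong')
    have rv: "?r v \<in> carrier R" by (auto intro!: finsum_closed)
    have "u e \<otimes> f {#} = (v e \<oplus> (u e \<ominus> v e)) \<otimes> f {#}" by (simp add: add_minus_cancel)
    also have "\<dots> = v e \<otimes> f {#} \<oplus> f {#} \<otimes> (u e \<ominus> v e)"
      by (simp add: l_distr m_comm[of "f {#}"])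
    finally have "u e \<otimes> f {#} = v e \<otimes> f {#} \<oplus> f {#} \<otimes> (u e \<ominus> v e)" .
    then show "(u \<otimes>\<^bsub>PS\<^esub> f) e = (v \<otimes>\<^bsub>PS\<^esub> f) e \<oplus> f {#} \<otimes> (u e \<ominus> v e)"
      unfolding power_series_mult_coeff_split[OF u f e] power_series_mult_coeff_split[OF v f e] r
      using rv by (simp add: a_ac)
  qed (use f unit in auto)
  then show ?thesis by blast
qed

text \<open>A product at \<open>e\<close> involves only coefficients at submultisets of
  \<open>e\<close>.\<close>

lemma power_series_nat_pow_cong:
  assumes u: "u \<in> carrier PS" and v: "v \<in> carrier PS" and uv: "\<And>d. d \<subseteq># e \<Longrightarrow> u d = v d"
  shows "(u [^]\<^bsub>PS\<^esub> (j::nat)) e = (v [^]\<^bsub>PS\<^esub> j) e"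
  using uv
proof (induction j arbitrary: e)
  case (Suc j)
  have "(u [^]\<^bsub>PS\<^esub> j) d \<otimes> u (e - d) = (v [^]\<^bsub>PS\<^esub> j) d \<otimes> v (e - d)" if "d \<subseteq># e" for d
  proof -
    have "(u [^]\<^bsub>PS\<^esub> j) d = (v [^]\<^bsub>PS\<^esub> j) d"
      using Suc.prems that by (intro Suc.IH) (meson subset_mset.order_trans)
    then show ?thesis using Suc.prems[of "e - d"] by simp
  qed
  then show ?case
    using u v P.coeff_closed by (auto simp: power_series_mult_coeff intro!: finsum_cong')
qed simp

text \<open>This is the derivative of \<open>u^j\<close> at constant term one: in each of the
  \<open>j\<close> factors a change of \<open>u e\<close> is multiplied by ones only, and all other
  contributions come from coefficients below \<open>e\<close>.\<close>

lemma power_series_nat_pow_diff: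
  assumes u: "u \<in> carrier PS" and v: "v \<in> carrier PS"
    and u0: "u {#} = \<one>" and v0: "v {#} = \<one>" and e: "e \<noteq> {#}"
    and uv: "\<And>d. d \<subset># e \<Longrightarrow> u d = v d"
  shows "(u [^]\<^bsub>PS\<^esub> (j::nat)) e = (v [^]\<^bsub>PS\<^esub> j) e \<oplus> add_pow R j (u e \<ominus> v e)"
proof (induction j)
  case 0
  then show ?case using u v P.coeff_closed[OF P.A.one_closed] by (simp add: P.coeff_closed)
next
  case (Suc j)
  interpret ev: ring_hom_cring PS R "\<lambda>f. f {#}" by (rule power_series_coeff_empty_hom)
  let ?u = "u [^]\<^bsub>PS\<^esub> j" and ?v = "v [^]\<^bsub>PS\<^esub> j"
  have uj: "?u \<in> carrier PS" and vj: "?v \<in> carrier PS" using u v by auto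
  note [simp] = P.coeff_closed[OF uj] P.coeff_closed[OF vj] P.coeff_closed[OF u] P.coeff_closed[OF v]
  have uj0: "?u {#} = \<one>" "?v {#} = \<one>"
    using ev.ring.hom_nat_pow[OF u, of j] ev.ring.hom_nat_pow[OF v, of j] u0 v0 by auto
  let ?r = "\<lambda>u' u. \<Oplus>d\<in>{d. d \<subset># e} - {{#}}. u' d \<otimes> u (e - d)"
  have r: "?r ?u u = ?r ?v v"
  proof (rule finsum_cong'[OF refl])
    fix d assume d: "d \<in> {d. d \<subset># e} - {{#}}"
    have "?u d = ?v d"
      using d uv by (intro power_series_nat_pow_cong[OF u v]) (auto intro: subset_mset.le_less_trans)
    moreover have "e - d \<subset># e"
      using d by (intro diff_subset_mset) (auto simp: subset_mset.less_imp_le)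
    ultimately show "?u d \<otimes> u (e - d) = ?v d \<otimes> v (e - d)" using uv by simp
  qed auto
  have rc: "?r ?v v \<in> carrier R" by (auto intro!: finsum_closed)
  define x where "x = u e \<ominus> v e"
  have x: "x \<in> carrier R" "u e = v e \<oplus> x"
    unfolding x_def by (simp_all add: add_minus_cancel)
  have "(u [^]\<^bsub>PS\<^esub> Suc j) e = ?u e \<oplus> (u e \<oplus> ?r ?u u)"
    using power_series_mult_coeff_split[OF uj u e] uj0 u0 by simp
  also have "\<dots> = (?v e \<oplus> (v e \<oplus> ?r ?v v)) \<oplus> (add_pow R j x \<oplus> x)"
    unfolding r Suc[folded x_def] x(2) using x(1) rc by (simp add: a_ac)
  also have "?v e \<oplus> (v e \<oplus> ?r ?v v) = (v [^]\<^bsub>PS\<^esub> Suc j) e"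
    using power_series_mult_coeff_split[OF vj v e] uj0 v0 by simp
  also have "add_pow R j x \<oplus> x = add_pow R (Suc j) x"
    using x by simp
  finally show ?case by (simp only: x_def)
qed

text \<open>A Hensel-type argument: with constant term one the equation at \<open>e\<close> is
  linear in \<open>u e\<close> with leading coefficient \<open>m\<close>, a unit by
  assumption.\<close>

lemma power_series_root:
  assumes h: "h \<in> carrier PS" and h0: "h {#} = \<zero>" and m: "add_pow R (m::nat) \<one> \<in> Units R"
  shows "\<exists>u\<in>carrier PS. u [^]\<^bsub>PS\<^esub> m = \<one>\<^bsub>PS\<^esub> \<oplus>\<^bsub>PS\<^esub> h"
proof -
  interpret ev: ring_hom_cring PS R "\<lambda>f. f {#}" by (rule power_series_coeff_empty_hom)
  have "\<exists>u\<in>carrier PS. u {#} = \<one> \<and> u [^]\<^bsub>PS\<^esub> m = \<one>\<^bsub>PS\<^esub> \<oplus>\<^bsub>PS\<^esub> h"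
  proof (rule power_series_triangular_solution[OF m])
    show "(u [^]\<^bsub>PS\<^esub> m) {#} = (\<one>\<^bsub>PS\<^esub> \<oplus>\<^bsub>PS\<^esub> h) {#}" if "u \<in> carrier PS" "u {#} = \<one>" for u
      using that h h0 ev.ring.hom_nat_pow[OF that(1), of m] by simp
    fix u v e assume *: "u \<in> carrier PS" "v \<in> carrier PS" "u {#} = \<one>" "v {#} = \<one>" "e \<noteq> {#}"
      "\<And>d. d \<subset># e \<Longrightarrow> u d = v d"
    have "u e \<ominus> v e \<in> carrier R" using * P.coeff_closed by simp
    then have "add_pow R m \<one> \<otimes> (u e \<ominus> v e) = add_pow R m (u e \<ominus> v e)"
      by (simp add: add_pow_ldistr)
    then show "(u [^]\<^bsub>PS\<^esub> m) e = (v [^]\<^bsub>PS\<^esub> m) e \<oplus> add_pow R m \<one> \<otimes> (u e \<ominus> v e)"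
      using power_series_nat_pow_diff[OF *] by simp
  qed (use h in auto)
  then show ?thesis by blast
qed

lemma power_series_sum_of_powers:
  assumes h: "h \<in> carrier PS" and h0: "h {#} = \<zero>" and m: "add_pow R (m::nat) \<one> \<in> Units R"
    and g: "is_sum_of_powers R m g (\<ominus> \<one>)"
  shows "is_sum_of_powers PS m (Suc g) h"
proof -
  interpret c: ring_hom_cring R PS P.const by (rule power_series_const_hom)
  obtain u where u: "u \<in> carrier PS" "u [^]\<^bsub>PS\<^esub> m = \<one>\<^bsub>PS\<^esub> \<oplus>\<^bsub>PS\<^esub> h"
    using power_series_root[OF h h0 m] by blast
  have "is_sum_of_powers PS m g (\<ominus>\<^bsub>PS\<^esub> \<one>\<^bsub>PS\<^esub>)"
    using c.is_sum_of_powers_hom[OF g] by simp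
  moreover have "h = u [^]\<^bsub>PS\<^esub> m \<oplus>\<^bsub>PS\<^esub> \<ominus>\<^bsub>PS\<^esub> \<one>\<^bsub>PS\<^esub>"
    unfolding u(2) using h by (simp add: P.A.a_comm[of "\<one>\<^bsub>PS\<^esub>" h] P.A.a_assoc P.A.r_neg)
  ultimately show ?thesis using u(1) P.A.is_sum_of_powers_Suc_iff by blast
qed

end

end

section \<open>The field of Laurent series\<close>

context cring
begin

interpretation L: convolution_ring R "laurent_ring R"
  by (rule laurent_convolution_ring)

lemma laurent_const_hom: "ring_hom_cring R (laurent_ring R) L.const"
  by (rule L.const_hom) (auto simp: laurent_ring_simps L.const_def)

definition laurent_monom :: "int \<Rightarrow> int \<Rightarrow> 'a" where
  "laurent_monom v = (\<lambda>i. if i = v then \<one> else \<zero>)"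

lemma laurent_monom_closed: "laurent_monom v \<in> carrier (laurent_ring R)"
  by (auto simp: laurent_monom_def laurent_ring_simps)

lemma laurent_monom_mult_coeff:
  assumes f: "f \<in> carrier (laurent_ring R)"
  shows "(laurent_monom v \<otimes>\<^bsub>laurent_ring R\<^esub> f) i = f (i - v)"
proof -
  have "(laurent_monom v \<otimes>\<^bsub>laurent_ring R\<^esub> f) (v + (i - v)) = laurent_monom v v \<otimes> f (i - v)"
    by (rule L.mult_coeff_single[OF laurent_monom_closed f])
      (auto simp: laurent_monom_def split: if_splits)
  then show ?thesis using L.coeff_closed[OF f] by (simp add: laurent_monom_def)
qed

lemma laurent_monom_mult:
  "laurent_monom v \<otimes>\<^bsub>laurent_ring R\<^esub> laurent_monom w = laurent_monom (v + w)"
  by (rule ext, unfold laurent_monom_mult_coeff[OF laurent_monom_closed])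
    (auto simp: laurent_monom_def)

lemma laurent_monom_0: "laurent_monom 0 = \<one>\<^bsub>laurent_ring R\<^esub>"
  by (simp add: laurent_monom_def laurent_ring_simps)

lemma laurent_monom_pow:
  "laurent_monom v [^]\<^bsub>laurent_ring R\<^esub> (m::nat) = laurent_monom (int m * v)"
  by (induction m) (simp_all add: laurent_monom_0 laurent_monom_mult algebra_simps)

text \<open>\<open>v\<close> is only a lower bound of the valuation and \<open>f v\<close> may
  vanish. This generality lets one \<open>v\<close> serve all summands of a sum of powers at
  once.\<close>

lemma laurent_pow_leading:
  assumes f: "f \<in> carrier (laurent_ring R)" and v: "\<And>i. i < v \<Longrightarrow> f i = \<zero>"
  shows "(\<forall>i < int m * v. (f [^]\<^bsub>laurent_ring R\<^esub> m) i = \<zero>) \<and>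
    (f [^]\<^bsub>laurent_ring R\<^esub> m) (int m * v) = f v [^] m"
proof (induction m)
  case 0
  then show ?case by (simp add: laurent_ring_simps)
next
  case (Suc m)
  let ?g = "f [^]\<^bsub>laurent_ring R\<^esub> m"
  have g: "?g \<in> carrier (laurent_ring R)" using f by simp
  have ge: "a \<ge> int m * v" "b \<ge> v" if "?g a \<noteq> \<zero>" "f b \<noteq> \<zero>" for a b
    using Suc v that not_less by blast+
  have "(?g \<otimes>\<^bsub>laurent_ring R\<^esub> f) i = \<zero>" if "i < int m * v + v" for i
  proof (rule ccontr)
    assume "(?g \<otimes>\<^bsub>laurent_ring R\<^esub> f) i \<noteq> \<zero>"
    then have "convolution R ?g f i \<noteq> \<zero>" by (simp only: L.mult_convolution[OF g f] not_False_eq_True)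
    then obtain a b where ab: "a + b = i" "?g a \<noteq> \<zero>" "f b \<noteq> \<zero>"
      by (rule L.convolution_nonzero)
    then show False using ge[OF ab(2,3)] that by simp
  qed
  moreover have "(?g \<otimes>\<^bsub>laurent_ring R\<^esub> f) (int m * v + v) = ?g (int m * v) \<otimes> f v"
  proof (rule L.mult_coeff_single[OF g f])
    fix a b assume "a + b = int m * v + v" "?g a \<noteq> \<zero>" "f b \<noteq> \<zero>"
    then show "a = int m * v \<and> b = v" using ge[of a b] by simp
  qed
  ultimately show ?case using Suc by (simp add: algebra_simps)
qed

text \<open>A whole family is treated at once because a sum of powers is governed by the least
  valuation among its summands; the uniform bound \<open>N\<close> makes that minimum exist.\<close>

lemma laurent_valuation:
  fixes f :: "'j \<Rightarrow> int \<Rightarrow> 'a"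
  assumes "\<And>j i. j \<in> J \<Longrightarrow> i < N \<Longrightarrow> f j i = \<zero>" and "j \<in> J" "f j i \<noteq> \<zero>"
  obtains v j where "j \<in> J" "f j v \<noteq> \<zero>" "\<And>j i. j \<in> J \<Longrightarrow> i < v \<Longrightarrow> f j i = \<zero>"
proof -
  define n where "n = (LEAST n. \<exists>j\<in>J. f j (N + int n) \<noteq> \<zero>)"
  have "i \<ge> N" using assms not_less by blast
  then have "f j (N + int (nat (i - N))) \<noteq> \<zero>" using assms by simp
  then have "\<exists>j\<in>J. f j (N + int n) \<noteq> \<zero>"
    using LeastI_ex[of "\<lambda>n. \<exists>j\<in>J. f j (N + int n) \<noteq> \<zero>", folded n_def] assms(2) by blast
  then obtain j' where j': "j' \<in> J" "f j' (N + int n) \<noteq> \<zero>" by blast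
  have "f j i = \<zero>" if "j \<in> J" "i < N + int n" for i j
  proof (cases "i < N")
    case False
    then have "nat (i - N) < n" using that by auto
    from not_less_Least[OF this[unfolded n_def]] show ?thesis using False that by auto
  qed (use that assms in auto)
  with j' show ?thesis using that by blast
qed

text \<open>Series in no variables are just \<open>R\<close>, by way of the constant term, so
  expansion along a single variable reaches every Laurent series without negative exponents.\<close>

lemma laurent_nonneg_expansion:
  assumes F: "F \<in> carrier (laurent_ring R)" and neg: "\<And>i. i < 0 \<Longrightarrow> F i = \<zero>"
  obtains f where "f \<in> carrier (power_series_ring R {()})" "f {#} = F 0"
    "power_series_expansion.expansion R R () {} (\<lambda>f. f {#}) f = F"
proof -
  interpret E: power_series_expansion R R "()" "{}" "\<lambda>f. f {#}"
    using power_series_coeff_empty_hom[of "{}"]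
    by unfold_locales (auto simp: ring_hom_cring_def ring_hom_cring_axioms_def)
  \<comment> \<open>A multiset over \<open>unit\<close> is determined by its size, which is the
    exponent.\<close>
  let ?f = "\<lambda>e :: unit multiset. F (int (size e))"
  have "E.expansion ?f = F"
    using neg by (auto simp: E.expansion_def slice_def fun_eq_iff)
  moreover have "?f \<in> carrier (power_series_ring R {()})"
    using L.coeff_closed[OF F] by (auto simp: power_series_ring_simps)
  ultimately show ?thesis using that[of ?f] by simp
qed

lemma laurent_expansion_hom:
  "ring_hom_cring (power_series_ring R {y}) (laurent_ring R)
    (power_series_expansion.expansion R R y {} (\<lambda>f. f {#}))"
proof -
  interpret E: power_series_expansion R R y "{}" "\<lambda>f. f {#}"
    using power_series_coeff_empty_hom[of "{}"]
    by unfold_locales (auto simp: ring_hom_cring_def ring_hom_cring_axioms_def)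
  show ?thesis
    using E.expansion_hom
    by (intro ring_hom_cringI L.is_cring convolution_ring.is_cring[OF power_series_convolution_ring])
qed

lemma laurent_sum_of_powers:
  assumes m: "add_pow R (m::nat) \<one> \<in> Units R" and m0: "m > 0"
    and g: "is_sum_of_powers R m g (\<ominus> \<one>)"
    and F: "F \<in> carrier (laurent_ring R)"
  shows "is_sum_of_powers (laurent_ring R) m (Suc g) F"
proof -
  let ?L = "laurent_ring R"
  interpret E: ring_hom_cring "power_series_ring R {()}" ?L
    "power_series_expansion.expansion R R () {} (\<lambda>f. f {#})"
    by (rule laurent_expansion_hom)
  obtain N where N: "\<And>i. i < N \<Longrightarrow> F i = \<zero>" using F by (auto simp: laurent_ring_simps)
  \<comment> \<open>Multiplication by \<open>x^(m k)\<close>, an \<open>m\<close>-th power, has to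
    move the lower bound \<open>N\<close> above zero, so that the constant term vanishes;
    \<open>k > |N|\<close> suffices because \<open>m \<ge> 1\<close>.\<close>
  define k where "k = \<bar>N\<bar> + 1"
  have "k \<le> int m * k" using m0 by (simp add: k_def)
  then have big: "i - int m * k < N" if "i \<le> 0" for i using that unfolding k_def by linarith
  let ?G = "laurent_monom (int m * k) \<otimes>\<^bsub>?L\<^esub> F"
  have G: "?G \<in> carrier ?L" using F laurent_monom_closed by simp
  have "?G i = \<zero>" if "i \<le> 0" for i
    using N[OF big[OF that]] by (simp add: laurent_monom_mult_coeff[OF F])
  then obtain f where f: "f \<in> carrier (power_series_ring R {()})" "f {#} = \<zero>"
    "power_series_expansion.expansion R R () {} (\<lambda>f. f {#}) f = ?G"
    using laurent_nonneg_expansion[OF G] by (metis less_imp_le order_refl)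
  have "is_sum_of_powers ?L m (Suc g) ?G"
    using E.is_sum_of_powers_hom[OF power_series_sum_of_powers[OF f(1,2) m g]] by (simp only: f(3))
  then have "is_sum_of_powers ?L m (Suc g) (laurent_monom (-k) [^]\<^bsub>?L\<^esub> m \<otimes>\<^bsub>?L\<^esub> ?G)"
    by (rule L.A.is_sum_of_powers_mult_power[OF laurent_monom_closed])
  also have "laurent_monom (-k) [^]\<^bsub>?L\<^esub> m \<otimes>\<^bsub>?L\<^esub> ?G = F"
    using F laurent_monom_closed
    by (simp add: laurent_monom_pow L.A.m_assoc[symmetric] laurent_monom_mult laurent_monom_0)
  finally show ?thesis .
qed

text \<open>For power series over a field a root is extracted at one summand of the constant term,
  which has to be invertible; zero summands are moved aside and serve as padding.\<close>

lemma is_sum_of_powers_nonzero_summand: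
  assumes "is_sum_of_powers R n g x" "x \<noteq> \<zero>" "n > 0"
  shows "\<exists>a\<in>carrier R. \<exists>y h. a \<noteq> \<zero> \<and> g = Suc h \<and> is_sum_of_powers R n h y \<and> x = a [^] n \<oplus> y"
  using assms(1,2)
proof (induction g arbitrary: x)
  case (Suc g)
  then obtain a y where a: "a \<in> carrier R" "is_sum_of_powers R n g y" "x = a [^] n \<oplus> y"
    by (auto simp: is_sum_of_powers_Suc_iff)
  show ?case
  proof (cases "a = \<zero>")
    case True
    then have x: "x = y" using a assms(3) by (simp add: nat_pow_zero is_sum_of_powers_closed)
    then obtain b z h where b: "b \<in> carrier R" "b \<noteq> \<zero>" "g = Suc h" "is_sum_of_powers R n h z"
      "y = b [^] n \<oplus> z"
      using Suc.IH[OF a(2)] Suc.prems(2) by blast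
    then show ?thesis
      using x is_sum_of_powers_mono[OF b(4) _ assms(3), of g] by auto
  qed (use a in blast)
qed (simp add: is_sum_of_powers_0_iff)

end

section \<open>Leading coefficients over a field\<close>

context field
begin

interpretation L: convolution_ring R "laurent_ring R"
  by (rule laurent_convolution_ring)

lemma laurent_field: "field (laurent_ring R)"
proof (rule cring.cring_fieldI2[OF L.is_cring])
  let ?L = "laurent_ring R"
  show "\<zero>\<^bsub>?L\<^esub> \<noteq> \<one>\<^bsub>?L\<^esub>" by (simp add: laurent_ring_simps fun_eq_iff)
  fix F assume F: "F \<in> carrier ?L" "F \<noteq> \<zero>\<^bsub>?L\<^esub>"
  interpret E: ring_hom_cring "power_series_ring R {()}" ?L
    "power_series_expansion.expansion R R () {} (\<lambda>f. f {#})"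
    by (rule laurent_expansion_hom)
  obtain N i where "\<And>i. i < N \<Longrightarrow> F i = \<zero>" "F i \<noteq> \<zero>"
    using F by (auto simp: laurent_ring_simps fun_eq_iff)
  then obtain v where v: "F v \<noteq> \<zero>" "\<And>i. i < v \<Longrightarrow> F i = \<zero>"
    using laurent_valuation[of "{()}" N "\<lambda>_. F" "()" i] by auto
  \<comment> \<open>Division by \<open>x^v\<close> makes the constant term nonzero, so the inverse
    can be taken among power series and shifted back.\<close>
  let ?G = "laurent_monom (-v) \<otimes>\<^bsub>?L\<^esub> F"
  have G: "?G \<in> carrier ?L" using F laurent_monom_closed by simp
  have Gi: "?G i = F (i + v)" for i by (simp add: laurent_monom_mult_coeff[OF F(1)])
  obtain f where f: "f \<in> carrier (power_series_ring R {()})" "f {#} = F v"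
    "power_series_expansion.expansion R R () {} (\<lambda>f. f {#}) f = ?G"
    using laurent_nonneg_expansion[OF G] v(2) by (auto simp: Gi)
  have "f {#} \<in> Units R" using f(2) v(1) L.coeff_closed[OF F(1)] field_Units by auto
  then obtain g where g: "g \<in> carrier (power_series_ring R {()})"
    "g \<otimes>\<^bsub>power_series_ring R {()}\<^esub> f = \<one>\<^bsub>power_series_ring R {()}\<^esub>"
    using power_series_inverse[OF f(1)] by blast
  let ?g = "power_series_expansion.expansion R R () {} (\<lambda>f. f {#}) g"
  have "?g \<otimes>\<^bsub>?L\<^esub> ?G = \<one>\<^bsub>?L\<^esub>"
    using E.hom_mult[OF g(1) f(1)] unfolding f(3) g(2) by simp
  moreover have gL: "?g \<in> carrier ?L" using g(1) by (rule E.hom_closed)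
  ultimately have "F \<otimes>\<^bsub>?L\<^esub> (?g \<otimes>\<^bsub>?L\<^esub> laurent_monom (-v)) = \<one>\<^bsub>?L\<^esub>"
    using F(1) laurent_monom_closed by (simp add: L.A.m_ac)
  then show "\<exists>b\<in>carrier ?L. F \<otimes>\<^bsub>?L\<^esub> b = \<one>\<^bsub>?L\<^esub>"
    using gL laurent_monom_closed by blast
qed

text \<open>Dividing a vanishing sum by one nonzero summand writes \<open>-1\<close> as a sum of the
  remaining \<open>g - 1\<close> powers.\<close>

lemma is_sum_of_powers_zero_nontrivial:
  assumes a: "a \<in> {..<g} \<rightarrow> carrier R" and sum: "(\<Oplus>i\<in>{..<g}. a i [^] (m::nat)) = \<zero>"
    and j: "j < g" "a j \<noteq> \<zero>"
  shows "is_sum_of_powers R m (g - 1) (\<ominus> \<one>)"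
proof -
  let ?S = "\<Oplus>i\<in>{..<g} - {j}. a i [^] m"
  have aj: "a j \<in> carrier R" using a j by auto
  have S: "?S \<in> carrier R" using a by (intro finsum_closed) auto
  have "is_sum_of_powers R m (card ({..<g} - {j})) ?S"
    using a by (intro is_sum_of_powers_finsum) auto
  then have SP: "is_sum_of_powers R m (g - 1) ?S" using j by simp
  have "{..<g} = insert j ({..<g} - {j})" using j by auto
  then have "(\<Oplus>i\<in>{..<g}. a i [^] m) = (\<Oplus>i\<in>insert j ({..<g} - {j}). a i [^] m)" by simp
  also have "\<dots> = a j [^] m \<oplus> ?S" using a aj by (intro finsum_insert) auto
  finally have "?S = \<ominus> (a j [^] m)"
    using sum aj S by (metis a_comm minus_equality nat_pow_closed)
  moreover have "inv (a j) \<in> carrier R" "inv (a j) \<otimes> a j = \<one>"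
    using aj j field_Units by auto
  then have "inv (a j) [^] m \<otimes> \<ominus> (a j [^] m) = \<ominus> \<one>"
    using aj by (simp add: r_minus nat_pow_distrib[symmetric])
  ultimately show ?thesis
    using is_sum_of_powers_mult_power[OF \<open>inv (a j) \<in> carrier R\<close> SP] by simp
qed

text \<open>Without cancellation in the leading coefficient, the valuation of a sum of \<open>m\<close>-th powers
  is divisible by \<open>m\<close>.\<close>

lemma laurent_sum_of_powers_leading:
  assumes sp: "is_sum_of_powers (laurent_ring R) m g F"
    and F: "F \<noteq> \<zero>\<^bsub>laurent_ring R\<^esub>" and no: "\<not> is_sum_of_powers R m (g - 1) (\<ominus> \<one>)" and m: "m > 0"
  shows "\<exists>v. F (int m * v) \<noteq> \<zero> \<and> is_sum_of_powers R m g (F (int m * v))"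
proof -
  let ?L = "laurent_ring R"
  obtain f where f: "\<And>i. i < g \<Longrightarrow> f i \<in> carrier ?L"
    and Fsum: "F = (\<Oplus>\<^bsub>?L\<^esub>i\<in>{..<g}. f i [^]\<^bsub>?L\<^esub> m)"
    using sp by (auto simp: is_sum_of_powers_def)
  have ex: "\<exists>j<g. f j \<noteq> \<zero>\<^bsub>?L\<^esub>"
  proof (rule ccontr)
    assume "\<not> ?thesis"
    then have "F = (\<Oplus>\<^bsub>?L\<^esub>i\<in>{..<g}. \<zero>\<^bsub>?L\<^esub>)"
      unfolding Fsum using m by (intro L.A.finsum_cong') (auto simp: L.A.nat_pow_zero)
    then show False using F by simp
  qed
  have "\<forall>i\<in>{..<g}. \<exists>N. \<forall>e<N. f i e = \<zero>" using f by (auto simp: laurent_ring_simps)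
  then obtain Nf where Nf: "\<And>i e. i < g \<Longrightarrow> e < Nf i \<Longrightarrow> f i e = \<zero>" by (metis lessThan_iff)
  have N: "f i e = \<zero>" if "i \<in> {..<g}" "e < Min (Nf ` {..<g})" for i e
  proof -
    have "Min (Nf ` {..<g}) \<le> Nf i" using that by (intro Min_le) auto
    then show ?thesis using Nf[of i e] that by simp
  qed
  obtain j e where j: "j < g" "f j e \<noteq> \<zero>"
    using ex by (auto simp: laurent_ring_simps fun_eq_iff)
  \<comment> \<open>The minimum is taken over all summands together; those of larger valuation
    contribute zero at exponent \<open>m v\<close>.\<close>
  obtain v j where v: "j \<in> {..<g}" "f j v \<noteq> \<zero>" "\<And>i e. i \<in> {..<g} \<Longrightarrow> e < v \<Longrightarrow> f i e = \<zero>"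
    by (rule laurent_valuation[of "{..<g}" "Min (Nf ` {..<g})" f j e]) (use N j in auto)
  have fv: "(\<lambda>i. f i v) \<in> {..<g} \<rightarrow> carrier R" using f L.coeff_closed by auto
  have "F (int m * v) = (\<Oplus>i\<in>{..<g}. (f i [^]\<^bsub>?L\<^esub> m) (int m * v))"
    unfolding Fsum using f by (intro L.finsum_coeff) auto
  also have "\<dots> = (\<Oplus>i\<in>{..<g}. f i v [^] m)"
    using fv f v(3) laurent_pow_leading by (intro finsum_cong') auto
  finally have Fv: "F (int m * v) = (\<Oplus>i\<in>{..<g}. f i v [^] m)" .
  have "F (int m * v) \<noteq> \<zero>"
    using is_sum_of_powers_zero_nontrivial[OF fv _ _ v(2)] v(1) no Fv by auto
  moreover have "is_sum_of_powers R m g (F (int m * v))"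
    unfolding Fv is_sum_of_powers_def using fv by (intro exI[of _ "\<lambda>i. f i v"]) auto
  ultimately show ?thesis by blast
qed

lemma laurent_level:
  assumes m: "m > 0"
  shows "level m (laurent_ring R) = level m R"
proof (rule antisym)
  let ?L = "laurent_ring R"
  interpret c: ring_hom_cring R ?L L.const by (rule laurent_const_hom)
  show "level m ?L \<le> level m R" by (rule c.level_hom_le[OF m])
  show "level m R \<le> level m ?L"
  proof (cases "level m ?L")
    case (enat g)
    then have g: "g > 0" "is_sum_of_powers ?L m g (\<ominus>\<^bsub>?L\<^esub> \<one>\<^bsub>?L\<^esub>)"
      using L.A.level_le_iff[OF m, of g] by auto
    have coeff: "(\<ominus>\<^bsub>?L\<^esub> \<one>\<^bsub>?L\<^esub>) i = (if i = 0 then \<ominus> \<one> else \<zero>)" for i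
      by (simp add: L.minus_coeff) (simp add: laurent_ring_simps)
    have "is_sum_of_powers R m g (\<ominus> \<one>)"
    proof (rule ccontr)
      assume no: "\<not> ?thesis"
      \<comment> \<open>If \<open>g\<close> powers in \<open>R\<close> do not suffice, neither do
        \<open>g - 1\<close>, so leading coefficients cannot cancel. As the series \<open>-1\<close>
        lives at exponent zero alone, its value there is then a sum of \<open>g\<close> powers in
        \<open>R\<close>, a contradiction.\<close>
      then have "\<not> is_sum_of_powers R m (g - 1) (\<ominus> \<one>)"
        using is_sum_of_powers_mono[OF _ _ m, of "g - 1" _ g] by auto
      moreover have "\<ominus>\<^bsub>?L\<^esub> \<one>\<^bsub>?L\<^esub> \<noteq> \<zero>\<^bsub>?L\<^esub>"
      proof
        assume "\<ominus>\<^bsub>?L\<^esub> \<one>\<^bsub>?L\<^esub> = \<zero>\<^bsub>?L\<^esub>"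
        then have "(\<ominus>\<^bsub>?L\<^esub> \<one>\<^bsub>?L\<^esub>) 0 = \<zero>\<^bsub>?L\<^esub> 0" by (rule fun_cong)
        then have "\<ominus> \<one> = \<zero>" unfolding coeff by (simp add: laurent_ring_simps)
        then show False using minus_minus[OF one_closed] one_not_zero by simp
      qed
      ultimately obtain v where "(\<ominus>\<^bsub>?L\<^esub> \<one>\<^bsub>?L\<^esub>) (int m * v) \<noteq> \<zero>"
          "is_sum_of_powers R m g ((\<ominus>\<^bsub>?L\<^esub> \<one>\<^bsub>?L\<^esub>) (int m * v))"
        using laurent_sum_of_powers_leading[OF g(2) _ _ m] by blast
      with no show False unfolding coeff by (auto split: if_splits)
    qed
    then show ?thesis unfolding enat using level_le_iff[OF m] g(1) by simp
  qed simp
qed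

lemma laurent_variable_sum_of_powers:
  assumes m: "m > 1" and sp: "is_sum_of_powers (laurent_ring R) m g (laurent_monom 1)"
  shows "level m R + 1 \<le> enat g"
proof -
  have m0: "m > 0" using m by simp
  have X: "laurent_monom 1 \<noteq> \<zero>\<^bsub>laurent_ring R\<^esub>"
    by (auto simp: laurent_monom_def laurent_ring_simps fun_eq_iff)
  have "is_sum_of_powers R m (g - 1) (\<ominus> \<one>)"
  proof (rule ccontr)
    assume "\<not> ?thesis"
    then obtain v where "laurent_monom 1 (int m * v) \<noteq> \<zero>"
      using laurent_sum_of_powers_leading[OF sp X _ m0] by blast
    then have "int m * v = 1" by (auto simp: laurent_monom_def split: if_splits)
    then show False using m by (simp add: zmult_eq_1_iff)
  qed
  \<comment> \<open>With natural subtraction this excludes \<open>g = 0\<close> and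
    \<open>g = 1\<close>, so that adding one gives back \<open>g\<close>.\<close>
  moreover from this have "g - 1 > 0"
    using one_not_zero by (cases "g - 1") (auto simp: is_sum_of_powers_0_iff)
  ultimately have "level m R \<le> enat (g - 1)" by (simp add: level_le_iff[OF m0])
  then have "level m R + 1 \<le> enat (g - 1) + 1" by (rule add_right_mono)
  also have "\<dots> = enat g" using \<open>g - 1 > 0\<close> by (simp add: one_enat_def)
  finally show ?thesis .
qed

end

section \<open>Waring numbers in terms of levels\<close>

text \<open>A single witness \<open>t\<close> suffices for the lower bound: by \<open>all\<close> it
  is itself a sum of powers, so any Waring bound applies to it.\<close>

lemma (in cring) waring_number_eqI:
  assumes m: "m > 0" and g: "l = enat g"
    and all: "\<And>x. x \<in> carrier R \<Longrightarrow> is_sum_of_powers R m (Suc g) x"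
    and t: "t \<in> carrier R" "\<And>h. is_sum_of_powers R m h t \<Longrightarrow> l + 1 \<le> enat h"
  shows "waring_number m R = l + 1"
proof (rule enat_eqI)
  fix h
  have "waring_number m R \<le> enat h \<longleftrightarrow> Suc g \<le> h"
    unfolding waring_number_le_iff[OF m]
  proof
    assume "h > 0 \<and> (\<forall>x k. is_sum_of_powers R m k x \<longrightarrow> is_sum_of_powers R m h x)"
    then have "is_sum_of_powers R m h t" using all t(1) by blast
    then show "Suc g \<le> h" using t(2)[of h] by (simp add: g one_enat_def)
  next
    assume "Suc g \<le> h"
    then show "h > 0 \<and> (\<forall>x k. is_sum_of_powers R m k x \<longrightarrow> is_sum_of_powers R m h x)"
      using is_sum_of_powers_mono[OF all _ m] is_sum_of_powers_closed by auto
  qed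
  then show "waring_number m R \<le> enat h \<longleftrightarrow> l + 1 \<le> enat h" by (simp add: g one_enat_def)
qed

text \<open>Evaluation at zero retracts the power series ring onto the constants, hence the lower
  bound \<open>waring_number m R\<close>. Conversely, a series with nonzero constant term
  \<open>a^m + y\<close>, \<open>a \<noteq> 0\<close>, needs no more powers than its constant term:
  after subtracting the constant \<open>y\<close>, what is left has constant term \<open>a^m\<close>
  and is an \<open>m\<close>-th power.\<close>

lemma (in field) power_series_waring_number:
  assumes m: "m > 0" and char: "add_pow R m \<one> \<noteq> \<zero>" and g: "level m R = enat g"
    and t: "t \<in> carrier (power_series_ring R I)" "t {#} = \<zero>"
      "\<And>h. is_sum_of_powers (power_series_ring R I) m h t \<Longrightarrow> level m R + 1 \<le> enat h"
  shows "waring_number m (power_series_ring R I) = max (waring_number m R) (level m R + 1)"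
proof (rule enat_eqI)
  let ?P = "power_series_ring R I"
  interpret P: convolution_ring R ?P by (rule power_series_convolution_ring)
  interpret ev: ring_hom_cring ?P R "\<lambda>f. f {#}" by (rule power_series_coeff_empty_hom)
  interpret c: ring_hom_cring R ?P P.const by (rule power_series_const_hom)
  have unit: "add_pow R m \<one> \<in> Units R" using char field_Units by auto
  have sg: "is_sum_of_powers R m g (\<ominus> \<one>)" using level_le_iff[OF m, of g] g by simp
  fix h
  show "waring_number m ?P \<le> enat h \<longleftrightarrow> max (waring_number m R) (level m R + 1) \<le> enat h"
    unfolding P.A.waring_number_le_iff[OF m] max.bounded_iff waring_number_le_iff[OF m]
  proof safe
    assume all: "\<forall>x k. is_sum_of_powers ?P m k x \<longrightarrow> is_sum_of_powers ?P m h x"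
    show "is_sum_of_powers R m h x" if "is_sum_of_powers R m k x" for x k
    proof -
      have "is_sum_of_powers ?P m h (P.const x)" using all c.is_sum_of_powers_hom[OF that] by blast
      from ev.is_sum_of_powers_hom[OF this] show ?thesis by (simp add: P.const_def)
    qed
    show "level m R + 1 \<le> enat h"
      using all t power_series_sum_of_powers[OF t(1,2) unit sg] by blast
  next
    fix f k assume all: "\<forall>x k. is_sum_of_powers R m k x \<longrightarrow> is_sum_of_powers R m h x"
      and le: "level m R + 1 \<le> enat h" and f: "is_sum_of_powers ?P m k f"
    have fP: "f \<in> carrier ?P" using f by (rule P.A.is_sum_of_powers_closed)
    have f0: "is_sum_of_powers R m h (f {#})" using all ev.is_sum_of_powers_hom[OF f] by blast
    show "is_sum_of_powers ?P m h f"
    proof (cases "f {#} = \<zero>")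
      case True
      have "Suc g \<le> h" using le by (simp add: g one_enat_def)
      with power_series_sum_of_powers[OF fP True unit sg] show ?thesis
        using P.A.is_sum_of_powers_mono m by blast
    next
      case False
      then obtain a y l where a: "a \<in> carrier R" "a \<noteq> \<zero>" "h = Suc l"
        "is_sum_of_powers R m l y" "f {#} = a [^] m \<oplus> y"
        using is_sum_of_powers_nonzero_summand[OF f0 _ m] by blast
      have y: "y \<in> carrier R" using a(4) by (rule is_sum_of_powers_closed)
      have am: "a [^] m \<in> Units R" "a [^] m \<in> carrier R"
        using a field_Units nat_pow_eq_zero by auto
      define r where "r = f \<ominus>\<^bsub>?P\<^esub> P.const y"
      have r: "r \<in> carrier ?P" "r {#} = a [^] m"
      proof -
        have cy: "P.const y \<in> carrier ?P" "P.const y {#} = y"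
          using y by (auto simp only: c.hom_closed) (simp add: P.const_def)
        show "r \<in> carrier ?P" using fP cy by (simp add: r_def)
        have "r {#} = f {#} \<oplus> \<ominus> y" using fP cy by (simp add: r_def P.A.minus_eq)
        then show "r {#} = a [^] m" using a(5) y am by (simp add: a_assoc r_neg)
      qed
      \<comment> \<open>Dividing by \<open>a^m\<close> normalizes the constant term to one, the form
        in which roots exist.\<close>
      define q where "q = P.const (inv (a [^] m)) \<otimes>\<^bsub>?P\<^esub> r"
      have q: "q \<in> carrier ?P" "q {#} = \<one>"
      proof -
        have ca: "P.const (inv (a [^] m)) \<in> carrier ?P" "P.const (inv (a [^] m)) {#} = inv (a [^] m)"
          using am by (auto simp only: c.hom_closed Units_inv_closed) (simp add: P.const_def)
        show "q \<in> carrier ?P" using r ca by (simp add: q_def)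
        show "q {#} = \<one>" using r ca am by (simp add: q_def)
      qed
      have "q \<ominus>\<^bsub>?P\<^esub> \<one>\<^bsub>?P\<^esub> \<in> carrier ?P" "(q \<ominus>\<^bsub>?P\<^esub> \<one>\<^bsub>?P\<^esub>) {#} = \<zero>"
        using q by (simp_all add: minus_eq r_neg)
      then obtain u where u: "u \<in> carrier ?P" "u [^]\<^bsub>?P\<^esub> m = \<one>\<^bsub>?P\<^esub> \<oplus>\<^bsub>?P\<^esub> (q \<ominus>\<^bsub>?P\<^esub> \<one>\<^bsub>?P\<^esub>)"
        using power_series_root[OF _ _ unit] by blast
      then have uq: "u [^]\<^bsub>?P\<^esub> m = q" using q by (simp add: P.A.add_minus_cancel)
      have "(P.const a \<otimes>\<^bsub>?P\<^esub> u) [^]\<^bsub>?P\<^esub> m = P.const (a [^] m) \<otimes>\<^bsub>?P\<^esub> q"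
        using a u(1) by (simp add: P.A.nat_pow_distrib uq c.ring.hom_nat_pow)
      also have "\<dots> = P.const (a [^] m \<otimes> inv (a [^] m)) \<otimes>\<^bsub>?P\<^esub> r"
        unfolding q_def using am r(1) by (subst c.hom_mult) (simp_all add: P.A.m_assoc)
      also have "\<dots> = r" unfolding Units_r_inv[OF am(1)] using r(1) by simp
      finally have "f = (P.const a \<otimes>\<^bsub>?P\<^esub> u) [^]\<^bsub>?P\<^esub> m \<oplus>\<^bsub>?P\<^esub> P.const y"
        using fP y by (simp add: r_def P.A.minus_eq P.A.a_assoc P.A.l_neg)
      moreover have "P.const a \<otimes>\<^bsub>?P\<^esub> u \<in> carrier ?P" using a u(1) by simp
      ultimately show ?thesis
        unfolding a(3) using c.is_sum_of_powers_hom[OF a(4)] P.A.is_sum_of_powers_Suc_iff by blast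
    qed
  qed
qed

section \<open>Fraction fields\<close>

text \<open>\<open>F\<close> is not assumed to be a ring: every axiom is checked on images in
  \<open>L\<close> and pulled back by injectivity, so only closure and negatives have to be
  supplied.\<close>

lemma cring_via_injection:
  assumes "cring L" and inj: "inj_on \<psi> (carrier F)"
    and \<psi>: "\<And>x. x \<in> carrier F \<Longrightarrow> \<psi> x \<in> carrier L"
    and mult: "\<And>x y. x \<in> carrier F \<Longrightarrow> y \<in> carrier F \<Longrightarrow>
      x \<otimes>\<^bsub>F\<^esub> y \<in> carrier F \<and> \<psi> (x \<otimes>\<^bsub>F\<^esub> y) = \<psi> x \<otimes>\<^bsub>L\<^esub> \<psi> y"
    and add: "\<And>x y. x \<in> carrier F \<Longrightarrow> y \<in> carrier F \<Longrightarrow>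
      x \<oplus>\<^bsub>F\<^esub> y \<in> carrier F \<and> \<psi> (x \<oplus>\<^bsub>F\<^esub> y) = \<psi> x \<oplus>\<^bsub>L\<^esub> \<psi> y"
    and one: "\<one>\<^bsub>F\<^esub> \<in> carrier F" "\<psi> \<one>\<^bsub>F\<^esub> = \<one>\<^bsub>L\<^esub>"
    and zero: "\<zero>\<^bsub>F\<^esub> \<in> carrier F" "\<psi> \<zero>\<^bsub>F\<^esub> = \<zero>\<^bsub>L\<^esub>"
    and minus: "\<And>x. x \<in> carrier F \<Longrightarrow> \<exists>y\<in>carrier F. \<psi> y = \<ominus>\<^bsub>L\<^esub> \<psi> x"
  shows "cring F"
proof -
  interpret L: cring L by fact
  have eqI: "x = y" if "\<psi> x = \<psi> y" "x \<in> carrier F" "y \<in> carrier F" for x y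
    using inj that by (auto simp: inj_on_def)
  show ?thesis
  proof (rule cringI)
    show "abelian_group F"
    proof (rule abelian_groupI)
      fix x assume x: "x \<in> carrier F"
      then obtain y where y: "y \<in> carrier F" "\<psi> y = \<ominus>\<^bsub>L\<^esub> \<psi> x" using minus by blast
      have "y \<oplus>\<^bsub>F\<^esub> x = \<zero>\<^bsub>F\<^esub>"
        by (rule eqI) (use x y \<psi> add zero in \<open>auto simp: L.l_neg\<close>)
      with y show "\<exists>y\<in>carrier F. y \<oplus>\<^bsub>F\<^esub> x = \<zero>\<^bsub>F\<^esub>" by blast
    next
      fix x y z assume xyz: "x \<in> carrier F" "y \<in> carrier F" "z \<in> carrier F"
      show "x \<oplus>\<^bsub>F\<^esub> y \<oplus>\<^bsub>F\<^esub> z = x \<oplus>\<^bsub>F\<^esub> (y \<oplus>\<^bsub>F\<^esub> z)"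
        by (rule eqI) (use xyz in \<open>simp_all add: add \<psi> L.a_assoc\<close>)
    next
      fix x y assume xy: "x \<in> carrier F" "y \<in> carrier F"
      show "x \<oplus>\<^bsub>F\<^esub> y = y \<oplus>\<^bsub>F\<^esub> x"
        by (rule eqI) (use xy in \<open>simp_all add: add \<psi> L.a_comm\<close>)
    next
      fix x assume x: "x \<in> carrier F"
      show "\<zero>\<^bsub>F\<^esub> \<oplus>\<^bsub>F\<^esub> x = x"
        by (rule eqI) (use x in \<open>simp_all add: add zero \<psi>\<close>)
    qed (simp_all add: add zero)
    show "comm_monoid F"
    proof (rule comm_monoidI)
      fix x y z assume xyz: "x \<in> carrier F" "y \<in> carrier F" "z \<in> carrier F"
      show "x \<otimes>\<^bsub>F\<^esub> y \<otimes>\<^bsub>F\<^esub> z = x \<otimes>\<^bsub>F\<^esub> (y \<otimes>\<^bsub>F\<^esub> z)"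
        by (rule eqI) (use xyz in \<open>simp_all add: mult \<psi> L.m_assoc\<close>)
    next
      fix x y assume xy: "x \<in> carrier F" "y \<in> carrier F"
      show "x \<otimes>\<^bsub>F\<^esub> y = y \<otimes>\<^bsub>F\<^esub> x"
        by (rule eqI) (use xy in \<open>simp_all add: mult \<psi> L.m_comm\<close>)
    next
      fix x assume x: "x \<in> carrier F"
      show "\<one>\<^bsub>F\<^esub> \<otimes>\<^bsub>F\<^esub> x = x"
        by (rule eqI) (use x in \<open>simp_all add: mult one \<psi>\<close>)
    qed (simp_all add: mult one)
    show "(x \<oplus>\<^bsub>F\<^esub> y) \<otimes>\<^bsub>F\<^esub> z = x \<otimes>\<^bsub>F\<^esub> z \<oplus>\<^bsub>F\<^esub> y \<otimes>\<^bsub>F\<^esub> z"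
      if "x \<in> carrier F" "y \<in> carrier F" "z \<in> carrier F" for x y z
      by (rule eqI) (use that in \<open>auto simp: mult add \<psi> L.l_distr\<close>)
  qed
qed

text \<open>Fractions are compared by their values in \<open>L\<close>. This replaces the usual
  verification that \<open>frac_rel\<close> is an equivalence and that the operations are well
  defined, and absence of zero divisors in \<open>R\<close> also comes from
  \<open>L\<close>.\<close>

locale fraction_embedding = L: field L + ring_hom_cring R L \<phi>
  for R :: "('a, 'b) ring_scheme" (structure) and L :: "('c, 'd) ring_scheme" and \<phi> +
  assumes inj: "inj_on \<phi> (carrier R)"
begin

abbreviation "F \<equiv> fraction_field R"

definition quot :: "'a \<Rightarrow> 'a \<Rightarrow> 'c" where
  "quot a b = \<phi> a \<otimes>\<^bsub>L\<^esub> inv\<^bsub>L\<^esub> \<phi> b"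

text \<open>The chosen representative does not matter, since all pairs of a class have the same
  quotient in \<open>L\<close>.\<close>

definition frac_val :: "('a \<times> 'a) set \<Rightarrow> 'c" where
  "frac_val P = (case (SOME p. p \<in> P) of (a, b) \<Rightarrow> quot a b)"

abbreviation nonzero :: "'a set" where "nonzero \<equiv> carrier R - {\<zero>}"

lemma nonzero_Units:
  assumes "b \<in> nonzero"
  shows "\<phi> b \<in> Units L"
proof -
  have "\<phi> b \<noteq> \<phi> \<zero>" using inj_onD[OF inj, of b \<zero>] assms by auto
  then show ?thesis using assms L.field_Units by simp
qed

lemma quot_inverse:
  assumes "b \<in> nonzero"
  shows "inv\<^bsub>L\<^esub> \<phi> b \<in> carrier L" "\<phi> b \<otimes>\<^bsub>L\<^esub> inv\<^bsub>L\<^esub> \<phi> b = \<one>\<^bsub>L\<^esub>" "inv\<^bsub>L\<^esub> \<phi> b \<otimes>\<^bsub>L\<^esub> \<phi> b = \<one>\<^bsub>L\<^esub>"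
  using nonzero_Units[OF assms] by auto

lemma quot_closed: "a \<in> carrier R \<Longrightarrow> b \<in> nonzero \<Longrightarrow> quot a b \<in> carrier L"
  using quot_inverse by (simp add: quot_def)

lemma quot_eq_iff_mult:
  assumes "a \<in> carrier R" "b \<in> nonzero" "x \<in> carrier L"
  shows "quot a b = x \<longleftrightarrow> \<phi> a = x \<otimes>\<^bsub>L\<^esub> \<phi> b"
proof
  assume "quot a b = x"
  then show "\<phi> a = x \<otimes>\<^bsub>L\<^esub> \<phi> b"
    using assms quot_inverse[OF assms(2)] by (auto simp: quot_def L.m_assoc)
next
  assume "\<phi> a = x \<otimes>\<^bsub>L\<^esub> \<phi> b"
  then show "quot a b = x"
    using assms quot_inverse[OF assms(2)] by (auto simp: quot_def L.m_assoc)
qed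

lemma nonzero_mult:
  assumes "b \<in> nonzero" "d \<in> nonzero"
  shows "b \<otimes> d \<in> nonzero"
proof -
  have "\<phi> b \<otimes>\<^bsub>L\<^esub> \<phi> d \<noteq> \<zero>\<^bsub>L\<^esub>"
    using L.integral nonzero_Units[OF assms(1)] nonzero_Units[OF assms(2)] L.field_Units by auto
  then show ?thesis using assms by (metis Diff_iff R.m_closed empty_iff hom_mult hom_zero insert_iff)
qed

lemma one_nonzero: "\<one> \<in> nonzero"
  by (metis Diff_iff L.one_not_zero R.one_closed empty_iff hom_one hom_zero insert_iff)

lemma quot_eq_iff:
  assumes a: "a \<in> carrier R" "b \<in> nonzero" and c: "c \<in> carrier R" "d \<in> nonzero"
  shows "quot a b = quot c d \<longleftrightarrow> a \<otimes> d = c \<otimes> b"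
proof -
  have "quot a b = quot c d \<longleftrightarrow> \<phi> a = \<phi> c \<otimes>\<^bsub>L\<^esub> inv\<^bsub>L\<^esub> \<phi> d \<otimes>\<^bsub>L\<^esub> \<phi> b"
    using quot_eq_iff_mult[OF a quot_closed[OF c]] by (simp add: quot_def)
  also have "\<phi> c \<otimes>\<^bsub>L\<^esub> inv\<^bsub>L\<^esub> \<phi> d \<otimes>\<^bsub>L\<^esub> \<phi> b = \<phi> (c \<otimes> b) \<otimes>\<^bsub>L\<^esub> inv\<^bsub>L\<^esub> \<phi> d"
    using a c quot_inverse[OF c(2)] by (simp add: L.m_ac)
  also have "\<phi> a = \<phi> (c \<otimes> b) \<otimes>\<^bsub>L\<^esub> inv\<^bsub>L\<^esub> \<phi> d \<longleftrightarrow> quot (c \<otimes> b) d = \<phi> a"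
    by (auto simp: quot_def)
  also have "\<dots> \<longleftrightarrow> \<phi> (c \<otimes> b) = \<phi> a \<otimes>\<^bsub>L\<^esub> \<phi> d"
    using a c by (intro quot_eq_iff_mult) auto
  also have "\<dots> \<longleftrightarrow> \<phi> (c \<otimes> b) = \<phi> (a \<otimes> d)" using a c by simp
  also have "\<dots> \<longleftrightarrow> a \<otimes> d = c \<otimes> b" using inj_on_eq_iff[OF inj, of "c \<otimes> b" "a \<otimes> d"] a c by auto
  finally show ?thesis .
qed

lemma frac_class_eq:
  assumes "a \<in> carrier R" "b \<in> nonzero"
  shows "frac_class R a b = {(c, d). c \<in> carrier R \<and> d \<in> nonzero \<and> quot c d = quot a b}"
proof -
  have "frac_class R a b = {(c, d). c \<in> carrier R \<and> d \<in> nonzero \<and> a \<otimes> d = c \<otimes> b}"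
    unfolding frac_class_def frac_rel_def using assms by auto
  also have "\<dots> = {(c, d). c \<in> carrier R \<and> d \<in> nonzero \<and> quot a b = quot c d}"
    using quot_eq_iff[OF assms] by (intro Collect_cong) (auto simp del: Diff_iff split: prod.splits)
  finally show ?thesis by (simp only: eq_commute[of "quot a b"])
qed

lemma frac_val_frac_class:
  assumes "a \<in> carrier R" "b \<in> nonzero"
  shows "frac_val (frac_class R a b) = quot a b"
proof -
  have "(SOME p. p \<in> frac_class R a b) \<in> frac_class R a b"
    by (rule someI[of _ "(a, b)"]) (use assms in \<open>auto simp: frac_class_eq\<close>)
  then show ?thesis by (auto simp: frac_val_def frac_class_eq[OF assms])
qed

lemma frac_class_eqI:
  assumes "a \<in> carrier R" "b \<in> nonzero" "c \<in> carrier R" "d \<in> nonzero" "quot a b = quot c d"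
  shows "frac_class R a b = frac_class R c d"
  using assms by (simp add: frac_class_eq)

lemma fraction_carrier:
  "x \<in> carrier F \<longleftrightarrow> (\<exists>a\<in>carrier R. \<exists>b\<in>nonzero. x = frac_class R a b)"
  by (auto simp: fraction_field_def quotient_def frac_class_def)

text \<open>The operations of \<open>fraction_field\<close> are unions over all representatives; a
  union of equal sets over a nonempty index set is that set.\<close>

lemma frac_class_Union:
  assumes "a \<in> carrier R" "b \<in> nonzero" "c \<in> carrier R" "d \<in> nonzero"
    and "\<And>a' b' c' d'. (a', b') \<in> frac_class R a b \<Longrightarrow> (c', d') \<in> frac_class R c d \<Longrightarrow> f a' b' c' d' = C"
  shows "(\<Union>(a', b')\<in>frac_class R a b. \<Union>(c', d')\<in>frac_class R c d. f a' b' c' d') = C"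
proof -
  have "(a, b) \<in> frac_class R a b" "(c, d) \<in> frac_class R c d"
    using assms(1-4) by (auto simp: frac_class_eq)
  then show ?thesis using assms(5) by (auto split: prod.splits) blast+
qed

lemma quot_mult:
  assumes "a \<in> carrier R" "b \<in> nonzero" "c \<in> carrier R" "d \<in> nonzero"
  shows "quot (a \<otimes> c) (b \<otimes> d) = quot a b \<otimes>\<^bsub>L\<^esub> quot c d"
proof -
  have "\<phi> a \<otimes>\<^bsub>L\<^esub> \<phi> c = quot a b \<otimes>\<^bsub>L\<^esub> \<phi> b \<otimes>\<^bsub>L\<^esub> (quot c d \<otimes>\<^bsub>L\<^esub> \<phi> d)"
    using assms quot_eq_iff_mult quot_closed by metis
  then show ?thesis
    using assms quot_closed
    by (subst quot_eq_iff_mult[OF _ nonzero_mult]) (auto simp: L.m_ac)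
qed

lemma quot_add:
  assumes "a \<in> carrier R" "b \<in> nonzero" "c \<in> carrier R" "d \<in> nonzero"
  shows "quot (a \<otimes> d \<oplus> c \<otimes> b) (b \<otimes> d) = quot a b \<oplus>\<^bsub>L\<^esub> quot c d"
proof -
  have "\<phi> a = quot a b \<otimes>\<^bsub>L\<^esub> \<phi> b" "\<phi> c = quot c d \<otimes>\<^bsub>L\<^esub> \<phi> d"
    using assms quot_eq_iff_mult quot_closed by metis+
  then have "\<phi> (a \<otimes> d \<oplus> c \<otimes> b) =
      quot a b \<otimes>\<^bsub>L\<^esub> \<phi> b \<otimes>\<^bsub>L\<^esub> \<phi> d \<oplus>\<^bsub>L\<^esub> quot c d \<otimes>\<^bsub>L\<^esub> \<phi> d \<otimes>\<^bsub>L\<^esub> \<phi> b"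
    using assms by simp
  also have "\<dots> = (quot a b \<oplus>\<^bsub>L\<^esub> quot c d) \<otimes>\<^bsub>L\<^esub> \<phi> (b \<otimes> d)"
    using assms quot_closed by (simp add: L.l_distr L.r_distr L.m_ac)
  finally show ?thesis
    using assms quot_closed by (subst quot_eq_iff_mult[OF _ nonzero_mult]) auto
qed

lemma frac_class_mult:
  assumes v: "a \<in> carrier R" "b \<in> nonzero" "c \<in> carrier R" "d \<in> nonzero"
  shows "frac_class R a b \<otimes>\<^bsub>F\<^esub> frac_class R c d = frac_class R (a \<otimes> c) (b \<otimes> d)"
proof -
  have "(\<Union>(a', b')\<in>frac_class R a b. \<Union>(c', d')\<in>frac_class R c d.
      frac_class R (a' \<otimes> c') (b' \<otimes> d')) = frac_class R (a \<otimes> c) (b \<otimes> d)"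
  proof (rule frac_class_Union[OF v])
    fix a' b' c' d'
    assume "(a', b') \<in> frac_class R a b" "(c', d') \<in> frac_class R c d"
    then have v': "a' \<in> carrier R" "b' \<in> nonzero" "c' \<in> carrier R" "d' \<in> nonzero"
      and eq: "quot a' b' = quot a b" "quot c' d' = quot c d"
      using v by (auto simp: frac_class_eq)
    show "frac_class R (a' \<otimes> c') (b' \<otimes> d') = frac_class R (a \<otimes> c) (b \<otimes> d)"
      using v v' nonzero_mult by (intro frac_class_eqI) (simp_all add: quot_mult eq del: Diff_iff)
  qed
  then show ?thesis by (simp add: fraction_field_def)
qed

lemma frac_class_add:
  assumes v: "a \<in> carrier R" "b \<in> nonzero" "c \<in> carrier R" "d \<in> nonzero"
  shows "frac_class R a b \<oplus>\<^bsub>F\<^esub> frac_class R c d = frac_class R (a \<otimes> d \<oplus> c \<otimes> b) (b \<otimes> d)"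
proof -
  have "(\<Union>(a', b')\<in>frac_class R a b. \<Union>(c', d')\<in>frac_class R c d.
      frac_class R (a' \<otimes> d' \<oplus> c' \<otimes> b') (b' \<otimes> d')) = frac_class R (a \<otimes> d \<oplus> c \<otimes> b) (b \<otimes> d)"
  proof (rule frac_class_Union[OF v])
    fix a' b' c' d'
    assume "(a', b') \<in> frac_class R a b" "(c', d') \<in> frac_class R c d"
    then have v': "a' \<in> carrier R" "b' \<in> nonzero" "c' \<in> carrier R" "d' \<in> nonzero"
      and eq: "quot a' b' = quot a b" "quot c' d' = quot c d"
      using v by (auto simp: frac_class_eq)
    have "b' \<in> carrier R" "d' \<in> carrier R" "b \<in> carrier R" "d \<in> carrier R" using v v' by auto
    then show "frac_class R (a' \<otimes> d' \<oplus> c' \<otimes> b') (b' \<otimes> d') = frac_class R (a \<otimes> d \<oplus> c \<otimes> b) (b \<otimes> d)"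
      using v v' nonzero_mult by (intro frac_class_eqI) (simp_all add: quot_add eq del: Diff_iff)
  qed
  then show ?thesis by (simp add: fraction_field_def)
qed

lemma frac_val_closed: "x \<in> carrier F \<Longrightarrow> frac_val x \<in> carrier L"
  unfolding fraction_carrier using frac_val_frac_class quot_closed by metis

lemma inj_frac_val: "inj_on frac_val (carrier F)"
proof (rule inj_onI)
  fix x y assume "x \<in> carrier F" "y \<in> carrier F" and eq: "frac_val x = frac_val y"
  then obtain a b c d where v: "a \<in> carrier R" "b \<in> nonzero" "c \<in> carrier R" "d \<in> nonzero"
    and xy: "x = frac_class R a b" "y = frac_class R c d"
    unfolding fraction_carrier by blast
  show "x = y"
    using eq unfolding xy frac_val_frac_class[OF v(1,2)] frac_val_frac_class[OF v(3,4)]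
    by (rule frac_class_eqI[OF v])
qed

lemma frac_val_mult:
  assumes "x \<in> carrier F" "y \<in> carrier F"
  shows "x \<otimes>\<^bsub>F\<^esub> y \<in> carrier F \<and> frac_val (x \<otimes>\<^bsub>F\<^esub> y) = frac_val x \<otimes>\<^bsub>L\<^esub> frac_val y"
proof -
  obtain a b c d where v: "a \<in> carrier R" "b \<in> nonzero" "c \<in> carrier R" "d \<in> nonzero"
    and xy: "x = frac_class R a b" "y = frac_class R c d"
    using assms unfolding fraction_carrier by blast
  show ?thesis
    unfolding xy frac_class_mult[OF v] fraction_carrier
    using v nonzero_mult[OF v(2,4)] by (auto simp: frac_val_frac_class quot_mult simp del: Diff_iff)
qed

lemma frac_val_add:
  assumes "x \<in> carrier F" "y \<in> carrier F"
  shows "x \<oplus>\<^bsub>F\<^esub> y \<in> carrier F \<and> frac_val (x \<oplus>\<^bsub>F\<^esub> y) = frac_val x \<oplus>\<^bsub>L\<^esub> frac_val y"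
proof -
  obtain a b c d where v: "a \<in> carrier R" "b \<in> nonzero" "c \<in> carrier R" "d \<in> nonzero"
    and xy: "x = frac_class R a b" "y = frac_class R c d"
    using assms unfolding fraction_carrier by blast
  have "a \<otimes> d \<oplus> c \<otimes> b \<in> carrier R" using v by simp
  then show ?thesis
    unfolding xy frac_class_add[OF v] fraction_carrier
    using v nonzero_mult[OF v(2,4)] by (auto simp: frac_val_frac_class quot_add simp del: Diff_iff)
qed

lemma quot_one: "a \<in> carrier R \<Longrightarrow> quot a \<one> = \<phi> a"
  by (simp add: quot_def)

lemma fraction_cring: "cring F"
proof (rule cring_via_injection[OF L.is_cring inj_frac_val frac_val_closed frac_val_mult frac_val_add])
  show "\<one>\<^bsub>F\<^esub> \<in> carrier F" "\<zero>\<^bsub>F\<^esub> \<in> carrier F"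
    unfolding fraction_carrier using one_nonzero by (auto simp: fraction_field_def simp del: Diff_iff)
  show "frac_val \<one>\<^bsub>F\<^esub> = \<one>\<^bsub>L\<^esub>" "frac_val \<zero>\<^bsub>F\<^esub> = \<zero>\<^bsub>L\<^esub>"
    using one_nonzero by (simp_all add: fraction_field_def frac_val_frac_class quot_one del: Diff_iff)
  fix x assume "x \<in> carrier F"
  then obtain a b where ab: "a \<in> carrier R" "b \<in> nonzero" "x = frac_class R a b"
    unfolding fraction_carrier by blast
  have "frac_val (frac_class R (\<ominus> a) b) = \<ominus>\<^bsub>L\<^esub> frac_val x"
    using ab quot_inverse[OF ab(2)] by (simp add: frac_val_frac_class quot_def L.l_minus del: Diff_iff)
  moreover have "frac_class R (\<ominus> a) b \<in> carrier F" unfolding fraction_carrier using ab by blast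
  ultimately show "\<exists>y\<in>carrier F. frac_val y = \<ominus>\<^bsub>L\<^esub> frac_val x" by blast
qed

lemma frac_val_hom: "ring_hom_cring F L frac_val"
proof (intro ring_hom_cringI fraction_cring L.is_cring ring_hom_memI)
  show "frac_val \<one>\<^bsub>F\<^esub> = \<one>\<^bsub>L\<^esub>"
    using one_nonzero by (simp add: fraction_field_def frac_val_frac_class quot_one del: Diff_iff)
qed (use frac_val_mult frac_val_add frac_val_closed in auto)

definition to_fraction :: "'a \<Rightarrow> ('a \<times> 'a) set" where "to_fraction a = frac_class R a \<one>"

lemma frac_val_to_fraction: "a \<in> carrier R \<Longrightarrow> frac_val (to_fraction a) = \<phi> a"
  using one_nonzero by (simp add: to_fraction_def frac_val_frac_class quot_one del: Diff_iff)

lemma to_fraction_closed: "a \<in> carrier R \<Longrightarrow> to_fraction a \<in> carrier F"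
  unfolding fraction_carrier to_fraction_def using one_nonzero by blast

lemma to_fraction_hom: "ring_hom_cring R F to_fraction"
proof (intro ring_hom_cringI R.is_cring fraction_cring ring_hom_memI)
  fix a b assume ab: "a \<in> carrier R" "b \<in> carrier R"
  show "to_fraction (a \<otimes> b) = to_fraction a \<otimes>\<^bsub>F\<^esub> to_fraction b"
    unfolding to_fraction_def using ab one_nonzero by (simp add: frac_class_mult del: Diff_iff)
  show "to_fraction (a \<oplus> b) = to_fraction a \<oplus>\<^bsub>F\<^esub> to_fraction b"
    unfolding to_fraction_def using ab one_nonzero by (simp add: frac_class_add del: Diff_iff)
next
  show "to_fraction \<one> = \<one>\<^bsub>F\<^esub>" by (simp add: to_fraction_def fraction_field_def)
qed (simp add: to_fraction_closed)

text \<open>Multiplying \<open>y = a/b\<close> by \<open>(b x)\<^sup>m\<close> gives a multiple of \<open>x\<close> in \<open>R\<close>.\<close>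

lemma fraction_sum_of_powers:
  assumes x: "x \<in> nonzero" and m: "m > 0"
    and sums: "\<And>r. r \<in> carrier R \<Longrightarrow> is_sum_of_powers R m g (x \<otimes> r)"
    and y: "y \<in> carrier F"
  shows "is_sum_of_powers F m g y"
proof -
  interpret F: cring F by (rule fraction_cring)
  interpret j: ring_hom_cring R F to_fraction by (rule to_fraction_hom)
  interpret e: ring_hom_cring F L frac_val by (rule frac_val_hom)
  obtain a b where ab: "a \<in> carrier R" "b \<in> nonzero" "y = frac_class R a b"
    using y unfolding fraction_carrier by blast
  obtain k where k: "m = Suc k" using m by (cases m) auto
  let ?d = "b \<otimes> x"
  have d: "?d \<in> nonzero" "?d \<in> carrier R" "x \<in> carrier R" "b \<in> carrier R"
    using nonzero_mult[OF ab(2) x] x ab by auto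
  \<comment> \<open>Since \<open>(b x)^m (a / b) = x ((b x)^k a)\<close>, this \<open>?r\<close> is
    the cofactor of \<open>x\<close>, and \<open>?c\<close>, the inverse of \<open>b x\<close>,
    undoes the scaling.\<close>
  let ?c = "frac_class R \<one> ?d" and ?r = "?d [^] k \<otimes> a"
  have c: "?c \<in> carrier F" unfolding fraction_carrier using d by blast
  have r: "?r \<in> carrier R" using d ab by simp
  have ec: "frac_val ?c = inv\<^bsub>L\<^esub> \<phi> ?d" "inv\<^bsub>L\<^esub> \<phi> ?d \<in> carrier L" "inv\<^bsub>L\<^esub> \<phi> ?d \<otimes>\<^bsub>L\<^esub> \<phi> ?d = \<one>\<^bsub>L\<^esub>"
    using d quot_inverse[OF d(1)] by (auto simp: frac_val_frac_class quot_def simp del: Diff_iff hom_mult)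
  \<comment> \<open>The identity is verified in \<open>L\<close>, where inverses are available, and
    pulled back by injectivity of \<open>frac_val\<close>.\<close>
  have "frac_val (?c [^]\<^bsub>F\<^esub> m \<otimes>\<^bsub>F\<^esub> to_fraction (x \<otimes> ?r))
      = (inv\<^bsub>L\<^esub> \<phi> ?d) [^]\<^bsub>L\<^esub> m \<otimes>\<^bsub>L\<^esub> (\<phi> x \<otimes>\<^bsub>L\<^esub> (\<phi> ?d [^]\<^bsub>L\<^esub> k \<otimes>\<^bsub>L\<^esub> \<phi> a))"
    using c r d ab
    by (simp add: frac_val_to_fraction e.ring.hom_nat_pow ec(1) ring.hom_nat_pow del: hom_mult j.hom_mult)
      (simp add: ring.hom_nat_pow)
  also have "\<dots> = (inv\<^bsub>L\<^esub> \<phi> ?d \<otimes>\<^bsub>L\<^esub> \<phi> ?d) [^]\<^bsub>L\<^esub> k \<otimes>\<^bsub>L\<^esub> (inv\<^bsub>L\<^esub> \<phi> ?d \<otimes>\<^bsub>L\<^esub> (\<phi> x \<otimes>\<^bsub>L\<^esub> \<phi> a))"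
    using ec(2) d ab by (simp add: k L.nat_pow_distrib L.m_ac del: hom_mult)
  also have "\<dots> = \<phi> (x \<otimes> a) \<otimes>\<^bsub>L\<^esub> inv\<^bsub>L\<^esub> \<phi> ?d"
    unfolding ec(3) using ec(2) d ab by (simp add: L.m_comm)
  also have "\<dots> = quot (x \<otimes> a) ?d" by (simp only: quot_def)
  also have "\<dots> = quot a b"
    using d ab by (subst quot_eq_iff) (auto simp: R.m_ac simp del: Diff_iff)
  also have "\<dots> = frac_val y" using ab by (simp add: frac_val_frac_class del: Diff_iff)
  finally have "?c [^]\<^bsub>F\<^esub> m \<otimes>\<^bsub>F\<^esub> to_fraction (x \<otimes> ?r) = y"
    using inj_frac_val c y r d(3) by (simp add: inj_on_def)
  moreover have "is_sum_of_powers F m g (to_fraction (x \<otimes> ?r))"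
    by (rule j.is_sum_of_powers_hom[OF sums[OF r]])
  ultimately show ?thesis using F.is_sum_of_powers_mult_power[OF c] by metis
qed

end

lemma field_imp_cring: "field R \<Longrightarrow> cring R"
  by (simp add: field_def domain_def)

section \<open>Reduction to exponents prime to the characteristic\<close>

lemma (in ring_hom_cring) hom_add_pow_one: "h (add_pow R (n::nat) \<one>) = add_pow S n \<one>\<^bsub>S\<^esub>"
  by (induction n) (simp_all add: R.add.nat_pow_0 S.add.nat_pow_0 R.add.nat_pow_Suc S.add.nat_pow_Suc)

text \<open>The numbers that annihilate one are the multiples of its additive order, so their gcd is
  this order, with 0 standing for infinite order.\<close>

lemma (in domain) ring_char_dvd_iff: "add_pow R (n::nat) \<one> = \<zero> \<longleftrightarrow> ring_char R dvd n"
proof -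
  let ?o = "group.ord (add_monoid R) \<one>"
  have o: "add_pow R (n::nat) \<one> = \<zero> \<longleftrightarrow> ?o dvd n" for n
    using group.pow_eq_id[OF a_group, of \<one> n] by (simp add: add_pow_def)
  have "ring_char R = ?o"
    unfolding ring_char_def o by (rule dvd_antisym) (auto intro: Gcd_dvd Gcd_greatest)
  with o show ?thesis by simp
qed

lemma (in domain) ring_char_prime:
  assumes "ring_char R \<noteq> 0"
  shows "Factorial_Ring.prime (ring_char R)"
proof (rule normalization_semidom_class.primeI[OF comm_semiring_1_class.prime_elemI])
  show "\<not> ring_char R dvd 1"
    using ring_char_dvd_iff[of 1] one_not_zero by simp
  fix a b assume "ring_char R dvd a * b"
  then have "add_pow R (a * b) \<one> = \<zero>" by (simp only: ring_char_dvd_iff)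
  also have "add_pow R (a * b) \<one> = add_pow R a \<one> \<otimes> add_pow R b \<one>"
    by (simp add: add_pow_ldistr add.nat_pow_pow mult.commute)
  finally show "ring_char R dvd a \<or> ring_char R dvd b"
    using integral by (simp only: ring_char_dvd_iff[symmetric]) (metis add.nat_pow_closed one_closed)
qed (use assms in auto)

text \<open>The last alternative speaks of a prime \<open>p\<close> with \<open>p 1 = 0\<close>
  instead of the characteristic, since such an equation passes along homomorphisms. Characteristic
  zero falls under \<open>m = n\<close>.\<close>

lemma (in domain) free_part_cases:
  assumes n: "n > 0" and m: "m = free_part (ring_char R) n"
  shows "m > 0" "add_pow R m \<one> \<noteq> \<zero>"
    "m = n \<or> (\<exists>p j. Factorial_Ring.prime p \<and> add_pow R p \<one> = \<zero> \<and> n = p ^ j * m)"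
proof -
  let ?p = "ring_char R"
  have "m > 0 \<and> add_pow R m \<one> \<noteq> \<zero> \<and>
    (m = n \<or> (\<exists>p j. Factorial_Ring.prime p \<and> add_pow R p \<one> = \<zero> \<and> n = p ^ j * m))"
  proof (cases "?p = 0")
    case True
    then show ?thesis using n m by (simp add: free_part_def ring_char_dvd_iff)
  next
    case False
    then have p: "Factorial_Ring.prime ?p" by (rule ring_char_prime)
    have m': "m = n div ?p ^ multiplicity ?p n" using m False by (simp add: free_part_def)
    have nm: "n = ?p ^ multiplicity ?p n * m"
      unfolding m' using multiplicity_dvd[of ?p n] by simp
    have "\<not> ?p dvd m"
      unfolding m' using n p by (intro multiplicity_decompose) auto
    moreover have "m > 0" using nm n by (cases m) auto
    moreover have "add_pow R ?p \<one> = \<zero>" by (simp add: ring_char_dvd_iff)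
    ultimately show ?thesis using p nm unfolding ring_char_dvd_iff by blast
  qed
  then show "m > 0" "add_pow R m \<one> \<noteq> \<zero>"
    "m = n \<or> (\<exists>p j. Factorial_Ring.prime p \<and> add_pow R p \<one> = \<zero> \<and> n = p ^ j * m)"
    by auto
qed

text \<open>The equation \<open>p 1 = 0\<close> passes from \<open>R\<close> to \<open>S\<close>, so
  the free part taken over the base serves for every domain above it, without computing the
  characteristic of \<open>S\<close>.\<close>

lemma (in ring_hom_cring) level_waring_free_part:
  assumes "domain R" "domain S" "n > 0"
  shows "level n S = level (free_part (ring_char R) n) S"
    and "waring_number n S = waring_number (free_part (ring_char R) n) S"
proof -
  let ?m = "free_part (ring_char R) n"
  note cases = domain.free_part_cases[OF assms(1,3) refl]
  have "level n S = level ?m S \<and> waring_number n S = waring_number ?m S"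
  proof (cases "?m = n")
    case False
    then obtain p j where p: "Factorial_Ring.prime p" "add_pow R p \<one> = \<zero>" "n = p ^ j * ?m"
      using cases(3) by blast
    have "add_pow S p \<one>\<^bsub>S\<^esub> = \<zero>\<^bsub>S\<^esub>" using hom_add_pow_one[of p] p(2) by simp
    from domain.level_waring_frobenius[OF assms(2) p(1) this cases(1), of j] show ?thesis
      unfolding p(3)[symmetric] by simp
  qed simp
  then show "level n S = level ?m S" "waring_number n S = waring_number ?m S" by auto
qed

section \<open>Iterated Laurent series\<close>

text \<open>Needed because every step of \<open>iterated_laurent\<close> is transported along an
  injection.\<close>

lemma level_waring_iso:
  assumes R: "cring R" and S: "cring S" and h: "h \<in> ring_iso R S" and n: "n > 0"
  shows "level n R = level n S" "waring_number n R = waring_number n S"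
proof -
  interpret R: cring R by fact
  interpret S: cring S by fact
  interpret h: ring_hom_cring R S h
    using h by (intro ring_hom_cringI R S) (simp add: ring_iso_def)
  have h': "inv_into (carrier R) h \<in> ring_iso S R"
    by (rule ring_iso_set_sym[OF R.ring_axioms h])
  interpret h': ring_hom_cring S R "inv_into (carrier R) h"
    using h' by (intro ring_hom_cringI R S) (simp add: ring_iso_def)
  show "level n R = level n S"
    using h.level_hom_le[OF n] h'.level_hom_le[OF n] by (rule antisym[rotated])
  have bij: "bij_betw h (carrier R) (carrier S)" using h by (simp add: ring_iso_def)
  have hh': "inv_into (carrier R) h (h x) = x" if "x \<in> carrier R" for x
    using bij that by (simp add: bij_betw_def)
  have h'h: "h (inv_into (carrier R) h x) = x" if "x \<in> carrier S" for x
    using bij that by (metis bij_betw_def f_inv_into_f)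
  have iff: "is_sum_of_powers R n g x \<longleftrightarrow> is_sum_of_powers S n g (h x)" if "x \<in> carrier R" for x g
    using h.is_sum_of_powers_hom[of n g x] h'.is_sum_of_powers_hom[of n g "h x"] hh'[OF that] by auto
  have "(\<forall>x k. is_sum_of_powers R n k x \<longrightarrow> is_sum_of_powers R n g x) \<longleftrightarrow>
      (\<forall>x k. is_sum_of_powers S n k x \<longrightarrow> is_sum_of_powers S n g x)" for g
  proof safe
    fix x k assume all: "\<forall>x k. is_sum_of_powers R n k x \<longrightarrow> is_sum_of_powers R n g x"
      and sx: "is_sum_of_powers S n k x"
    have "is_sum_of_powers R n g (inv_into (carrier R) h x)"
      using all h'.is_sum_of_powers_hom[OF sx] by blast
    from h.is_sum_of_powers_hom[OF this] show "is_sum_of_powers S n g x"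
      using h'h[OF S.is_sum_of_powers_closed[OF sx]] by simp
  next
    fix x k assume all: "\<forall>x k. is_sum_of_powers S n k x \<longrightarrow> is_sum_of_powers S n g x"
      and sx: "is_sum_of_powers R n k x"
    have "is_sum_of_powers S n g (h x)" using all h.is_sum_of_powers_hom[OF sx] by blast
    then show "is_sum_of_powers R n g x" using iff[OF R.is_sum_of_powers_closed[OF sx]] by simp
  qed
  then show "waring_number n R = waring_number n S"
    by (intro enat_eqI) (simp only: R.waring_number_le_iff[OF n] S.waring_number_le_iff[OF n])
qed

lemma iterated_laurent_field:
  assumes "field k"
  shows "field (iterated_laurent k s)"
proof (induction s)
  case 0
  then show ?case
    using field.inj_imp_image_ring_is_field[OF assms inj_on_subset[OF inj_const_list]] by simp
next
  case (Suc s)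
  then show ?case
    using field.inj_imp_image_ring_is_field[OF field.laurent_field inj_on_subset[OF inj_uncurry_list]]
    by simp
qed

text \<open>The mere existence of a map from \<open>k\<close> is enough: it reduces the exponent and
  keeps \<open>m\<close> nonzero.\<close>

lemma iterated_laurent_const_hom:
  assumes "field k"
  shows "\<exists>\<sigma>. ring_hom_cring k (iterated_laurent k s) \<sigma>"
proof (induction s)
  case 0
  have "ring_hom_cring k (iterated_laurent k 0) (const_list k)"
    using iterated_laurent_0_iso[of k] field_imp_cring[OF iterated_laurent_field[OF assms, of 0]]
      field_imp_cring[OF assms]
    by (intro ring_hom_cringI) (auto simp: ring_iso_def)
  then show ?case by blast
next
  case (Suc s)
  then obtain \<sigma> where \<sigma>: "ring_hom_cring k (iterated_laurent k s) \<sigma>" by blast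
  interpret K: field "iterated_laurent k s" by (rule iterated_laurent_field[OF assms])
  obtain \<tau> where \<tau>: "\<tau> \<in> ring_hom (iterated_laurent k s) (laurent_ring (iterated_laurent k s))"
    using ring_hom_cring.homh[OF K.laurent_const_hom] by blast
  have "uncurry_list k \<circ> (\<tau> \<circ> \<sigma>) \<in> ring_hom k (iterated_laurent k (Suc s))"
    using ring_hom_trans[OF ring_hom_trans[OF ring_hom_cring.homh[OF \<sigma>] \<tau>]]
      iterated_laurent_Suc_iso[of k s] by (auto simp: ring_iso_def)
  then have "ring_hom_cring k (iterated_laurent k (Suc s)) (uncurry_list k \<circ> (\<tau> \<circ> \<sigma>))"
    by (intro ring_hom_cringI field_imp_cring[OF assms] field_imp_cring[OF iterated_laurent_field[OF assms]])
  then show ?case by blast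
qed

lemma laurent_iterated_laurent_level_waring:
  assumes "field k" "n > 0"
  shows "level n (iterated_laurent k (Suc s)) = level n (laurent_ring (iterated_laurent k s))"
    and "waring_number n (iterated_laurent k (Suc s)) = waring_number n (laurent_ring (iterated_laurent k s))"
  using level_waring_iso[OF field_imp_cring[OF field.laurent_field[OF iterated_laurent_field[OF assms(1)]]]
      field_imp_cring[OF iterated_laurent_field[OF assms(1)]] iterated_laurent_Suc_iso assms(2)]
  by auto

lemma iterated_laurent_level:
  assumes "field k" "m > 0"
  shows "level m (iterated_laurent k s) = level m k"
proof (induction s)
  case 0
  show ?case
    by (rule level_waring_iso(1)[OF _ _ iterated_laurent_0_iso assms(2), symmetric])
      (rule field_imp_cring[OF assms(1)], rule field_imp_cring[OF iterated_laurent_field[OF assms(1)]])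
next
  case (Suc s)
  then show ?case
    using laurent_iterated_laurent_level_waring(1)[OF assms]
      field.laurent_level[OF iterated_laurent_field[OF assms(1)] assms(2)] by simp
qed

section \<open>Embedding power series into iterated Laurent series\<close>

lemma inj_power_series_coeff_empty:
  fixes R :: "('a, 'b) ring_scheme"
  shows "inj_on (\<lambda>f :: 'v multiset \<Rightarrow> 'a. f {#}) (carrier (power_series_ring R {}))"
proof (rule inj_onI, rule ext)
  fix f g :: "'v multiset \<Rightarrow> 'a" and e
  assume "f \<in> carrier (power_series_ring R {})" "g \<in> carrier (power_series_ring R {})" "f {#} = g {#}"
  then show "f e = g e" by (cases "e = {#}") (auto simp: power_series_ring_simps)
qed

text \<open>The two claims feed each other: expanding along the variable \<open>Suc s\<close> leads
  from the first to the second, and \<open>uncurry_list\<close> repackages the second as the first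
  for \<open>Suc s\<close>. The second still shows the last variable as a uniformizer.\<close>

lemma power_series_iterated_laurent_embedding:
  assumes "field k"
  shows "\<exists>\<phi>. \<phi> \<in> ring_hom (power_series_ring k {1..s}) (iterated_laurent k s) \<and>
    inj_on \<phi> (carrier (power_series_ring k {1..s}))"
    and "\<exists>\<phi>. \<phi> \<in> ring_hom (power_series_ring k {1..Suc s}) (laurent_ring (iterated_laurent k s)) \<and>
    inj_on \<phi> (carrier (power_series_ring k {1..Suc s})) \<and>
    \<phi> (\<lambda>e. if e = {#Suc s#} then \<one>\<^bsub>k\<^esub> else \<zero>\<^bsub>k\<^esub>) = cring.laurent_monom (iterated_laurent k s) 1"
proof -
  interpret k: field k by fact
  let ?A = "\<lambda>s \<phi>. \<phi> \<in> ring_hom (power_series_ring k {1..s}) (iterated_laurent k s) \<and>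
    inj_on \<phi> (carrier (power_series_ring k {1..s}))"
  let ?B = "\<lambda>s \<phi>. \<phi> \<in> ring_hom (power_series_ring k {1..Suc s}) (laurent_ring (iterated_laurent k s)) \<and>
    inj_on \<phi> (carrier (power_series_ring k {1..Suc s})) \<and>
    \<phi> (\<lambda>e. if e = {#Suc s#} then \<one>\<^bsub>k\<^esub> else \<zero>\<^bsub>k\<^esub>) = cring.laurent_monom (iterated_laurent k s) 1"
  have AB: "\<exists>\<psi>. ?B s \<psi>" if "?A s \<phi>" for s \<phi>
  proof -
    interpret K: field "iterated_laurent k s" by (rule iterated_laurent_field[OF assms])
    interpret E: power_series_expansion k "iterated_laurent k s" "Suc s" "{1..s}" \<phi>
      using that by unfold_locales auto
    have "insert (Suc s) {1..s} = {1..Suc s}" by auto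
    then have "?B s E.expansion"
      using E.expansion_hom E.inj_expansion E.expansion_variable that
      by (simp add: K.laurent_monom_def)
    then show ?thesis by blast
  qed
  have BA: "\<exists>\<phi>. ?A (Suc s) \<phi>" if "?B s \<psi>" for s \<psi>
  proof -
    have u: "uncurry_list k \<in> ring_hom (laurent_ring (iterated_laurent k s)) (iterated_laurent k (Suc s))"
      using iterated_laurent_Suc_iso[of k s] by (simp add: ring_iso_def)
    have "uncurry_list k \<circ> \<psi> \<in> ring_hom (power_series_ring k {1..Suc s}) (iterated_laurent k (Suc s))"
      using ring_hom_trans[OF _ u] that by blast
    moreover have "inj_on (uncurry_list k \<circ> \<psi>) (carrier (power_series_ring k {1..Suc s}))"
      using that by (intro comp_inj_on inj_on_subset[OF inj_uncurry_list]) auto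
    ultimately show ?thesis by blast
  qed
  \<comment> \<open>Without variables a series is its constant term, so evaluation is
    injective.\<close>
  have "\<exists>\<phi>. ?A 0 \<phi>"
  proof -
    interpret ev: ring_hom_cring "power_series_ring k {1..0::nat}" k "\<lambda>f. f {#}"
      by (rule k.power_series_coeff_empty_hom)
    have c: "const_list k \<in> ring_hom k (iterated_laurent k 0)"
      using iterated_laurent_0_iso[of k] by (simp add: ring_iso_def)
    have "const_list k \<circ> (\<lambda>f. f {#}) \<in> ring_hom (power_series_ring k {1..0::nat}) (iterated_laurent k 0)"
      by (rule ring_hom_trans[OF ev.homh c])
    moreover have "inj_on (\<lambda>f. f {#}) (carrier (power_series_ring k {1..0::nat}))"
      using inj_power_series_coeff_empty by simp
    then have "inj_on (const_list k \<circ> (\<lambda>f. f {#})) (carrier (power_series_ring k {1..0::nat}))"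
      by (intro comp_inj_on inj_on_subset[OF inj_const_list]) auto
    ultimately show ?thesis by blast
  qed
  then have A: "\<exists>\<phi>. ?A s \<phi>" for s
    by (induction s) (use AB BA in blast)+
  show "\<exists>\<phi>. ?A s \<phi>" by (rule A)
  show "\<exists>\<phi>. ?B s \<phi>" using A AB by blast
qed

lemma (in cring) power_series_variable:
  assumes "y \<in> I"
  shows "(\<lambda>e. if e = {#y#} then \<one> else \<zero>) \<in> carrier (power_series_ring R I)"
  using assms by (auto simp: power_series_ring_simps)

lemma (in field) laurent_waring_number:
  assumes m: "m > 1" and char: "add_pow R m \<one> \<noteq> \<zero>" and g: "level m R = enat g"
  shows "waring_number m (laurent_ring R) = level m R + 1"
proof -
  interpret L: convolution_ring R "laurent_ring R" by (rule laurent_convolution_ring)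
  have m0: "m > 0" using m by simp
  have unit: "add_pow R m \<one> \<in> Units R" using char field_Units by auto
  have sg: "is_sum_of_powers R m g (\<ominus> \<one>)" using level_le_iff[OF m0, of g] g by simp
  show ?thesis
    by (rule L.A.waring_number_eqI[OF m0 g laurent_sum_of_powers[OF unit m0 sg]
          laurent_monom_closed laurent_variable_sum_of_powers[OF m]])
qed

text \<open>The separate field \<open>K\<close> lets this cover both power series rings of the
  theorem: \<open>s\<close> variables over \<open>k\<close>, with \<open>K\<close> the
  \<open>(s-1)\<close>-fold iteration, and one variable over \<open>R = K\<close>. The series
  \<open>t\<close> is the variable that becomes the uniformizer of \<open>K((x))\<close>.\<close>

lemma (in field) power_series_fraction_field:
  assumes L: "field K" and hom: "\<phi> \<in> ring_hom (power_series_ring R I) (laurent_ring K)"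
    and inj: "inj_on \<phi> (carrier (power_series_ring R I))"
    and t: "t \<in> carrier (power_series_ring R I)" "t {#} = \<zero>" "\<phi> t = cring.laurent_monom K 1"
    and lev: "level m K = level m R" and m: "m > 0"
  defines "P \<equiv> power_series_ring R I"
  shows "domain P" "domain (fraction_field P)"
    "\<exists>\<sigma>. ring_hom_cring R P \<sigma>" "\<exists>\<sigma>. ring_hom_cring R (fraction_field P) \<sigma>"
    "level m P = level m R" "level m (fraction_field P) = level m R"
    "m > 1 \<Longrightarrow> add_pow R m \<one> \<noteq> \<zero> \<Longrightarrow> level m R < \<infinity> \<Longrightarrow>
      waring_number m P = max (waring_number m R) (level m R + 1) \<and>
      waring_number m (fraction_field P) = level m R + 1"
proof -
  interpret K: field K by fact
  interpret L: field "laurent_ring K" by (rule K.laurent_field)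
  interpret P: convolution_ring R P unfolding P_def by (rule power_series_convolution_ring)
  interpret c: ring_hom_cring R P P.const unfolding P_def by (rule power_series_const_hom)
  interpret f: fraction_embedding P "laurent_ring K" \<phi>
    using hom inj unfolding P_def[symmetric] by unfold_locales
  interpret F: cring "fraction_field P" by (rule f.fraction_cring)
  interpret j: ring_hom_cring P "fraction_field P" f.to_fraction by (rule f.to_fraction_hom)
  interpret e: ring_hom_cring "fraction_field P" "laurent_ring K" f.frac_val by (rule f.frac_val_hom)
  show "domain P" by (rule f.ring.inj_on_domain[OF f.inj L.domain_axioms])
  show "domain (fraction_field P)" by (rule e.ring.inj_on_domain[OF f.inj_frac_val L.domain_axioms])
  show "\<exists>\<sigma>. ring_hom_cring R P \<sigma>" using c.ring_hom_cring_axioms by blast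
  have "f.to_fraction \<circ> P.const \<in> ring_hom R (fraction_field P)"
    by (rule ring_hom_trans[OF c.homh j.homh])
  then show "\<exists>\<sigma>. ring_hom_cring R (fraction_field P) \<sigma>"
    using ring_hom_cringI[OF is_cring F.is_cring] by blast
  \<comment> \<open>The maps from \<open>R\<close> to \<open>P\<close>, on to the fraction field and
    on to \<open>K((x))\<close> squeeze both levels, because the two ends have equal level.\<close>
  have "level m R \<le> level m (fraction_field P)"
    using e.level_hom_le[OF m] K.laurent_level[OF m] lev by simp
  moreover have "level m (fraction_field P) \<le> level m P" by (rule j.level_hom_le[OF m])
  moreover have "level m P \<le> level m R" by (rule c.level_hom_le[OF m])
  ultimately show levels: "level m P = level m R" "level m (fraction_field P) = level m R" by auto
  assume m1: "m > 1" and char: "add_pow R m \<one> \<noteq> \<zero>" and "level m R < \<infinity>"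
  then obtain g where g: "level m R = enat g" by auto
  have unit: "add_pow R m \<one> \<in> Units R" using char field_Units by auto
  have sg: "is_sum_of_powers R m g (\<ominus> \<one>)" using level_le_iff[OF m, of g] g by simp
  have tP: "t \<in> carrier P" using t(1) by (simp add: P_def)
  \<comment> \<open>Any representation of \<open>t\<close> in \<open>P\<close> or in its fraction
    field is carried to one of the uniformizer, where valuations apply.\<close>
  have lower: "level m R + 1 \<le> enat h" if "is_sum_of_powers (laurent_ring K) m h (\<phi> t)" for h
    using K.laurent_variable_sum_of_powers[OF m1, of h] that unfolding t(3) lev by blast
  \<comment> \<open>Multiples of \<open>t\<close> have zero constant term; this is the input for
    clearing denominators.\<close>
  have "is_sum_of_powers P m (Suc g) (t \<otimes>\<^bsub>P\<^esub> r)" if r: "r \<in> carrier P" for r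
  proof -
    interpret ev: ring_hom_cring P R "\<lambda>f. f {#}"
      unfolding P_def by (rule power_series_coeff_empty_hom)
    have "(t \<otimes>\<^bsub>P\<^esub> r) {#} = \<zero>" using ev.hom_mult[OF tP r] ev.hom_closed[OF r] t(2) by simp
    moreover have "t \<otimes>\<^bsub>P\<^esub> r \<in> carrier P" using tP r by simp
    ultimately show ?thesis
      using power_series_sum_of_powers[OF _ _ unit sg] unfolding P_def by blast
  qed
  moreover have "t \<noteq> \<zero>\<^bsub>P\<^esub>"
  proof
    assume "t = \<zero>\<^bsub>P\<^esub>"
    then have "cring.laurent_monom K 1 = \<zero>\<^bsub>laurent_ring K\<^esub>" using f.hom_zero t(3) by simp
    then have "K.laurent_monom 1 1 = \<zero>\<^bsub>laurent_ring K\<^esub> 1" by (rule fun_cong)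
    then show False by (simp add: K.laurent_monom_def laurent_ring_simps)
  qed
  ultimately have all: "is_sum_of_powers (fraction_field P) m (Suc g) y"
    if "y \<in> carrier (fraction_field P)" for y
    using f.fraction_sum_of_powers[of t m "Suc g" y] tP m that by blast
  have "waring_number m (fraction_field P) = level m R + 1"
  proof (rule F.waring_number_eqI[OF m g all j.hom_closed[OF tP]])
    fix h assume "is_sum_of_powers (fraction_field P) m h (f.to_fraction t)"
    from e.is_sum_of_powers_hom[OF this] show "level m R + 1 \<le> enat h"
      using lower f.frac_val_to_fraction[OF tP] by simp
  qed
  moreover have "waring_number m P = max (waring_number m R) (level m R + 1)"
    unfolding P_def
  proof (rule power_series_waring_number[OF m char g t(1,2)])
    fix h assume "is_sum_of_powers (power_series_ring R I) m h t"
    then show "level m R + 1 \<le> enat h"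
      using lower f.is_sum_of_powers_hom unfolding P_def by blast
  qed
  ultimately show "waring_number m P = max (waring_number m R) (level m R + 1) \<and>
      waring_number m (fraction_field P) = level m R + 1" by blast
qed

section \<open>The level and Waring formulas for the rings over \<open>k\<close>\<close>

theorem theorem6p1:
  fixes k :: "('a, 'b) ring_scheme" and n s m :: nat
  assumes "field k"
    and "n > 0" and "s > 0"
    and "m = free_part (ring_char k) n"
  shows
    "level n (power_series_ring k {1..s}) = level n (fraction_field (power_series_ring k {1..s}))
     \<and> level n (fraction_field (power_series_ring k {1..s})) = level n (iterated_laurent k s)
     \<and> level n (iterated_laurent k s) = level m k
     \<and> (level n k < \<infinity> \<longrightarrow>
          waring_number n (power_series_ring k {1..s})
            = (if m > 1 then max (waring_number m k) (level m k + 1) else 1)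
        \<and> waring_number n (fraction_field (power_series_ring k {1..s}))
            = waring_number n (iterated_laurent k s)
        \<and> waring_number n (iterated_laurent k s)
            = (if m > 1 then level m k + 1 else 1)
        \<and> waring_number n (power_series_ring (iterated_laurent k s) {s + 1})
            = (if m > 1 then level m k + 1 else 1))"
proof -
  let ?P = "power_series_ring k {1..s}" and ?J = "iterated_laurent k s"
  let ?F = "fraction_field ?P" and ?Q = "power_series_ring ?J {s + 1}"
  interpret k: field k by fact
  note m = k.free_part_cases(1,2)[OF assms(2,4)]
  \<comment> \<open>The last variable is separated, as it serves as the uniformizer over the other
    \<open>s'\<close> variables.\<close>
  obtain s' where s: "s = Suc s'" using assms(3) by (cases s) auto
  let ?K = "iterated_laurent k s'"
  interpret K: field ?K by (rule iterated_laurent_field[OF assms(1)])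
  interpret J: field ?J by (rule iterated_laurent_field[OF assms(1)])
  have lev: "level m ?J = level m k" "level m ?K = level m k"
    using iterated_laurent_level[OF assms(1) m(1)] by auto
  obtain \<sigma> \<tau> where \<sigma>: "ring_hom_cring k ?J \<sigma>" and \<tau>: "ring_hom_cring k ?K \<tau>"
    using iterated_laurent_const_hom[OF assms(1)] by blast
  \<comment> \<open>\<open>m\<close> is nonzero in \<open>k\<close>, hence invertible, and a ring
    homomorphism keeps it invertible.\<close>
  have char: "add_pow L m \<one>\<^bsub>L\<^esub> \<noteq> \<zero>\<^bsub>L\<^esub>"
    if "field L" "ring_hom_cring k L \<rho>" for L :: "(int list \<Rightarrow> 'a) ring" and \<rho>
  proof -
    interpret L: field L by fact
    interpret \<rho>: ring_hom_cring k L \<rho> by fact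
    have "\<rho> (inv\<^bsub>k\<^esub> add_pow k m \<one>\<^bsub>k\<^esub>) \<otimes>\<^bsub>L\<^esub> \<rho> (add_pow k m \<one>\<^bsub>k\<^esub>) = \<one>\<^bsub>L\<^esub>"
      using m(2) k.field_Units by (simp flip: \<rho>.hom_mult)
    moreover have "\<rho> (inv\<^bsub>k\<^esub> add_pow k m \<one>\<^bsub>k\<^esub>) \<in> carrier L"
      using m(2) k.field_Units by (intro \<rho>.hom_closed) auto
    ultimately show ?thesis by (auto simp: \<rho>.hom_add_pow_one)
  qed
  obtain \<phi> where "\<phi> \<in> ring_hom ?P (laurent_ring ?K)" "inj_on \<phi> (carrier ?P)"
    "\<phi> (\<lambda>e. if e = {#s#} then \<one>\<^bsub>k\<^esub> else \<zero>\<^bsub>k\<^esub>) = cring.laurent_monom ?K 1"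
    using power_series_iterated_laurent_embedding(2)[OF assms(1), of s'] unfolding s by blast
  note \<phi> = this
  define x where "x = (\<lambda>e. if e = {#s#} then \<one>\<^bsub>k\<^esub> else \<zero>\<^bsub>k\<^esub>)"
  have x: "x \<in> carrier ?P" "x {#} = \<zero>\<^bsub>k\<^esub>" "\<phi> x = cring.laurent_monom ?K 1"
    unfolding x_def using k.power_series_variable[of s "{1..s}"] assms(3) \<phi>(3) by auto
  note P = k.power_series_fraction_field[OF K.field_axioms \<phi>(1,2) x lev(2) m(1)]
  \<comment> \<open>The extra variable is expanded over \<open>?J\<close> itself; with no other
    variables the coefficient map is evaluation at the constant term.\<close>
  interpret E: power_series_expansion ?J ?J "s + 1" "{}" "\<lambda>f. f {#}"
    using ring_hom_cring.homh[OF J.power_series_coeff_empty_hom[of "{}"]] by unfold_locales auto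
  define z where "z = (\<lambda>e. if e = {#s + 1#} then \<one>\<^bsub>?J\<^esub> else \<zero>\<^bsub>?J\<^esub>)"
  have z: "z \<in> carrier ?Q" "z {#} = \<zero>\<^bsub>?J\<^esub>" "E.expansion z = J.laurent_monom 1"
    unfolding z_def using J.power_series_variable[of "s + 1" "{s + 1}"] E.expansion_variable
    by (auto simp: J.laurent_monom_def)
  note Q = J.power_series_fraction_field[OF J.field_axioms E.expansion_hom
      E.inj_expansion[OF inj_power_series_coeff_empty] z refl m(1)]
  \<comment> \<open>One reduction for all rings: it asks only for a domain with a homomorphism from
    \<open>k\<close>, and the free part refers to the characteristic of \<open>k\<close>.\<close>
  have red: "level n L = level m L \<and> waring_number n L = waring_number m L"
    if "domain L" "\<exists>\<rho>. ring_hom_cring k L \<rho>" for L :: "('x, 'y) ring_scheme"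
    using ring_hom_cring.level_waring_free_part[OF _ k.domain_axioms that(1) assms(2)] that(2)
    unfolding assms(4) by blast
  obtain \<rho> where \<rho>: "ring_hom_cring ?J ?Q \<rho>" using Q(3) by blast
  have "\<rho> \<circ> \<sigma> \<in> ring_hom k ?Q"
    by (rule ring_hom_trans[OF ring_hom_cring.homh[OF \<sigma>] ring_hom_cring.homh[OF \<rho>]])
  then have "\<exists>\<rho>. ring_hom_cring k ?Q \<rho>"
    using ring_hom_cringI[OF k.is_cring domain.axioms(1)[OF Q(1)]] by blast
  note red_Q = red[OF Q(1) this]
  have "\<exists>\<rho>. ring_hom_cring k k \<rho>"
    using ring_hom_cringI[OF k.is_cring k.is_cring id_ring_hom] by blast
  note red_k = red[OF k.domain_axioms this]
  have red_J: "level n ?J = level m ?J" "waring_number n ?J = waring_number m ?J"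
    using red[OF J.domain_axioms] \<sigma> by blast+
  note red_P = red[OF P(1,3)] and red_F = red[OF P(2,4)]
  have levels: "level n ?P = level m k" "level n ?F = level m k" "level n ?J = level m k"
    using red_P red_F red_J(1) P(5,6) lev(1) by auto
  have waring: "waring_number n ?P = (if m > 1 then max (waring_number m k) (level m k + 1) else 1)
      \<and> waring_number n ?F = (if m > 1 then level m k + 1 else 1)
      \<and> waring_number n ?J = (if m > 1 then level m k + 1 else 1)
      \<and> waring_number n ?Q = (if m > 1 then level m k + 1 else 1)"
    if "level n k < \<infinity>"
  proof (cases "m > 1")
    case False
    then have "m = 1" using m(1) by simp
    then show ?thesis
      using red_P red_F red_J red_Q cring.waring_number_1[OF domain.axioms(1)[OF P(1)]]
        cring.waring_number_1[OF domain.axioms(1)[OF P(2)]] J.waring_number_1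
        cring.waring_number_1[OF domain.axioms(1)[OF Q(1)]] by simp
  next
    case True
    \<comment> \<open>Finiteness is assumed for exponent \<open>n\<close>; over \<open>k\<close> the
      levels for \<open>n\<close> and \<open>m\<close> agree.\<close>
    have fin: "level m k < \<infinity>" using that red_k by simp
    then obtain g where g: "level m ?K = enat g" using lev(2) by auto
    have "waring_number m ?J = level m k + 1"
      using laurent_iterated_laurent_level_waring(2)[OF assms(1) m(1), of s']
        K.laurent_waring_number[OF True char[OF K.field_axioms \<tau>] g] lev(2)
      unfolding s by simp
    \<comment> \<open>For \<open>?Q\<close> the maximum compares \<open>waring_number m ?J\<close>
      with \<open>level m ?J + 1\<close>, and these have just been seen to be equal.\<close>
    then show ?thesis
      using red_P red_F red_J red_Q True P(7)[OF True m(2) fin]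
        Q(7)[OF True char[OF J.field_axioms \<sigma>]] fin lev(1) by simp
  qed
  show ?thesis using levels waring by simp
qed

end
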